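(* Let $\mathbb{K}$ be an algebraically closed field of characteristic zero. Let $X$ be the trinomial hypersurface in $\mathbb{K}^n$ given by $f=T_0^{l_0}+T_1^{l_1}+T_2^{l_2}$. Assume that (i) $l_{ij}\ge 2$ for all $i=0,1,2$ and $j=1,\dots,n_i$; (ii) the numbers $d_i=\gcd(l_{i1},\dots,l_{in_i})$, $i=0,1,2$, are pairwise coprime. Then the automorphism group $\mathrm{Aut}(X)$ is isomorphic to the semidirect product $P(f)\ltimes\mathbb{T}$ (with $\mathbb{T}$ the normal factor), where $\mathbb{T}$ is the maximal torus in $\mathrm{Aut}(X)$ and $P(f)$ is the permutation group of the trinomial $f$.
   Context: $\mathrm{Aut}(X)$ is the group of all algebraic automorphisms of $X$. A subtorus of $\mathrm{Aut}(X)$ is a subgroup with a structure of an algebraic group isomorphic to $(\mathbb{K}^{\times})^s$ for some $s$ such that its action on $X$ is a morphism; the maximal torus in $\mathrm{Aut}(X)$ is the subtorus containing all other subtori (it exists and is unique for rigid affine varieties, i.e. irreducible affine varieties with no nontrivial regular action of $(\mathbb{K},+)$; hypersurfaces as in the claim are rigid). Trinomials: fix positive integers $n_0,n_1,n_2$, put $n=n_0+n_1+n_2$, and for each $i=0,1,2$ fix a tuple $l_i=(l_{i1},\dots,l_{in_i})\in\mathbb{Z}_{>0}^{n_i}$. Put $T_i^{l_i}:=T_{i1}^{l_{i1}}\cdots T_{in_i}^{l_{in_i}}\in\mathbb{K}[T_{ij};\ i=0,1,2,\ j=1,\dots,n_i]$. A trinomial is a polynomial $f=T_0^{l_0}+T_1^{l_1}+T_2^{l_2}$;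 its zero set in $\mathbb{K}^n$ is a trinomial hypersurface. The permutation group $P(f)$ is the group of all permutations $\tau$ of the $n$ variables $T_{ij}$ such that the induced automorphism of $\mathbb{K}[T_{ij}]$ satisfies $\tau(f)=f$; it acts on $X$ by permuting coordinates, and on $\mathbb{T}$ by conjugation in $\mathrm{Aut}(X)$. *)

theory Defs
  imports
    "HOL-Algebra.Bij"
    "HOL-Algebra.Product_Groups"
    "HOL-Combinatorics.Permutations"
    "HOL-Computational_Algebra.Polynomial"
    "HOL-Library.Poly_Mapping"
begin

section \<open>Polynomials in several variables\<close>

type_synonym ('v, 'k) mpoly = "('v \<Rightarrow>\<^sub>0 nat) \<Rightarrow>\<^sub>0 'k"

definition mvar :: "'v \<Rightarrow> ('v, 'k::comm_ring_1) mpoly"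
  where "mvar v = Poly_Mapping.single (Poly_Mapping.single v 1) 1"

definition mconst :: "'k \<Rightarrow> ('v, 'k::comm_ring_1) mpoly"
  where "mconst c = Poly_Mapping.single 0 c"

definition mvars :: "('v, 'k::comm_ring_1) mpoly \<Rightarrow> 'v set"
  where "mvars p = (\<Union>m\<in>Poly_Mapping.keys p. Poly_Mapping.keys m)"

definition meval :: "('v, 'k::comm_ring_1) mpoly \<Rightarrow> ('v \<Rightarrow> 'k) \<Rightarrow> 'k"
  where "meval p x = (\<Sum>m\<in>Poly_Mapping.keys p. Poly_Mapping.lookup p m *
           (\<Prod>v\<in>Poly_Mapping.keys m. x v ^ Poly_Mapping.lookup m v))"

text \<open>The \<open>'k\<close>-algebra endomorphism with \<open>mvar v \<mapsto> mvar (\<tau> v)\<close>.\<close>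
definition mrename :: "('v \<Rightarrow> 'v) \<Rightarrow> ('v, 'k::comm_ring_1) mpoly \<Rightarrow> ('v, 'k) mpoly"
  where "mrename \<tau> p = (\<Sum>m\<in>Poly_Mapping.keys p. mconst (Poly_Mapping.lookup p m) *
           (\<Prod>v\<in>Poly_Mapping.keys m. mvar (\<tau> v) ^ Poly_Mapping.lookup m v))"


section \<open>Closed subsets of affine space and their automorphisms\<close>

text \<open>The affine space with coordinates indexed by a set \<open>V\<close> is \<open>V \<rightarrow>\<^sub>E UNIV\<close>. Since a closed
  subset \<open>X\<close> does not determine \<open>V\<close> syntactically, \<open>V\<close> is passed along explicitly.\<close>

definition zero_set :: "'v set \<Rightarrow> ('v, 'k::comm_ring_1) mpoly \<Rightarrow> ('v \<Rightarrow> 'k) set"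
  where "zero_set V p = {x \<in> V \<rightarrow>\<^sub>E UNIV. meval p x = 0}"

definition regular_fun :: "'v set \<Rightarrow> ('v \<Rightarrow> 'k::comm_ring_1) set \<Rightarrow> (('v \<Rightarrow> 'k) \<Rightarrow> 'k) \<Rightarrow> bool"
  where "regular_fun V X g \<longleftrightarrow> (\<exists>p. mvars p \<subseteq> V \<and> (\<forall>x\<in>X. g x = meval p x))"

definition regular_map ::
    "'v set \<Rightarrow> ('v \<Rightarrow> 'k::comm_ring_1) set \<Rightarrow> (('v \<Rightarrow> 'k) \<Rightarrow> ('v \<Rightarrow> 'k)) \<Rightarrow> bool"
  where "regular_map V X \<phi> \<longleftrightarrow> (\<forall>v\<in>V. regular_fun V X (\<lambda>x. \<phi> x v))"

definition aut_group ::
    "'v set \<Rightarrow> ('v \<Rightarrow> 'k::comm_ring_1) set \<Rightarrow> (('v \<Rightarrow> 'k) \<Rightarrow> ('v \<Rightarrow> 'k)) monoid"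
  where "aut_group V X = (BijGroup X)
    \<lparr>carrier := {\<phi> \<in> Bij X. regular_map V X \<phi> \<and> regular_map V X (inv_into X \<phi>)}\<rparr>"


section \<open>Tori of automorphisms\<close>

definition mult_group :: "'k::field monoid"
  where "mult_group = \<lparr>carrier = UNIV - {0}, monoid.mult = (*), one = 1\<rparr>"

abbreviation std_torus :: "nat \<Rightarrow> (nat \<Rightarrow> 'k::field) monoid"
  where "std_torus s \<equiv> product_group {..<s} (\<lambda>_. mult_group)"

text \<open>The map \<open>std_torus s \<times> X \<rightarrow> X, (t, x) \<mapsto> \<psi> t x\<close> is a morphism of affine varieties. The
  regular functions on \<open>std_torus s \<times> X\<close> are the polynomials in the coordinates of \<open>t\<close>, their
  inverses, and the coordinates of \<open>x\<close>; the three blocks of variables are tagged by a sum type.\<close>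
definition morphic_torus_action ::
    "'v set \<Rightarrow> ('v \<Rightarrow> 'k::field) set \<Rightarrow> nat \<Rightarrow> ((nat \<Rightarrow> 'k) \<Rightarrow> ('v \<Rightarrow> 'k) \<Rightarrow> ('v \<Rightarrow> 'k)) \<Rightarrow> bool"
  where "morphic_torus_action V X s \<psi> \<longleftrightarrow>
    (\<forall>v\<in>V. \<exists>p :: (nat + nat + 'v, 'k) mpoly. mvars p \<subseteq> {..<s} <+> {..<s} <+> V \<and>
      (\<forall>t\<in>carrier (std_torus s). \<forall>x\<in>X.
         \<psi> t x v = meval p (case_sum t (case_sum (\<lambda>k. inverse (t k)) x))))"

definition is_subtorus ::
    "'v set \<Rightarrow> ('v \<Rightarrow> 'k::field) set \<Rightarrow> (('v \<Rightarrow> 'k) \<Rightarrow> ('v \<Rightarrow> 'k)) set \<Rightarrow> bool"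
  where "is_subtorus V X T \<longleftrightarrow> subgroup T (aut_group V X) \<and>
    (\<exists>s. \<exists>\<psi>\<in>iso (std_torus s) ((aut_group V X)\<lparr>carrier := T\<rparr>). morphic_torus_action V X s \<psi>)"

definition is_maximal_torus ::
    "'v set \<Rightarrow> ('v \<Rightarrow> 'k::field) set \<Rightarrow> (('v \<Rightarrow> 'k) \<Rightarrow> ('v \<Rightarrow> 'k)) set \<Rightarrow> bool"
  where "is_maximal_torus V X T \<longleftrightarrow> is_subtorus V X T \<and> (\<forall>S. is_subtorus V X S \<longrightarrow> S \<subseteq> T)"


section \<open>Semidirect products\<close>

text \<open>Meaningful when \<open>\<theta> \<in> hom H (AutoGroup N)\<close>; the pair \<open>(h, n)\<close> stands for the product \<open>n h\<close>,
  and \<open>N\<close> is the normal factor.\<close>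
definition semidirect_product ::
    "('h, 'c) monoid_scheme \<Rightarrow> ('n, 'd) monoid_scheme \<Rightarrow> ('h \<Rightarrow> 'n \<Rightarrow> 'n) \<Rightarrow> ('h \<times> 'n) monoid"
  where "semidirect_product H N \<theta> =
    \<lparr>carrier = carrier H \<times> carrier N,
     monoid.mult = (\<lambda>(h, m) (h', m'). (h \<otimes>\<^bsub>H\<^esub> h', m \<otimes>\<^bsub>N\<^esub> \<theta> h m')),
     one = (\<one>\<^bsub>H\<^esub>, \<one>\<^bsub>N\<^esub>)\<rparr>"


section \<open>Trinomials and their permutation groups\<close>

definition trinomial_vars :: "(nat \<Rightarrow> nat) \<Rightarrow> (nat \<times> nat) set"
  where "trinomial_vars n = (SIGMA i:{0..2}. {1..n i})"

definition trinomial :: "(nat \<Rightarrow> nat) \<Rightarrow> (nat \<Rightarrow> nat \<Rightarrow> nat) \<Rightarrow> (nat \<times> nat, 'k::comm_ring_1) mpoly"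
  where "trinomial n l = (\<Sum>i=0..2. \<Prod>j=1..n i. mvar (i, j) ^ l i j)"

definition perm_group :: "'v set \<Rightarrow> ('v, 'k::comm_ring_1) mpoly \<Rightarrow> ('v \<Rightarrow> 'v) monoid"
  where "perm_group V f =
    \<lparr>carrier = {\<tau>. \<tau> permutes V \<and> mrename \<tau> f = f}, monoid.mult = (\<circ>), one = id\<rparr>"

text \<open>The inverse makes this a left action.\<close>
definition perm_aut ::
    "'v set \<Rightarrow> ('v \<Rightarrow> 'k) set \<Rightarrow> ('v \<Rightarrow> 'v) \<Rightarrow> ('v \<Rightarrow> 'k) \<Rightarrow> ('v \<Rightarrow> 'k)"
  where "perm_aut V X \<tau> = (\<lambda>x\<in>X. \<lambda>v\<in>V. x (Hilbert_Choice.inv \<tau> v))"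

definition conj_action ::
    "'v set \<Rightarrow> ('v \<Rightarrow> 'k::comm_ring_1) set \<Rightarrow> (('v \<Rightarrow> 'k) \<Rightarrow> ('v \<Rightarrow> 'k)) set \<Rightarrow>
     ('v \<Rightarrow> 'v) \<Rightarrow> (('v \<Rightarrow> 'k) \<Rightarrow> ('v \<Rightarrow> 'k)) \<Rightarrow> (('v \<Rightarrow> 'k) \<Rightarrow> ('v \<Rightarrow> 'k))"
  where "conj_action V X T \<tau> = (\<lambda>t\<in>T. perm_aut V X \<tau> \<otimes>\<^bsub>aut_group V X\<^esub> t
           \<otimes>\<^bsub>aut_group V X\<^esub> inv\<^bsub>aut_group V X\<^esub> (perm_aut V X \<tau>))"

end

theory Submission
  imports Defs "HOL-Library.Function_Algebras" "HOL-Library.Countable"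
begin

text \<open>
  The heart of the matter is that every automorphism of the hypersurface maps each coordinate function
  to a constant multiple of a coordinate function (\<open>\<Phi>_T\<close>). Then the induced permutation of the variables
  fixes the trinomial, and the constants form an element of the diagonal torus
  \<open>{c. c\<^bsup>l\<^sub>0\<^esup> = c\<^bsup>l\<^sub>1\<^esup> = c\<^bsup>l\<^sub>2\<^esup>}\<close> (\<open>monomial_form\<close>). So the automorphism group is the semidirect product of the
  finite group of permutations with the diagonal torus. A subtorus is divisible, has trivial image in
  the finite quotient, and therefore lies in the diagonal torus (\<open>subtorus_le_Tor\<close>). As the gcds are
  pairwise coprime, the diagonal torus is connected, and it is parametrized by a product of copies of
  the multiplicative group through Laurent monomials (\<open>torus_parametrization\<close>).

  The diagonal torus grades the coordinate ring. Its general orbits have codimension one, and a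
  homogeneous function is a monomial times a binary form in two of the three monomials of the trinomial
  (\<open>homogeneous_form\<close>). Two facts about degrees follow from all exponents being at least two and the gcds
  being coprime: a coordinate function is, up to constants, the only function of its degree (\<open>H_dg\<close>),
  whereas the functions of the degree of the trinomial form a two-dimensional space, the pencil.

  An automorphism conjugates an infinitesimal torus action to a locally finite derivation. Its
  homogeneous component of extreme degree is locally nilpotent unless the degree is zero
  (\<open>top_component_lnd\<close>). By rigidity there is no nonzero homogeneous locally nilpotent derivation, hence the
  conjugate preserves degrees and the coordinate functions are its eigenvectors. Going back, the
  automorphism maps coordinate functions to homogeneous elements. These are irreducible, so they are
  multiples of coordinate functions or belong to the pencil, and the latter is excluded by the dimensions
  above.

  Rigidity has two steps. First, the kernel of a homogeneous locally nilpotent derivation contains an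
  element of the pencil (\<open>pencil_meets_kernel\<close>): otherwise the kernel would be spanned by monomials, and
  a count of weights shows that it would be too small. Second, if an element of the pencil is in the
  kernel, then the derivatives of two of the monomials of the trinomial are proportional. A comparison
  of degrees in the style of Mason and Stothers shows that they are zero (\<open>proportional_mod_kernel\<close>), and
  then the derivation is zero, because its kernel is factorially closed. This uses that variables from
  different groups are coprime in the coordinate ring (\<open>coprime_groups\<close>), which is read off from normal
  forms.
\<close>


section \<open>Locally nilpotent derivations\<close>

text \<open>Subrings are handled as subsets of a ring type, because the coordinate ring of a hypersurface
  depends on parameters and cannot be a type.\<close>
locale ring_subset =
  fixes A :: "'a::{comm_ring_1,ring_char_0} set"
  assumes one_in [simp, intro]: "1 \<in> A"
    and add_in [simp, intro]: "a \<in> A \<Longrightarrow> b \<in> A \<Longrightarrow> a + b \<in> A"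
    and mult_in [simp, intro]: "a \<in> A \<Longrightarrow> b \<in> A \<Longrightarrow> a * b \<in> A"
    and neg_in [simp, intro]: "a \<in> A \<Longrightarrow> - a \<in> A"
begin

lemma zero_in [simp, intro]: "0 \<in> A"
  using add_in[OF one_in neg_in[OF one_in]] by simp

lemma diff_in [simp, intro]: "a \<in> A \<Longrightarrow> b \<in> A \<Longrightarrow> a - b \<in> A"
  using add_in[of a "- b"] by simp

lemma sum_in [intro]: "(\<And>i. i \<in> I \<Longrightarrow> f i \<in> A) \<Longrightarrow> sum f I \<in> A"
  by (induction I rule: infinite_finite_induct) auto

lemma prod_in [intro]: "(\<And>i. i \<in> I \<Longrightarrow> f i \<in> A) \<Longrightarrow> prod f I \<in> A"
  by (induction I rule: infinite_finite_induct) auto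

lemma power_in [simp, intro]: "a \<in> A \<Longrightarrow> a ^ n \<in> A"
  by (induction n) auto

lemma of_nat_in [simp, intro]: "of_nat n \<in> A"
  by (induction n) auto

end

locale derivation_on = ring_subset A for A :: "'a::{comm_ring_1,ring_char_0} set" +
  fixes D :: "'a \<Rightarrow> 'a"
  assumes D_in [simp, intro]: "a \<in> A \<Longrightarrow> D a \<in> A"
    and D_add: "a \<in> A \<Longrightarrow> b \<in> A \<Longrightarrow> D (a + b) = D a + D b"
    and D_mult: "a \<in> A \<Longrightarrow> b \<in> A \<Longrightarrow> D (a * b) = D a * b + a * D b"
begin

lemma D_0 [simp]: "D 0 = 0"
  using D_add[of 0 0] by simp

lemma D_1 [simp]: "D 1 = 0"
  using D_mult[of 1 1] by simp

lemma D_sum: "(\<And>i. i \<in> I \<Longrightarrow> f i \<in> A) \<Longrightarrow> D (sum f I) = (\<Sum>i\<in>I. D (f i))"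
  by (induction I rule: infinite_finite_induct) (auto simp: D_add sum_in)

lemma D_prod_zero: "(\<And>i. i \<in> I \<Longrightarrow> f i \<in> A) \<Longrightarrow> (\<And>i. i \<in> I \<Longrightarrow> D (f i) = 0) \<Longrightarrow> D (prod f I) = 0"
  by (induction I rule: infinite_finite_induct) (auto simp: D_mult prod_in)

lemma D_power_zero: "a \<in> A \<Longrightarrow> D a = 0 \<Longrightarrow> D (a ^ n) = 0"
  by (induction n) (auto simp: D_mult)

text \<open>Stated with \<open>a ^ n\<close> in front: a derivation lowers the exponent of a factor by at most one.
  The next lemma extends this to monomials.\<close>
lemma D_power_Suc: "a \<in> A \<Longrightarrow> D (a ^ Suc n) = a ^ n * (of_nat (Suc n) * D a)"
proof (induction n)
  case (Suc n)
  have "D (a ^ Suc (Suc n)) = D a * a ^ Suc n + a * D (a ^ Suc n)"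
    using Suc.prems D_mult[of a "a ^ Suc n"] by simp
  also have "\<dots> = a ^ Suc n * (of_nat (Suc (Suc n)) * D a)"
    unfolding Suc.IH[OF Suc.prems] by (simp add: algebra_simps)
  finally show ?case .
qed simp

text \<open>A derivative of a monomial is divisible by the monomial divided by its radical.\<close>
lemma D_prod_powers_dvd:
  assumes "finite I" "\<And>i. i \<in> I \<Longrightarrow> f i \<in> A" "\<And>i. i \<in> I \<Longrightarrow> e i \<ge> (1::nat)"
  shows "\<exists>g\<in>A. D (\<Prod>i\<in>I. f i ^ e i) = (\<Prod>i\<in>I. f i ^ (e i - 1)) * g"
  using assms
proof (induction I rule: finite_induct)
  case empty
  then show ?case by auto
next
  case (insert i I)
  then obtain g where g: "g \<in> A" "D (\<Prod>i\<in>I. f i ^ e i) = (\<Prod>i\<in>I. f i ^ (e i - 1)) * g"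
    by (metis insertCI)
  obtain k where k: "e i = Suc k"
    using insert.prems(2)[of i] by (cases "e i") auto
  let ?P = "\<Prod>i\<in>I. f i ^ e i" and ?Q = "\<Prod>i\<in>I. f i ^ (e i - 1)" and ?R = "\<Prod>i\<in>I. f i"
  have P: "?P = ?Q * ?R"
    unfolding prod.distrib[symmetric]
  proof (rule prod.cong)
    fix x assume "x \<in> I"
    then have "e x \<ge> 1" using insert.prems(2) by auto
    then show "f x ^ e x = f x ^ (e x - 1) * f x"
      by (metis Suc_diff_le diff_Suc_Suc minus_nat.diff_0 One_nat_def power_Suc2)
  qed simp
  have in1: "f i \<in> A" "?P \<in> A" "?R \<in> A" using insert.prems(1) by auto
  have "D (f i ^ Suc k * ?P) = f i ^ k * (of_nat (Suc k) * D (f i)) * ?P + f i ^ Suc k * (?Q * g)"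
    using in1 D_mult[of "f i ^ Suc k" ?P] D_power_Suc[of "f i" k] g(2) by (simp del: power_Suc)
  also have "\<dots> = (f i ^ k * ?Q) * (of_nat (Suc k) * D (f i) * ?R + f i * g)"
    unfolding P by (simp add: algebra_simps)
  finally show ?case
    using insert.hyps k in1 g(1)
    by (intro bexI[of _ "of_nat (Suc k) * D (f i) * ?R + f i * g"]) (auto simp del: of_nat_Suc)
qed

lemma iter_in [simp, intro]: "a \<in> A \<Longrightarrow> (D ^^ n) a \<in> A"
  by (induction n) auto

lemma iter_0 [simp]: "(D ^^ n) 0 = 0"
  by (induction n) auto

lemma iter_add: "a \<in> A \<Longrightarrow> b \<in> A \<Longrightarrow> (D ^^ n) (a + b) = (D ^^ n) a + (D ^^ n) b"
  by (induction n) (auto simp: D_add)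

lemma iter_zero_mono: "(D ^^ n) a = 0 \<Longrightarrow> n \<le> m \<Longrightarrow> (D ^^ m) a = 0"
  by (induction m) (auto simp: le_Suc_eq)

lemma iter_const_mult: "c \<in> A \<Longrightarrow> D c = 0 \<Longrightarrow> a \<in> A \<Longrightarrow> (D ^^ n) (c * a) = c * (D ^^ n) a"
  by (induction n) (auto simp: D_mult)

text \<open>In the general Leibniz rule all terms but one vanish when the order of differentiation is the sum
  of the nilpotency orders of the two factors.\<close>
lemma iter_mult_top:
  assumes "a \<in> A" "b \<in> A" "(D ^^ Suc i) a = 0" "(D ^^ Suc j) b = 0"
  shows "(D ^^ (i + j)) (a * b) = of_nat ((i + j) choose i) * (D ^^ i) a * (D ^^ j) b \<and>
         (D ^^ Suc (i + j)) (a * b) = 0"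
  using assms
proof (induction "i + j" arbitrary: a b i j)
  case 0
  then show ?case by (auto simp: D_mult)
next
  case (Suc n)
  note swap = funpow_Suc_right o_apply
  have Dab: "D (a * b) = D a * b + a * D b"
    using Suc.prems by (simp add: D_mult)
  have z1: "(D ^^ Suc (i - 1)) (D a) = 0" if "i > 0"
    using Suc.prems(3) that by (simp add: funpow_swap1)
  have z2: "(D ^^ Suc (j - 1)) (D b) = 0" if "j > 0"
    using Suc.prems(4) that by (simp add: funpow_swap1)
  have eq1: "(D ^^ n) (D a * b) = of_nat (n choose (i - 1)) * (D ^^ i) a * (D ^^ j) b \<and>
       (D ^^ Suc n) (D a * b) = 0" if "i > 0"
  proof -
    have n: "n = (i - 1) + j" using that Suc.hyps(2) by simp
    have "(D ^^ (i - 1)) (D a) = (D ^^ i) a"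
      using that by (metis Suc_diff_1 funpow_swap1 funpow.simps(2) o_apply)
    then show ?thesis
      using Suc.hyps(1)[OF n D_in[OF Suc.prems(1)] Suc.prems(2) z1[OF that] Suc.prems(4)] n
      by (simp del: funpow.simps)
  qed
  have eq2: "(D ^^ n) (a * D b) = of_nat (n choose i) * (D ^^ i) a * (D ^^ j) b \<and>
       (D ^^ Suc n) (a * D b) = 0" if "j > 0"
  proof -
    have n: "n = i + (j - 1)" using that Suc.hyps(2) by simp
    have "(D ^^ (j - 1)) (D b) = (D ^^ j) b"
      using that by (metis Suc_diff_1 funpow_swap1 funpow.simps(2) o_apply)
    then show ?thesis
      using Suc.hyps(1)[OF n Suc.prems(1) D_in[OF Suc.prems(2)] Suc.prems(3) z2[OF that]] n
      by (simp del: funpow.simps)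
  qed
  have split: "(D ^^ Suc m) (a * b) = (D ^^ m) (D a * b) + (D ^^ m) (a * D b)" for m
    unfolding funpow_Suc_right o_apply Dab using Suc.prems by (intro iter_add) auto
  consider "i = 0" "j > 0" | "i > 0" "j = 0" | "i > 0" "j > 0"
    using Suc.hyps(2) by (cases i; cases j) auto
  then show ?case
  proof cases
    case 1
    then have "D a = 0" "j = Suc n" using Suc.prems Suc.hyps(2) by auto
    then show ?thesis
      using split[of n] split[of "Suc n"] eq2 1 by (simp del: funpow.simps)
  next
    case 2
    then have "D b = 0" "i = Suc n" using Suc.prems Suc.hyps(2) by auto
    then show ?thesis
      using split[of n] split[of "Suc n"] eq1 2 by (simp del: funpow.simps)
  next
    case 3
    have "(i + j choose i) = (n choose (i - 1)) + (n choose i)"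
      using 3 Suc.hyps(2) by (metis Suc_diff_1 binomial_Suc_Suc)
    then show ?thesis
      using split[of n] split[of "Suc n"] eq1[OF 3(1)] eq2[OF 3(2)] Suc.hyps(2)
      by (simp del: funpow.simps add: algebra_simps)
  qed
qed

end

locale lnd = derivation_on A D for A :: "'a::{comm_ring_1,ring_char_0} set" and D +
  assumes nzd: "a \<in> A \<Longrightarrow> b \<in> A \<Longrightarrow> a * b = 0 \<Longrightarrow> a = 0 \<or> b = 0"
    and nil: "a \<in> A \<Longrightarrow> \<exists>n. (D ^^ n) a = 0"
begin

text \<open>The degree function of a locally nilpotent derivation: the largest \<open>n\<close> with \<open>D\<^sup>n a \<noteq> 0\<close>, and \<open>0\<close> for
  \<open>a = 0\<close>.\<close>
definition ldeg :: "'a \<Rightarrow> nat"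
  where "ldeg a = (LEAST n. (D ^^ Suc n) a = 0)"

text \<open>The last nonzero iterate, an element of the kernel.\<close>
definition ltop :: "'a \<Rightarrow> 'a"
  where "ltop a = (D ^^ ldeg a) a"

lemma iter_ldeg: "a \<in> A \<Longrightarrow> (D ^^ Suc (ldeg a)) a = 0"
proof -
  assume a: "a \<in> A"
  obtain n where "(D ^^ n) a = 0" using nil[OF a] by blast
  then have "(D ^^ Suc n) a = 0" by simp
  then show ?thesis unfolding ldeg_def by (rule LeastI)
qed

lemma ldeg_less: "(D ^^ n) a = 0 \<Longrightarrow> a \<noteq> 0 \<Longrightarrow> ldeg a < n"
proof -
  assume "(D ^^ n) a = 0" "a \<noteq> 0"
  then obtain m where "n = Suc m" by (cases n) auto
  then show ?thesis
    using \<open>(D ^^ n) a = 0\<close> unfolding ldeg_def by (auto simp del: funpow.simps intro: le_imp_less_Suc Least_le)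
qed

lemma ltop_nonzero: "a \<noteq> 0 \<Longrightarrow> ltop a \<noteq> 0"
  unfolding ltop_def using ldeg_less[of "ldeg a" a] by auto

lemma ltop_in [simp, intro]: "a \<in> A \<Longrightarrow> ltop a \<in> A"
  unfolding ltop_def by auto

lemma D_ltop: "a \<in> A \<Longrightarrow> D (ltop a) = 0"
  using iter_ldeg unfolding ltop_def by simp

lemma ldeg_eqI: "(D ^^ n) a \<noteq> 0 \<Longrightarrow> (D ^^ Suc n) a = 0 \<Longrightarrow> ldeg a = n"
  unfolding ldeg_def by (rule Least_equality) (assumption, rule ccontr, meson iter_zero_mono not_less_eq_eq)

lemma ldeg_0_iff: "a \<in> A \<Longrightarrow> ldeg a = 0 \<longleftrightarrow> D a = 0"
  using iter_ldeg[of a] by (cases "a = 0") (auto simp: ldeg_def Least_eq_0 intro: ccontr)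

lemma nonzero_mult: "a \<in> A \<Longrightarrow> b \<in> A \<Longrightarrow> a \<noteq> 0 \<Longrightarrow> b \<noteq> 0 \<Longrightarrow> a * b \<noteq> 0"
  using nzd by blast

text \<open>The binomial coefficient in \<open>iter_mult_top\<close> does not vanish in characteristic zero, so the top
  derivative of a product is a nonzero multiple of the product of the top derivatives.\<close>
lemma ldeg_ltop_mult:
  assumes "a \<in> A" "b \<in> A" "a \<noteq> 0" "b \<noteq> 0"
  shows "ldeg (a * b) = ldeg a + ldeg b"
    and "\<exists>c>0. ltop (a * b) = of_nat c * (ltop a * ltop b)"
proof -
  let ?i = "ldeg a" and ?j = "ldeg b"
  have *: "(D ^^ (?i + ?j)) (a * b) = of_nat ((?i + ?j) choose ?i) * ltop a * ltop b"
    "(D ^^ Suc (?i + ?j)) (a * b) = 0"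
    using iter_mult_top[OF assms(1,2) iter_ldeg[OF assms(1)] iter_ldeg[OF assms(2)]]
    unfolding ltop_def by auto
  have pos: "((?i + ?j) choose ?i) > 0" by simp
  have "of_nat ((?i + ?j) choose ?i) * ltop a * ltop b \<noteq> 0"
    using pos assms by (intro nonzero_mult ltop_nonzero) (auto simp: ltop_nonzero)
  then show d: "ldeg (a * b) = ldeg a + ldeg b"
    using * by (intro ldeg_eqI) auto
  show "\<exists>c>0. ltop (a * b) = of_nat c * (ltop a * ltop b)"
    using pos *(1) d unfolding ltop_def[of "a * b"]
    by (intro exI[of _ "(?i + ?j) choose ?i"]) (auto simp: mult.assoc)
qed

lemma power_nonzero: "a \<in> A \<Longrightarrow> a \<noteq> 0 \<Longrightarrow> a ^ n \<noteq> 0"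
  by (induction n) (simp_all add: nonzero_mult)

lemma ldeg_one: "ldeg 1 = 0"
  by (simp add: ldeg_0_iff)

lemma ldeg_ltop_power:
  assumes "a \<in> A" "a \<noteq> 0"
  shows "ldeg (a ^ n) = n * ldeg a"
    and "\<exists>c>0. ltop (a ^ n) = of_nat c * ltop a ^ n"
proof -
  have "ldeg (a ^ n) = n * ldeg a \<and> (\<exists>c>0. ltop (a ^ n) = of_nat c * ltop a ^ n)"
  proof (induction n)
    case 0
    have "ltop (a ^ 0) = of_nat 1 * ltop a ^ 0"
      by (simp add: ldeg_one ltop_def)
    then show ?case
      by (intro conjI exI[of _ 1]) (simp_all add: ldeg_one)
  next
    case (Suc n)
    then obtain c where c: "c > 0" "ltop (a ^ n) = of_nat c * ltop a ^ n" by (elim exE conjE)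
    obtain c' where c': "c' > 0" "ltop (a * a ^ n) = of_nat c' * (ltop a * ltop (a ^ n))"
      using ldeg_ltop_mult(2)[OF assms(1) power_in[OF assms(1)] assms(2) power_nonzero[OF assms(1,2), of n]]
      by (elim exE conjE)
    have "ltop (a ^ Suc n) = of_nat (c' * c) * ltop a ^ Suc n"
      unfolding power_Suc c'(2) c(2) of_nat_mult by (simp only: ac_simps)
    moreover have "ldeg (a * a ^ n) = ldeg a + ldeg (a ^ n)"
      by (intro ldeg_ltop_mult power_in power_nonzero assms)
    ultimately show ?case
      using Suc.IH c(1) c'(1) by (intro conjI exI[of _ "c' * c"]) simp_all
  qed
  then show "ldeg (a ^ n) = n * ldeg a" "\<exists>c>0. ltop (a ^ n) = of_nat c * ltop a ^ n"
    by auto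
qed

lemma ldeg_D:
  assumes "a \<in> A" "D a \<noteq> 0"
  shows "ldeg a = Suc (ldeg (D a))"
proof (rule ldeg_eqI)
  have *: "(D ^^ Suc n) a = (D ^^ n) (D a)" for n
    by (simp add: funpow_swap1)
  show "(D ^^ Suc (ldeg (D a))) a \<noteq> 0"
    using ltop_nonzero[OF assms(2)] unfolding ltop_def * .
  show "(D ^^ Suc (Suc (ldeg (D a)))) a = 0"
    using iter_ldeg[OF D_in[OF assms(1)]] unfolding * .
qed

text \<open>Degrees are natural numbers and add up under multiplication: a product of degree zero has factors
  of degree zero only. So the kernel is factorially closed.\<close>
lemma ldeg_factor:
  assumes "a \<in> A" "b \<in> A" "a * b \<noteq> 0" "D (a * b) = 0"
  shows "D a = 0"
proof -
  have "a \<noteq> 0" "b \<noteq> 0" using assms by auto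
  then have "ldeg a + ldeg b = 0"
    using ldeg_ltop_mult(1)[OF assms(1,2)] assms ldeg_0_iff[of "a * b"] by auto
  then show ?thesis using ldeg_0_iff assms by auto
qed

lemma ldeg_prod:
  "finite I \<Longrightarrow> (\<And>i. i \<in> I \<Longrightarrow> f i \<in> A) \<Longrightarrow> (\<And>i. i \<in> I \<Longrightarrow> f i \<noteq> 0) \<Longrightarrow>
    prod f I \<noteq> 0 \<and> ldeg (prod f I) = (\<Sum>i\<in>I. ldeg (f i))"
  by (induction I rule: finite_induct) (auto simp: ldeg_one ldeg_ltop_mult(1) prod_in nonzero_mult)

end

section \<open>Gradings by an ordered group and locally finite derivations\<close>

text \<open>A grading given by its projections \<open>cmp g\<close>. Only homogeneous elements are assumed not to be zero
  divisors; the order on the degrees extends this to all elements.\<close>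
locale graded_domain = ring_subset A for A :: "'a::{comm_ring_1,ring_char_0} set" +
  fixes cmp :: "'g::linordered_idom \<Rightarrow> 'a \<Rightarrow> 'a"
  assumes cmp_in [simp, intro]: "a \<in> A \<Longrightarrow> cmp g a \<in> A"
    and cmp_add: "a \<in> A \<Longrightarrow> b \<in> A \<Longrightarrow> cmp g (a + b) = cmp g a + cmp g b"
    and cmp_cmp: "a \<in> A \<Longrightarrow> cmp g (cmp h a) = (if g = h then cmp g a else 0)"
    and finite_cmp: "a \<in> A \<Longrightarrow> finite {g. cmp g a \<noteq> 0}"
    and sum_cmp: "a \<in> A \<Longrightarrow> (\<Sum>g | cmp g a \<noteq> 0. cmp g a) = a"
    and cmp_mult: "a \<in> A \<Longrightarrow> b \<in> A \<Longrightarrow> cmp (g + h) (cmp g a * cmp h b) = cmp g a * cmp h b"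
    and cmp_nzd: "a \<in> A \<Longrightarrow> b \<in> A \<Longrightarrow> cmp g a * cmp h b = 0 \<Longrightarrow> cmp g a = 0 \<or> cmp h b = 0"
begin

definition supp :: "'a \<Rightarrow> 'g set"
  where "supp a = {g. cmp g a \<noteq> 0}"

definition H :: "'g \<Rightarrow> 'a set"
  where "H g = {a \<in> A. cmp g a = a}"

lemma finite_supp [simp, intro]: "a \<in> A \<Longrightarrow> finite (supp a)"
  by (simp add: supp_def finite_cmp)

lemma sum_supp: "a \<in> A \<Longrightarrow> (\<Sum>g\<in>supp a. cmp g a) = a"
  using sum_cmp by (simp add: supp_def)

lemma H_subset: "a \<in> H g \<Longrightarrow> a \<in> A"
  by (simp add: H_def)

lemma cmp_in_H [simp, intro]: "a \<in> A \<Longrightarrow> cmp g a \<in> H g"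
  by (simp add: H_def cmp_cmp)

lemma cmp_0 [simp]: "cmp g 0 = 0"
  using cmp_add[of 0 0 g] by simp

lemma cmp_sum: "(\<And>i. i \<in> I \<Longrightarrow> f i \<in> A) \<Longrightarrow> cmp g (sum f I) = (\<Sum>i\<in>I. cmp g (f i))"
  by (induction I rule: infinite_finite_induct) (auto simp: cmp_add sum_in)

lemma cmp_H: "a \<in> H h \<Longrightarrow> cmp g a = (if g = h then a else 0)"
  using cmp_cmp[of a g h] by (auto simp: H_def)

lemma H_0 [simp]: "0 \<in> H g"
  by (simp add: H_def)

lemma H_add [intro]: "a \<in> H g \<Longrightarrow> b \<in> H g \<Longrightarrow> a + b \<in> H g"
  by (simp add: H_def cmp_add)

lemma H_mult [intro]: "a \<in> H g \<Longrightarrow> b \<in> H h \<Longrightarrow> a * b \<in> H (g + h)"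
  using cmp_mult[of a b g h] by (auto simp: H_def)

lemma H_disjoint: "a \<in> H g \<Longrightarrow> a \<in> H h \<Longrightarrow> a \<noteq> 0 \<Longrightarrow> g = h"
  using cmp_H[of a h g] by (auto simp: H_def split: if_splits)

lemma H_induct [consumes 1, case_names add hom]:
  assumes "a \<in> A" and "\<And>a b. a \<in> A \<Longrightarrow> b \<in> A \<Longrightarrow> P a \<Longrightarrow> P b \<Longrightarrow> P (a + b)"
    and "\<And>g a. a \<in> H g \<Longrightarrow> P a"
  shows "P a"
proof -
  have "P (\<Sum>g\<in>S. cmp g a)" if "finite S" for S
    using that
  proof induction
    case empty
    then show ?case using assms(3)[OF H_0] by simp
  next
    case (insert g S)
    then show ?case using assms(1) by (auto intro!: assms(2) intro: assms(3) sum_in)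
  qed
  from this[of "supp a"] show ?thesis
    using assms(1) by (simp add: sum_supp)
qed

lemma cmp_mult_H:
  assumes "a \<in> A" "b \<in> H h"
  shows "cmp (g + h) (a * b) = cmp g a * b"
  using assms(1)
proof (induction rule: H_induct)
  case (add a a')
  then show ?case using H_subset[OF assms(2)] by (simp add: distrib_right cmp_add)
next
  case (hom k a)
  then show ?case using H_mult[OF hom assms(2)] by (auto simp: cmp_H)
qed

text \<open>Only the two highest components contribute to the highest degree of a product.\<close>
lemma cmp_above_mult:
  assumes "a \<in> A" "b \<in> A" "\<And>g. g > m \<Longrightarrow> cmp g a = 0" "\<And>g. g > k \<Longrightarrow> cmp g b = 0"
  shows "cmp (m + k) (a * b) = cmp m a * cmp k b"
proof -
  have "a * b = (\<Sum>h\<in>supp b. a * cmp h b)"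
    using sum_supp[OF assms(2)] by (metis sum_distrib_left)
  then have "cmp (m + k) (a * b) = (\<Sum>h\<in>supp b. cmp (m + k) (a * cmp h b))"
    using assms by (simp add: cmp_sum)
  also have "\<dots> = (\<Sum>h\<in>supp b. if h = k then cmp m a * cmp k b else 0)"
  proof (rule sum.cong)
    fix h assume "h \<in> supp b"
    then have "h \<le> k" using assms(4)[of h] by (auto simp: supp_def not_less[symmetric])
    have "cmp (m + k) (a * cmp h b) = cmp (m + k - h) a * cmp h b"
      using cmp_mult_H[of a "cmp h b" h "m + k - h"] assms(1,2) by simp
    then show "cmp (m + k) (a * cmp h b) = (if h = k then cmp m a * cmp k b else 0)"
      using assms(3)[of "m + k - h"] \<open>h \<le> k\<close> by auto
  qed simp
  also have "\<dots> = cmp m a * cmp k b"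
    using assms(2) by (subst sum.delta) (auto simp: supp_def finite_cmp)
  finally show ?thesis .
qed

lemma supp_nonempty: "a \<in> A \<Longrightarrow> a \<noteq> 0 \<Longrightarrow> supp a \<noteq> {}"
  using sum_supp[of a] by auto

lemma top_mult:
  assumes "a \<in> A" "b \<in> A" "a \<noteq> 0" "b \<noteq> 0"
  shows "cmp (Max (supp a) + Max (supp b)) (a * b) \<noteq> 0"
proof -
  have *: "cmp g x = 0" if "x \<in> A" "g > Max (supp x)" for x g
    using that Max_ge[of "supp x" g] by (auto simp: supp_def[of x] not_less[symmetric] finite_cmp)
  have **: "cmp (Max (supp x)) x \<noteq> 0" if "x \<in> A" "x \<noteq> 0" for x
    using Max_in[OF finite_supp[OF that(1)] supp_nonempty[OF that]] by (simp add: supp_def[of x])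
  show ?thesis
    using cmp_above_mult[OF assms(1,2) * *] cmp_nzd[OF assms(1,2)] ** assms by metis
qed

lemma nzd: "a \<in> A \<Longrightarrow> b \<in> A \<Longrightarrow> a * b = 0 \<Longrightarrow> a = 0 \<or> b = 0"
  using top_mult[of a b] by auto

text \<open>Negating degrees exchanges highest and lowest components, so that statements about lowest
  components follow from those about highest ones.\<close>
lemma reverse_grading: "graded_domain A (\<lambda>g. cmp (- g))"
proof
  fix a assume a: "a \<in> A"
  have im: "{g. cmp (- g) a \<noteq> 0} = uminus ` supp a"
    by (force simp: supp_def image_iff)
  show "finite {g. cmp (- g) a \<noteq> 0}" using a im by simp
  show "(\<Sum>g | cmp (- g) a \<noteq> 0. cmp (- g) a) = a"
    unfolding im using sum_supp[OF a] by (subst sum.reindex) auto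
next
  fix a b g h assume "a \<in> A" "b \<in> A"
  then show "cmp (- (g + h)) (cmp (- g) a * cmp (- h) b) = cmp (- g) a * cmp (- h) b"
    using cmp_mult[of a b "- g" "- h"] by simp
qed (auto simp: cmp_add cmp_cmp dest: cmp_nzd)

lemma bottom_mult:
  assumes "a \<in> A" "b \<in> A" "a \<noteq> 0" "b \<noteq> 0"
  shows "cmp (Min (supp a) + Min (supp b)) (a * b) \<noteq> 0"
proof -
  interpret r: graded_domain A "\<lambda>g. cmp (- g)" by (rule reverse_grading)
  have im: "r.supp x = uminus ` supp x" for x
    by (force simp: supp_def r.supp_def image_iff)
  have "Max (r.supp x) = - Min (supp x)" if "x \<in> A" "x \<noteq> 0" for x
    unfolding im using that supp_nonempty[OF that] by (simp add: minus_Min_eq_Max)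
  then show ?thesis using r.top_mult[OF assms] assms by (simp add: add.commute)
qed

text \<open>Highest and lowest components multiply separately. If the product has a single degree, the highest
  and the lowest degree of each factor have to agree.\<close>
lemma homogeneous_factor:
  assumes "a \<in> A" "b \<in> A" "a * b \<in> H g" "a * b \<noteq> 0"
  shows "\<exists>h. a \<in> H h \<and> b \<in> H (g - h)"
proof -
  have nz: "a \<noteq> 0" "b \<noteq> 0" using assms by auto
  have g1: "Max (supp a) + Max (supp b) = g"
    using top_mult[OF assms(1,2) nz] cmp_H[OF assms(3)] by metis
  have g2: "Min (supp a) + Min (supp b) = g"
    using bottom_mult[OF assms(1,2) nz] cmp_H[OF assms(3)] by metis
  have ne: "supp a \<noteq> {}" "supp b \<noteq> {}" "finite (supp a)" "finite (supp b)"
    using supp_nonempty nz assms by auto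
  have le: "Min (supp a) \<le> Max (supp a)" "Min (supp b) \<le> Max (supp b)"
    using ne by (auto intro: Min_le)
  have eq: "Min (supp a) = Max (supp a)" "Min (supp b) = Max (supp b)"
    using le g1 g2 by (smt (verit) add_le_cancel_left add_le_cancel_right antisym)+
  have sing: "x \<in> H (Max (supp x))" if "x \<in> A" "supp x \<noteq> {}" "Min (supp x) = Max (supp x)" for x
  proof -
    have "y = Max (supp x)" if "y \<in> supp x" for y
      using that \<open>x \<in> A\<close> Max_ge[of "supp x" y] Min_le[of "supp x" y] \<open>Min (supp x) = Max (supp x)\<close>
      by (metis finite_supp antisym)
    then have "supp x = {Max (supp x)}" using that Max_in[of "supp x"] by auto
    then have "(\<Sum>g\<in>{Max (supp x)}. cmp g x) = x" using sum_supp[OF \<open>x \<in> A\<close>] by simp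
    then show ?thesis using \<open>x \<in> A\<close> by (simp add: H_def)
  qed
  have "a \<in> H (Max (supp a))" "b \<in> H (g - Max (supp a))"
    using sing[OF assms(1) ne(1) eq(1)] sing[OF assms(2) ne(2) eq(2)] g1 by (auto simp: algebra_simps)
  then show ?thesis by blast
qed

end

locale graded_derivation = graded_domain A cmp + derivation_on A D
  for A :: "'a::{comm_ring_1,ring_char_0} set" and cmp :: "'g::linordered_idom \<Rightarrow> 'a \<Rightarrow> 'a"
    and D :: "'a \<Rightarrow> 'a"
begin

text \<open>The homogeneous component of degree \<open>\<mu>\<close> of the derivation \<open>D\<close>.\<close>
definition Dcmp :: "'g \<Rightarrow> 'a \<Rightarrow> 'a"
  where "Dcmp \<mu> a = (\<Sum>g\<in>supp a. cmp (g + \<mu>) (D (cmp g a)))"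

lemma Dcmp_eq:
  assumes "finite S" "supp a \<subseteq> S"
  shows "Dcmp \<mu> a = (\<Sum>g\<in>S. cmp (g + \<mu>) (D (cmp g a)))"
  unfolding Dcmp_def using assms by (intro sum.mono_neutral_left) (auto simp: supp_def)

lemma Dcmp_H: "a \<in> H g \<Longrightarrow> Dcmp \<mu> a = cmp (g + \<mu>) (D a)"
  by (subst Dcmp_eq[of "{g}"]) (auto simp: supp_def cmp_H split: if_splits)

lemma Dcmp_H_in: "a \<in> H g \<Longrightarrow> Dcmp \<mu> a \<in> H (g + \<mu>)"
  by (simp add: Dcmp_H H_subset D_in)

lemma Dcmp_in [intro]: "a \<in> A \<Longrightarrow> Dcmp \<mu> a \<in> A"
  unfolding Dcmp_def by auto

lemma Dcmp_add:
  assumes "a \<in> A" "b \<in> A"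
  shows "Dcmp \<mu> (a + b) = Dcmp \<mu> a + Dcmp \<mu> b"
proof -
  let ?S = "supp a \<union> supp b"
  have "finite ?S" "supp (a + b) \<subseteq> ?S"
    using assms by (auto simp: supp_def cmp_add finite_cmp)
  then show ?thesis
    using assms by (simp add: Dcmp_eq[of ?S] cmp_add D_add D_in sum.distrib)
qed

lemma Dcmp_mult_H:
  assumes "a \<in> H g" "b \<in> H h"
  shows "Dcmp \<mu> (a * b) = Dcmp \<mu> a * b + a * Dcmp \<mu> b"
proof -
  have ab: "a \<in> A" "b \<in> A" using assms H_subset by auto
  have "Dcmp \<mu> (a * b) = cmp (g + h + \<mu>) (D a * b) + cmp (g + h + \<mu>) (D b * a)"
    using H_mult[OF assms] ab by (simp add: Dcmp_H D_mult cmp_add mult.commute)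
  also have "cmp (g + h + \<mu>) (D a * b) = cmp (g + \<mu>) (D a) * b"
    using cmp_mult_H[of "D a" b h "g + \<mu>"] assms(2) ab by (simp add: algebra_simps)
  also have "cmp (g + h + \<mu>) (D b * a) = cmp (h + \<mu>) (D b) * a"
    using cmp_mult_H[of "D b" a g "h + \<mu>"] assms(1) ab by (simp add: algebra_simps)
  finally show ?thesis using assms by (simp add: Dcmp_H mult.commute)
qed

lemma Dcmp_mult:
  assumes "a \<in> A" "b \<in> A"
  shows "Dcmp \<mu> (a * b) = Dcmp \<mu> a * b + a * Dcmp \<mu> b"
  using assms
proof (induction a arbitrary: b rule: H_induct)
  case (add a a')
  then show ?case by (simp add: distrib_right Dcmp_add Dcmp_in)
next
  case (hom g a)
  have a: "a \<in> A" using hom(1) H_subset by auto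
  show ?case
    using hom(2)
  proof (induction b rule: H_induct)
    case (add b b')
    then show ?case using a by (simp add: distrib_left Dcmp_add Dcmp_in)
  next
    case (hom h b)
    then show ?case using \<open>a \<in> H g\<close> Dcmp_mult_H by blast
  qed
qed

lemma derivation_Dcmp: "derivation_on A (Dcmp \<mu>)"
  by unfold_locales (auto simp: Dcmp_add Dcmp_mult)

lemma cmp_D: "a \<in> A \<Longrightarrow> cmp k (D a) = (\<Sum>h\<in>supp a. Dcmp (k - h) (cmp h a))"
proof -
  assume a: "a \<in> A"
  have "D a = (\<Sum>h\<in>supp a. D (cmp h a))"
    using sum_supp[OF a] D_sum[of "supp a" "\<lambda>h. cmp h a"] a by simp
  then have "cmp k (D a) = (\<Sum>h\<in>supp a. cmp k (D (cmp h a)))"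
    using a by (simp add: cmp_sum D_in)
  then show ?thesis using a by (simp add: Dcmp_H[OF cmp_in_H])
qed

text \<open>For finitely generated algebras this follows if every element lies in a finite-dimensional
  \<open>D\<close>-stable subspace; only the degrees that occur matter here.\<close>
definition locally_finite :: bool
  where "locally_finite \<longleftrightarrow> (\<forall>a\<in>A. \<exists>S. finite S \<and> (\<forall>n. supp ((D ^^ n) a) \<subseteq> S))"

text \<open>If no component of \<open>D\<close> has degree above \<open>\<mu>\<close>, the terms of highest possible degree in the iterates of
  \<open>D\<close> come from the component of degree \<open>\<mu>\<close> alone.\<close>
lemma top_component_iter:
  assumes top: "\<And>\<nu> a. \<nu> > \<mu> \<Longrightarrow> a \<in> A \<Longrightarrow> Dcmp \<nu> a = 0" and a: "a \<in> H g"
  shows "(\<forall>h>g + of_nat n * \<mu>. cmp h ((D ^^ n) a) = 0) \<and>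
         cmp (g + of_nat n * \<mu>) ((D ^^ n) a) = (Dcmp \<mu> ^^ n) a"
proof (induction n)
  case 0
  then show ?case using a by (auto simp: cmp_H)
next
  case (Suc n)
  let ?x = "(D ^^ n) a" and ?m = "g + of_nat n * \<mu>"
  have x: "?x \<in> A" using a H_subset by auto
  have below: "h \<le> ?m" if "h \<in> supp ?x" for h
    using Suc that by (auto simp: supp_def not_less[symmetric])
  have z: "Dcmp (k - h) (cmp h ?x) = 0" if "h \<in> supp ?x" "k \<ge> ?m + \<mu>" "k \<noteq> ?m + \<mu> \<or> h \<noteq> ?m" for k h
  proof (rule top)
    have "h \<le> ?m" using below that by simp
    then have "h + \<mu> \<le> ?m + \<mu>" by simp
    then have "h + \<mu> < k" using that by force
    then show "\<mu> < k - h" by (simp add: algebra_simps)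
  qed (use x in auto)
  have "cmp k (D ?x) = 0" if "k > ?m + \<mu>" for k
    using cmp_D[OF x, of k] z[of _ k] that by (simp add: sum.neutral)
  moreover have "cmp (?m + \<mu>) (D ?x) = Dcmp \<mu> (cmp ?m ?x)"
  proof -
    have "cmp (?m + \<mu>) (D ?x) = (\<Sum>h\<in>supp ?x. if h = ?m then Dcmp \<mu> (cmp ?m ?x) else 0)"
      unfolding cmp_D[OF x] by (rule sum.cong) (auto simp: z)
    also have "\<dots> = Dcmp \<mu> (cmp ?m ?x)"
      using x by (subst sum.delta) (auto simp: supp_def Dcmp_def finite_cmp)
    finally show ?thesis .
  qed
  moreover have "g + of_nat (Suc n) * \<mu> = ?m + \<mu>"
    by (simp add: algebra_simps)
  ultimately show ?case using Suc by (simp only: funpow.simps o_apply) simp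
qed

text \<open>Iterates of the highest component are components of iterates of \<open>D\<close> whose degrees are pairwise
  distinct. By local finiteness almost all of them vanish.\<close>
lemma top_component_lnd:
  assumes lf: locally_finite and "\<mu> \<noteq> 0"
    and top: "\<And>\<nu> a. \<nu> > \<mu> \<Longrightarrow> a \<in> A \<Longrightarrow> Dcmp \<nu> a = 0"
  shows "lnd A (Dcmp \<mu>)"
proof -
  interpret c: derivation_on A "Dcmp \<mu>" by (rule derivation_Dcmp)
  have "\<exists>n. (Dcmp \<mu> ^^ n) a = 0" if "a \<in> A" for a
    using that
  proof (induction rule: H_induct)
    case (add a b)
    then obtain n m where "(Dcmp \<mu> ^^ n) a = 0" "(Dcmp \<mu> ^^ m) b = 0" by blast
    then have "(Dcmp \<mu> ^^ (max n m)) (a + b) = 0"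
      using add by (simp add: c.iter_add c.iter_zero_mono[of _ _ "max n m"])
    then show ?case by blast
  next
    case (hom g a)
    obtain S where S: "finite S" "\<And>n. supp ((D ^^ n) a) \<subseteq> S"
      using lf hom H_subset unfolding locally_finite_def by meson
    have "inj (\<lambda>n. g + of_nat n * \<mu>)"
      using \<open>\<mu> \<noteq> 0\<close> by (auto simp: inj_def)
    then have "\<not> (range (\<lambda>n. g + of_nat n * \<mu>) \<subseteq> S)"
      using S(1) finite_subset finite_imageD infinite_UNIV_nat by metis
    then obtain n where n: "g + of_nat n * \<mu> \<notin> S" by auto
    then have "cmp (g + of_nat n * \<mu>) ((D ^^ n) a) = 0"
      using S(2)[of n] by (auto simp: supp_def)
    then show ?case
      using top_component_iter[OF top hom, where n = n] by auto
  qed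
  then show ?thesis
    by unfold_locales (use nzd in auto)
qed

lemma reverse_graded_derivation: "graded_derivation A (\<lambda>g. cmp (- g)) D"
proof -
  interpret r: graded_domain A "\<lambda>g. cmp (- g)" by (rule reverse_grading)
  show ?thesis by unfold_locales
qed

text \<open>The extreme components of a locally finite derivation are locally nilpotent unless their degree is
  zero. If the only homogeneous locally nilpotent derivation of nonzero degree is zero, the derivation
  is therefore concentrated in degree zero.\<close>
lemma preserves_degrees:
  assumes lf: locally_finite and fin: "finite {\<mu>. \<exists>a\<in>A. Dcmp \<mu> a \<noteq> 0}"
    and rigid: "\<And>\<mu> a. \<mu> \<noteq> 0 \<Longrightarrow> lnd A (Dcmp \<mu>) \<Longrightarrow> a \<in> A \<Longrightarrow> Dcmp \<mu> a = 0"
    and a: "a \<in> H g"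
  shows "D a \<in> H g"
proof -
  interpret r: graded_derivation A "\<lambda>g. cmp (- g)" D by (rule reverse_graded_derivation)
  have im: "r.supp x = uminus ` supp x" for x
    by (force simp: supp_def r.supp_def image_iff)
  have rD: "r.Dcmp \<mu> x = Dcmp (- \<mu>) x" for \<mu> x
    unfolding r.Dcmp_def Dcmp_def im by (subst sum.reindex) auto
  have rlf: "r.locally_finite"
    unfolding r.locally_finite_def
  proof
    fix x assume "x \<in> A"
    then obtain S where "finite S" "\<And>n. supp ((D ^^ n) x) \<subseteq> S"
      using lf unfolding locally_finite_def by meson
    then show "\<exists>S. finite S \<and> (\<forall>n. r.supp ((D ^^ n) x) \<subseteq> S)"
      unfolding im by (intro exI[of _ "uminus ` S"]) (auto intro: image_mono)
  qed
  let ?N = "{\<mu>. \<exists>a\<in>A. Dcmp \<mu> a \<noteq> 0}"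
  have "Dcmp \<mu> x = 0" if "\<mu> > 0" "x \<in> A" for \<mu> x
  proof (rule ccontr)
    assume "Dcmp \<mu> x \<noteq> 0"
    then have "\<mu> \<in> ?N" using that by auto
    define M where "M = Max ?N"
    have "M \<in> ?N" "\<mu> \<le> M"
      using Max_in[OF fin] Max_ge[OF fin] \<open>\<mu> \<in> ?N\<close> unfolding M_def by blast+
    have "Dcmp \<nu> y = 0" if "\<nu> > M" "y \<in> A" for \<nu> y
      using Max_ge[OF fin, of \<nu>] that unfolding M_def by force
    then have "lnd A (Dcmp M)"
      using \<open>\<mu> > 0\<close> \<open>\<mu> \<le> M\<close> by (intro top_component_lnd lf) auto
    then show False using rigid[of M] \<open>M \<in> ?N\<close> \<open>\<mu> > 0\<close> \<open>\<mu> \<le> M\<close> by auto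
  qed
  moreover have "Dcmp \<mu> x = 0" if "\<mu> < 0" "x \<in> A" for \<mu> x
  proof (rule ccontr)
    assume "Dcmp \<mu> x \<noteq> 0"
    then have "\<mu> \<in> ?N" using that by auto
    define M where "M = Min ?N"
    have "M \<in> ?N" "M \<le> \<mu>"
      using Min_in[OF fin] Min_le[OF fin] \<open>\<mu> \<in> ?N\<close> unfolding M_def by blast+
    have "r.Dcmp \<nu> y = 0" if "\<nu> > - M" "y \<in> A" for \<nu> y
    proof (rule ccontr)
      assume "r.Dcmp \<nu> y \<noteq> 0"
      then have "M \<le> - \<nu>"
        using Min_le[OF fin, of "- \<nu>"] that unfolding M_def rD by auto
      then show False using that(1) by (simp add: le_minus_iff)
    qed
    then have "lnd A (r.Dcmp (- M))"
      using \<open>\<mu> < 0\<close> \<open>M \<le> \<mu>\<close> by (intro r.top_component_lnd rlf) auto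
    moreover have "r.Dcmp (- M) = Dcmp M" by (auto simp: rD)
    ultimately show False using rigid[of M] \<open>M \<in> ?N\<close> \<open>\<mu> < 0\<close> \<open>M \<le> \<mu>\<close> by auto
  qed
  ultimately have zero: "Dcmp \<mu> x = 0" if "\<mu> \<noteq> 0" "x \<in> A" for \<mu> x
    using that by (cases "\<mu> > 0") auto
  have aA: "a \<in> A" using a H_subset by auto
  have "cmp k (D a) = 0" if "k \<noteq> g" for k
    using Dcmp_H[OF a, of "k - g"] zero[of "k - g" a] aA that by simp
  then have "supp (D a) \<subseteq> {g}" by (auto simp: supp_def)
  then have "(\<Sum>k\<in>{g}. cmp k (D a)) = (\<Sum>k\<in>supp (D a). cmp k (D a))"
    by (intro sum.mono_neutral_right) (auto simp: supp_def)
  then have "cmp g (D a) = D a" using sum_supp[of "D a"] aA by auto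
  then show ?thesis using aA by (simp add: H_def)
qed

end

section \<open>Evaluation of polynomials\<close>

text \<open>The universal property of the polynomial ring, proved once for evaluation at points and for the
  substitution of variables for variables.\<close>
locale coeff_hom =
  fixes \<kappa> :: "'k::comm_ring_1 \<Rightarrow> 'r::comm_ring_1"
  assumes \<kappa>_add: "\<kappa> (a + b) = \<kappa> a + \<kappa> b" and \<kappa>_mult: "\<kappa> (a * b) = \<kappa> a * \<kappa> b"
    and \<kappa>_1 [simp]: "\<kappa> 1 = 1"
begin

lemma \<kappa>_0 [simp]: "\<kappa> 0 = 0"
  using \<kappa>_add[of 0 0] by simp

definition mono_ext :: "('v \<Rightarrow> 'r) \<Rightarrow> ('v \<Rightarrow>\<^sub>0 nat) \<Rightarrow> 'r"
  where "mono_ext g m = (\<Prod>v\<in>Poly_Mapping.keys m. g v ^ Poly_Mapping.lookup m v)"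

definition ext :: "('v \<Rightarrow> 'r) \<Rightarrow> ('v, 'k) mpoly \<Rightarrow> 'r"
  where "ext g p = (\<Sum>m\<in>Poly_Mapping.keys p. \<kappa> (Poly_Mapping.lookup p m) * mono_ext g m)"

lemma mono_ext_superset:
  assumes "finite S" "Poly_Mapping.keys m \<subseteq> S"
  shows "mono_ext g m = (\<Prod>v\<in>S. g v ^ Poly_Mapping.lookup m v)"
  unfolding mono_ext_def using assms
  by (intro prod.mono_neutral_left) (auto simp: in_keys_iff)

lemma mono_ext_add: "mono_ext g (m + m') = mono_ext g m * mono_ext g m'"
proof -
  let ?S = "Poly_Mapping.keys m \<union> Poly_Mapping.keys m'"
  have "Poly_Mapping.keys (m + m') \<subseteq> ?S" by (rule keys_add)
  then show ?thesis
    by (simp add: mono_ext_superset[of ?S] lookup_add power_add prod.distrib)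
qed

lemma mono_ext_0 [simp]: "mono_ext g 0 = 1"
  by (simp add: mono_ext_def)

lemma ext_superset:
  assumes "finite S" "Poly_Mapping.keys p \<subseteq> S"
  shows "ext g p = (\<Sum>m\<in>S. \<kappa> (Poly_Mapping.lookup p m) * mono_ext g m)"
  unfolding ext_def using assms
  by (intro sum.mono_neutral_left) (auto simp: in_keys_iff)

lemma ext_add: "ext g (p + q) = ext g p + ext g q"
proof -
  let ?S = "Poly_Mapping.keys p \<union> Poly_Mapping.keys q"
  have "Poly_Mapping.keys (p + q) \<subseteq> ?S" by (rule keys_add)
  then show ?thesis
    by (simp add: ext_superset[of ?S] lookup_add \<kappa>_add distrib_right sum.distrib)
qed

lemma ext_0 [simp]: "ext g 0 = 0"
  by (simp add: ext_def)

lemma ext_single [simp]: "ext g (Poly_Mapping.single m c) = \<kappa> c * mono_ext g m"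
  by (cases "c = 0") (simp_all add: ext_def)

lemma ext_sum: "ext g (sum f I) = (\<Sum>i\<in>I. ext g (f i))"
  by (induction I rule: infinite_finite_induct) (auto simp: ext_add)

lemma poly_as_sum: "p = (\<Sum>m\<in>Poly_Mapping.keys p. Poly_Mapping.single m (Poly_Mapping.lookup p m))"
  for p :: "('v, 'k) mpoly"
proof (rule poly_mapping_eqI)
  fix k
  show "Poly_Mapping.lookup p k = Poly_Mapping.lookup
      (\<Sum>m\<in>Poly_Mapping.keys p. Poly_Mapping.single m (Poly_Mapping.lookup p m)) k"
    by (simp add: lookup_sum lookup_single when_def in_keys_iff)
qed

lemma ext_mult: "ext g (p * q) = ext g p * ext g q"
proof -
  have "ext g (p * q) = ext g ((\<Sum>m\<in>Poly_Mapping.keys p. Poly_Mapping.single m (Poly_Mapping.lookup p m)) *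
      (\<Sum>m\<in>Poly_Mapping.keys q. Poly_Mapping.single m (Poly_Mapping.lookup q m)))"
    using poly_as_sum[of p] poly_as_sum[of q] by simp
  also have "\<dots> = ext g p * ext g q"
    unfolding ext_def[of g p] ext_def[of g q] sum_product ext_sum mult_single ext_single
    by (intro sum.cong refl) (simp only: mono_ext_add \<kappa>_mult ac_simps)
  finally show ?thesis .
qed

lemma ext_1 [simp]: "ext g 1 = 1"
  using ext_single[of g 0 1] by simp

lemma ext_prod: "ext g (prod f I) = (\<Prod>i\<in>I. ext g (f i))"
  by (induction I rule: infinite_finite_induct) (auto simp: ext_mult)

lemma ext_power: "ext g (p ^ n) = ext g p ^ n"
  by (induction n) (auto simp: ext_mult)

lemma ext_mvar [simp]: "ext g (mvar v) = g v"
  by (simp add: mvar_def mono_ext_def)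

lemma ext_mconst [simp]: "ext g (mconst c) = \<kappa> c"
  by (simp add: mconst_def)

end

lemma id_hom: "coeff_hom (\<lambda>c::'k::comm_ring_1. c)"
  by unfold_locales auto

lemma meval_conv_ext: "meval p x = coeff_hom.ext (\<lambda>c. c) x p"
  by (simp add: coeff_hom.ext_def[OF id_hom] coeff_hom.mono_ext_def[OF id_hom] meval_def)

abbreviation mmono :: "('v \<Rightarrow>\<^sub>0 nat) \<Rightarrow> ('v \<Rightarrow> 'k::comm_ring_1) \<Rightarrow> 'k"
  where "mmono m x \<equiv> (\<Prod>v\<in>Poly_Mapping.keys m. x v ^ Poly_Mapping.lookup m v)"

lemma mmono_superset:
  assumes "finite S" "Poly_Mapping.keys m \<subseteq> S"
  shows "mmono m x = (\<Prod>v\<in>S. x v ^ Poly_Mapping.lookup m v)"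
  using coeff_hom.mono_ext_superset[OF id_hom assms]
  by (simp add: coeff_hom.mono_ext_def[OF id_hom])

lemma meval_0 [simp]: "meval 0 x = 0"
  by (simp add: meval_conv_ext coeff_hom.ext_0[OF id_hom])

lemma meval_1 [simp]: "meval 1 x = 1"
  by (simp add: meval_conv_ext coeff_hom.ext_1[OF id_hom])

lemma meval_add: "meval (p + q) x = meval p x + meval q x"
  by (simp add: meval_conv_ext coeff_hom.ext_add[OF id_hom])

lemma meval_mult: "meval (p * q) x = meval p x * meval q x"
  by (simp add: meval_conv_ext coeff_hom.ext_mult[OF id_hom])

lemma meval_sum: "meval (sum f I) x = (\<Sum>i\<in>I. meval (f i) x)"
  by (simp add: meval_conv_ext coeff_hom.ext_sum[OF id_hom])

lemma meval_prod: "meval (prod f I) x = (\<Prod>i\<in>I. meval (f i) x)"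
  by (simp add: meval_conv_ext coeff_hom.ext_prod[OF id_hom])

lemma meval_power: "meval (p ^ n) x = meval p x ^ n"
  by (simp add: meval_conv_ext coeff_hom.ext_power[OF id_hom])

lemma meval_mvar [simp]: "meval (mvar v) x = x v"
  by (simp add: meval_conv_ext coeff_hom.ext_mvar[OF id_hom])

lemma meval_mconst [simp]: "meval (mconst c) x = c"
  by (simp add: meval_conv_ext coeff_hom.ext_mconst[OF id_hom])

lemma meval_single: "meval (Poly_Mapping.single m c) x = c * mmono m x"
  by (simp add: meval_conv_ext coeff_hom.ext_single[OF id_hom] coeff_hom.mono_ext_def[OF id_hom])

lemma mconst_hom: "coeff_hom (mconst :: 'k::comm_ring_1 \<Rightarrow> ('v, 'k) mpoly)"
  by unfold_locales (auto simp: mconst_def single_add mult_single)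

lemma mrename_conv_ext: "mrename \<tau> p = coeff_hom.ext mconst (\<lambda>v. mvar (\<tau> v)) p"
  unfolding coeff_hom.ext_def[OF mconst_hom] coeff_hom.mono_ext_def[OF mconst_hom] mrename_def ..

lemma mrename_sum: "mrename \<tau> (sum f I) = (\<Sum>i\<in>I. mrename \<tau> (f i))"
  by (simp add: mrename_conv_ext coeff_hom.ext_sum[OF mconst_hom])

lemma mrename_prod: "mrename \<tau> (prod f I) = (\<Prod>i\<in>I. mrename \<tau> (f i))"
  by (simp add: mrename_conv_ext coeff_hom.ext_prod[OF mconst_hom])

lemma mrename_power: "mrename \<tau> (p ^ n) = mrename \<tau> p ^ n"
  by (simp add: mrename_conv_ext coeff_hom.ext_power[OF mconst_hom])

lemma mrename_mvar: "mrename \<tau> (mvar v) = mvar (\<tau> v)"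
  by (simp add: mrename_conv_ext coeff_hom.ext_mvar[OF mconst_hom])

lemma meval_mrename: "meval (mrename \<tau> p) x = meval p (\<lambda>v. x (\<tau> v))"
  unfolding mrename_def meval_def[of p] meval_sum meval_mult meval_prod meval_power
    meval_mvar meval_mconst ..

lemma mvars_0 [simp]: "mvars 0 = {}"
  by (simp add: mvars_def)

lemma mvars_add: "mvars (p + q) \<subseteq> mvars p \<union> mvars q"
  unfolding mvars_def using keys_add[of p q] by blast

lemma mvars_mult: "mvars (p * q) \<subseteq> mvars p \<union> mvars q"
proof
  fix v assume "v \<in> mvars (p * q)"
  then obtain m where m: "m \<in> Poly_Mapping.keys (p * q)" "v \<in> Poly_Mapping.keys m"
    by (auto simp: mvars_def)
  then obtain a b where "m = a + b" "a \<in> Poly_Mapping.keys p" "b \<in> Poly_Mapping.keys q"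
    using keys_mult[of p q] by auto
  then show "v \<in> mvars p \<union> mvars q"
    using m(2) keys_add[of a b] by (auto simp: mvars_def)
qed

lemma mvars_single: "mvars (Poly_Mapping.single m c) \<subseteq> Poly_Mapping.keys m"
  by (auto simp: mvars_def)

lemma mvars_mconst [simp]: "mvars (mconst c) = {}"
  using mvars_single[of 0 c] by (auto simp: mconst_def)

lemma mvars_1 [simp]: "mvars 1 = {}"
  using mvars_mconst[of 1] by (simp add: mconst_def)

lemma mvars_mvar: "mvars (mvar v) \<subseteq> {v}"
  using mvars_single[of "Poly_Mapping.single v 1" 1] unfolding mvar_def by auto

lemma mvars_uminus [simp]: "mvars (- p) = mvars p"
proof -
  have "Poly_Mapping.keys (- p) = Poly_Mapping.keys p"
    by (simp add: keys.rep_eq)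
  then show ?thesis by (simp only: mvars_def)
qed

lemma mvars_prod: "mvars (prod f I) \<subseteq> (\<Union>i\<in>I. mvars (f i))"
proof (induction I rule: infinite_finite_induct)
  case (insert i I)
  then show ?case using mvars_mult[of "f i" "prod f I"] by auto
qed auto

lemma mvars_power: "mvars (p ^ n) \<subseteq> mvars p"
proof (induction n)
  case (Suc n)
  then show ?case using mvars_mult[of p "p ^ n"] by auto
qed auto

section \<open>Laurent polynomials vanishing almost everywhere\<close>

text \<open>A suitable power of the variable turns the Laurent polynomial into a polynomial with infinitely many
  roots.\<close>
lemma laurent_sum_zero:
  fixes y :: "int \<Rightarrow> 'k::{field_char_0}"
  assumes "finite Z" "finite B" "\<And>w. w \<notin> B \<Longrightarrow> w \<noteq> 0 \<Longrightarrow> (\<Sum>z\<in>Z. y z * w powi z) = 0" "z \<in> Z"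
  shows "y z = 0"
proof -
  obtain b :: nat where b: "\<And>z. z \<in> Z \<Longrightarrow> z + int b \<ge> 0"
  proof (cases "Z = {}")
    case False
    show ?thesis
    proof (rule that[of "nat (\<bar>Min Z\<bar>)"])
      fix z assume "z \<in> Z"
      then have "Min Z \<le> z" using assms(1) by simp
      then show "z + int (nat \<bar>Min Z\<bar>) \<ge> 0" by simp
    qed
  qed (use that in auto)
  define q where "q = (\<Sum>z\<in>Z. monom (y z) (nat (z + int b)))"
  have "poly q w = 0" if "w \<notin> B" "w \<noteq> 0" for w
  proof -
    have "poly q w = (\<Sum>z\<in>Z. w ^ b * (y z * w powi z))"
      unfolding q_def poly_sum
    proof (rule sum.cong)
      fix z assume "z \<in> Z"
      then have "w ^ nat (z + int b) = w powi (z + int b)"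
        using b by (simp add: power_int_def)
      then show "poly (monom (y z) (nat (z + int b))) w = w ^ b * (y z * w powi z)"
        using \<open>w \<noteq> 0\<close> by (simp add: poly_monom power_int_add)
    qed simp
    also have "\<dots> = 0" using assms(3)[OF that] by (simp add: sum_distrib_left[symmetric])
    finally show ?thesis .
  qed
  then have "- (insert 0 B) \<subseteq> {w. poly q w = 0}" by auto
  moreover have "infinite (- insert 0 B)"
    using assms(2) infinite_UNIV_char_0[where 'a='k] by (simp add: Compl_eq_Diff_UNIV)
  ultimately have "q = 0"
    using poly_roots_finite[of q] finite_subset by blast
  then have "0 = coeff q (nat (z + int b))" by simp
  also have "\<dots> = (\<Sum>z'\<in>Z. if z' = z then y z' else 0)"
    unfolding q_def coeff_sum using b \<open>z \<in> Z\<close>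
    by (intro sum.cong) (auto simp: nat_eq_iff)
  also have "\<dots> = y z" using assms by simp
  finally show ?thesis by simp
qed

section \<open>The coordinate ring of a trinomial hypersurface\<close>

lemma fun_power_apply: "(f ^ n) x = (f x ^ n :: 'b::comm_semiring_1)"
  by (induction n) (simp_all add: times_fun_def one_fun_def)

lemma fun_sum_apply: "(sum f I) x = (\<Sum>i\<in>I. f i x :: 'b::comm_semiring_1)"
  by (induction I rule: infinite_finite_induct) simp_all

lemma fun_prod_apply: "(prod f I) x = (\<Prod>i\<in>I. f i x :: 'b::comm_semiring_1)"
  by (induction I rule: infinite_finite_induct) (simp_all add: one_fun_def)

text \<open>The variables are split into the groups \<open>Vs 0\<close>, \<open>Vs 1\<close>, \<open>Vs 2\<close>, and \<open>l v\<close> is the exponent of the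
  variable \<open>v\<close>. Most arguments are symmetric in the three groups and are stated for distinct indices
  \<open>i\<close>, \<open>j\<close>, \<open>k\<close>.\<close>
locale trinomial_hypersurface =
  fixes Vs :: "nat \<Rightarrow> 'v::countable set" and l :: "'v \<Rightarrow> nat"
    and X :: "('v \<Rightarrow> 'k::{alg_closed_field, field_char_0}) set"
  assumes finite_Vs [simp, intro]: "i < 3 \<Longrightarrow> finite (Vs i)"
    and Vs_nonempty: "i < 3 \<Longrightarrow> Vs i \<noteq> {}"
    and Vs_disjoint: "i < 3 \<Longrightarrow> j < 3 \<Longrightarrow> i \<noteq> j \<Longrightarrow> Vs i \<inter> Vs j = {}"
    and l_ge_2: "i < 3 \<Longrightarrow> v \<in> Vs i \<Longrightarrow> l v \<ge> 2"
    and coprime_Gcd: "i < 3 \<Longrightarrow> j < 3 \<Longrightarrow> i \<noteq> j \<Longrightarrow> coprime (Gcd (l ` Vs i)) (Gcd (l ` Vs j))"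
    and X_eq: "X = {x \<in> (\<Union>i<3. Vs i) \<rightarrow>\<^sub>E UNIV. (\<Sum>i<3. \<Prod>v\<in>Vs i. x v ^ l v) = 0}"
begin

definition V :: "'v set" where "V = (\<Union>i<3. Vs i)"

definition Mv :: "nat \<Rightarrow> ('v \<Rightarrow> 'k) \<Rightarrow> 'k"
  where "Mv i x = (\<Prod>v\<in>Vs i. x v ^ l v)"

definition idx :: "'v \<Rightarrow> nat"
  where "idx v = (THE i. i < 3 \<and> v \<in> Vs i)"

lemma finite_V [simp, intro]: "finite V"
  by (auto simp: V_def)

lemma Vs_V: "i < 3 \<Longrightarrow> v \<in> Vs i \<Longrightarrow> v \<in> V"
  by (auto simp: V_def)

lemma idx_eq: "i < 3 \<Longrightarrow> v \<in> Vs i \<Longrightarrow> idx v = i"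
  unfolding idx_def using Vs_disjoint by blast

lemma V_cases: "v \<in> V \<Longrightarrow> (\<And>i. i < 3 \<Longrightarrow> v \<in> Vs i \<Longrightarrow> P) \<Longrightarrow> P"
  by (auto simp: V_def)

lemma idx_less: "v \<in> V \<Longrightarrow> idx v < 3" and idx_mem: "v \<in> V \<Longrightarrow> v \<in> Vs (idx v)"
  by (auto elim!: V_cases simp: idx_eq)

lemma l_pos: "v \<in> V \<Longrightarrow> l v > 0"
  by (auto elim!: V_cases dest: l_ge_2)

lemma sum_V: "(\<Sum>v\<in>V. f v) = (\<Sum>i<3. \<Sum>v\<in>Vs i. f v)" for f :: "'v \<Rightarrow> 'b::comm_monoid_add"
  unfolding V_def by (intro sum.UNION_disjoint) (auto dest: Vs_disjoint)

lemma prod_V: "(\<Prod>v\<in>V. f v) = (\<Prod>i<3. \<Prod>v\<in>Vs i. f v)" for f :: "'v \<Rightarrow> 'b::comm_monoid_mult"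
  unfolding V_def by (intro prod.UNION_disjoint) (auto dest: Vs_disjoint)

lemma X_iff: "x \<in> X \<longleftrightarrow> x \<in> V \<rightarrow>\<^sub>E UNIV \<and> (\<Sum>i<3. Mv i x) = 0"
  by (simp add: X_eq V_def Mv_def)

lemma sum_3: "i < 3 \<Longrightarrow> j < 3 \<Longrightarrow> k < 3 \<Longrightarrow> distinct [i, j, k] \<Longrightarrow> (\<Sum>i<3. f i) = f i + f j + f k"
  for f :: "nat \<Rightarrow> 'b::comm_monoid_add"
  by (simp add: numeral_3_eq_3 less_Suc_eq) (auto simp: ac_simps)

lemma third_index: "i < 3 \<Longrightarrow> j < 3 \<Longrightarrow> i \<noteq> j \<Longrightarrow> \<exists>k<(3::nat). distinct [i, j, k]"
  by (rule exI[of _ "3 - i - j"]) (simp, presburger)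

subsection \<open>Points\<close>

definition origin :: "'v \<Rightarrow> 'k" where "origin = (\<lambda>v\<in>V. 0)"

lemma Mv_origin: "i < 3 \<Longrightarrow> Mv i origin = 0"
proof -
  assume i: "i < 3"
  obtain v where v: "v \<in> Vs i" using Vs_nonempty[OF i] by auto
  have "origin v ^ l v = 0"
    using l_ge_2[OF i v] Vs_V[OF i v] by (simp add: origin_def)
  then show ?thesis
    unfolding Mv_def using i v by (intro prod_zero) auto
qed

lemma origin_in_X: "origin \<in> X"
  unfolding X_iff by (simp add: Mv_origin) (simp add: origin_def)

lemma Mv_cong: "(\<And>v. v \<in> Vs i \<Longrightarrow> x v = y v) \<Longrightarrow> Mv i x = Mv i y"
  by (simp add: Mv_def)

text \<open>It suffices to take a root for one coordinate and \<open>1\<close> for the others.\<close>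
lemma root_group:
  assumes "i < 3"
  shows "\<exists>x. Mv i x = c \<and> (c \<noteq> 0 \<longrightarrow> (\<forall>v\<in>Vs i. x v \<noteq> 0))"
proof -
  obtain u where u: "u \<in> Vs i" using Vs_nonempty[OF assms] by auto
  have "l u > 0" using l_ge_2[OF assms u] by simp
  then obtain z where z: "z ^ l u = c" using nth_root_exists by blast
  let ?x = "(\<lambda>_. 1)(u := z)"
  have "Mv i ?x = (\<Prod>v\<in>Vs i. if v = u then c else 1)"
    unfolding Mv_def by (rule prod.cong) (auto simp: z)
  then have "Mv i ?x = c" using u assms by simp
  moreover have "c \<noteq> 0 \<longrightarrow> z \<noteq> 0" using z \<open>l u > 0\<close> by auto
  ultimately show ?thesis by (intro exI[of _ ?x]) auto
qed

text \<open>The equation prescribes only the third monomial, and a monomial takes every value.\<close>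
lemma point_exists:
  assumes "i < 3" "j < 3" "i \<noteq> j"
  shows "\<exists>x\<in>X. (\<forall>v\<in>Vs i \<union> Vs j. x v = y v) \<and>
           (Mv i y + Mv j y \<noteq> 0 \<longrightarrow> (\<forall>v\<in>V - Vs i - Vs j. x v \<noteq> 0))"
proof -
  obtain k where k: "k < 3" "distinct [i, j, k]" using third_index[OF assms] by blast
  obtain x where x: "Mv k x = - (Mv i y + Mv j y)"
    "Mv i y + Mv j y \<noteq> 0 \<longrightarrow> (\<forall>v\<in>Vs k. x v \<noteq> 0)"
    using root_group[OF k(1), of "- (Mv i y + Mv j y)"] by (metis neg_equal_0_iff_equal)
  define z where "z = (\<lambda>v\<in>V. if v \<in> Vs k then x v else y v)"
  have disj: "Vs i \<inter> Vs k = {}" "Vs j \<inter> Vs k = {}"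
    using k assms Vs_disjoint by auto
  have eqs: "Mv i z = Mv i y" "Mv j z = Mv j y" "Mv k z = Mv k x"
    using disj assms k by (auto intro!: Mv_cong simp: z_def Vs_V)
  have "z \<in> X"
    unfolding X_iff sum_3[OF assms(1,2) k] eqs x(1) by (simp add: z_def)
  moreover have "V - Vs i - Vs j \<subseteq> Vs k"
  proof
    fix v assume "v \<in> V - Vs i - Vs j"
    then obtain m where "m < 3" "v \<in> Vs m" "m \<noteq> i" "m \<noteq> j" by (auto elim!: V_cases)
    then have "m = k" using k assms by auto
    then show "v \<in> Vs k" using \<open>v \<in> Vs m\<close> by simp
  qed
  ultimately show ?thesis
    using x(2) disj assms k by (intro bexI[of _ z]) (auto simp: z_def Vs_V)
qed

lemma generic_point:
  assumes "i < 3" "j < 3" "i \<noteq> j" "w \<noteq> 0" "w \<noteq> -1"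
  shows "\<exists>x\<in>X. (\<forall>v\<in>V. x v \<noteq> 0) \<and> Mv i x = w \<and> Mv j x = 1"
proof -
  obtain y where y: "Mv i y = w" "\<forall>v\<in>Vs i. y v \<noteq> 0"
    using root_group[OF assms(1), of w] assms by auto
  define z where "z = (\<lambda>v. if v \<in> Vs i then y v else 1)"
  have d: "Vs i \<inter> Vs j = {}" using assms Vs_disjoint by auto
  have z: "Mv i z = w" using y(1) Mv_cong[of i z y] by (simp add: z_def)
  have zj: "Mv j z = 1"
    unfolding Mv_def z_def using d by (intro prod.neutral) auto
  have "Mv i z + Mv j z \<noteq> 0"
    using assms(5) z zj by (metis add_eq_0_iff2 minus_minus)
  then obtain x where x: "x \<in> X" "\<forall>v\<in>Vs i \<union> Vs j. x v = z v" "\<forall>v\<in>V - Vs i - Vs j. x v \<noteq> 0"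
    using point_exists[OF assms(1,2,3), of z] by auto
  have "x v \<noteq> 0" if "v \<in> V" for v
    using x that y(2) by (cases "v \<in> Vs i \<union> Vs j") (auto simp: z_def)
  moreover have "Mv i x = w" "Mv j x = 1"
    using x(2) z zj Mv_cong[of i x z] Mv_cong[of j x z] by auto
  ultimately show ?thesis using x(1) by blast
qed

subsection \<open>Regular functions\<close>

text \<open>A retraction onto the hypersurface. Functions on \<open>X\<close> become the functions that factor through it,
  which makes the coordinate ring a subring of a function type with pointwise operations.\<close>
definition retr :: "('v \<Rightarrow> 'k) \<Rightarrow> ('v \<Rightarrow> 'k)"
  where "retr x = (if x \<in> X then x else origin)"

text \<open>Restriction of polynomials to the hypersurface.\<close>
definition rho :: "('v, 'k) mpoly \<Rightarrow> ('v \<Rightarrow> 'k) \<Rightarrow> 'k"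
  where "rho p = (\<lambda>x. meval p (retr x))"

definition A :: "(('v \<Rightarrow> 'k) \<Rightarrow> 'k) set"
  where "A = rho ` {p. mvars p \<subseteq> V}"

definition con :: "'k \<Rightarrow> ('v \<Rightarrow> 'k) \<Rightarrow> 'k"
  where "con c = (\<lambda>_. c)"

definition T :: "'v \<Rightarrow> ('v \<Rightarrow> 'k) \<Rightarrow> 'k"
  where "T v = (\<lambda>x. retr x v)"

definition mon :: "('v \<Rightarrow> nat) \<Rightarrow> ('v \<Rightarrow> 'k) \<Rightarrow> 'k"
  where "mon e = (\<Prod>v\<in>V. T v ^ e v)"

definition M :: "nat \<Rightarrow> ('v \<Rightarrow> 'k) \<Rightarrow> 'k"
  where "M i = (\<Prod>v\<in>Vs i. T v ^ l v)"

lemma retr_in_X [simp]: "retr x \<in> X"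
  by (simp add: retr_def origin_in_X)

lemma retr_X [simp]: "x \<in> X \<Longrightarrow> retr x = x"
  by (simp add: retr_def)

lemma con_apply [simp]: "con c x = c" by (simp add: con_def)
lemma T_apply [simp]: "T v x = retr x v" by (simp add: T_def)
lemma M_apply: "M i x = Mv i (retr x)"
  by (simp add: M_def Mv_def fun_prod_apply fun_power_apply)
lemma mon_apply: "mon e x = (\<Prod>v\<in>V. retr x v ^ e v)"
  by (simp add: mon_def fun_prod_apply fun_power_apply)

lemma con_add: "con (a + b) = con a + con b" by (simp add: fun_eq_iff)
lemma con_mult: "con (a * b) = con a * con b" by (simp add: fun_eq_iff)
lemma con_0 [simp]: "con 0 = 0" by (simp add: fun_eq_iff)
lemma con_1 [simp]: "con 1 = 1" by (simp add: fun_eq_iff one_fun_def)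
lemma con_minus: "con (- a) = - con a" by (simp add: fun_eq_iff)
lemma con_diff: "con (a - b) = con a - con b" by (simp add: fun_eq_iff)
lemma con_eq_0_iff [simp]: "con c = 0 \<longleftrightarrow> c = 0" by (auto simp: fun_eq_iff)

lemma rho_apply: "rho p x = meval p (retr x)" by (simp add: rho_def)

lemma rho_add: "rho (p + q) = rho p + rho q"
  by (simp add: fun_eq_iff rho_apply meval_add)
lemma rho_mult: "rho (p * q) = rho p * rho q"
  by (simp add: fun_eq_iff rho_apply meval_mult)
lemma rho_mconst [simp]: "rho (mconst c) = con c"
  by (simp add: fun_eq_iff rho_apply)
lemma rho_mvar [simp]: "rho (mvar v) = T v"
  by (simp add: fun_eq_iff rho_apply)

lemma meval_uminus: "meval (- p) x = - meval p x"
  using meval_add[of p "- p" x] by (simp add: eq_neg_iff_add_eq_0 add.commute)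

lemma rho_uminus: "rho (- p) = - rho p"
  by (simp add: fun_eq_iff rho_apply meval_uminus)

sublocale ring_subset A
proof
  show "1 \<in> A"
    unfolding A_def by (rule image_eqI[of _ _ 1]) (simp_all add: fun_eq_iff rho_apply one_fun_def)
next
  fix a b assume "a \<in> A" "b \<in> A"
  then obtain p q where "a = rho p" "b = rho q" "mvars p \<subseteq> V" "mvars q \<subseteq> V"
    by (auto simp: A_def)
  then show "a + b \<in> A" "a * b \<in> A"
    using mvars_add[of p q] mvars_mult[of p q] unfolding A_def
    by (auto simp: rho_add[symmetric] rho_mult[symmetric] intro!: imageI)
next
  fix a assume "a \<in> A"
  then obtain p where "a = rho p" "mvars p \<subseteq> V"
    by (auto simp: A_def)
  then show "- a \<in> A"
    unfolding A_def by (auto simp: rho_uminus[symmetric] intro!: imageI)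
qed

lemma con_in [simp, intro]: "con c \<in> A"
  unfolding A_def by (rule image_eqI[of _ _ "mconst c"]) auto

lemma T_in [simp, intro]: "v \<in> V \<Longrightarrow> T v \<in> A"
  unfolding A_def using mvars_mvar[of v] by (intro image_eqI[of _ _ "mvar v"]) auto

lemma mon_in [simp, intro]: "mon e \<in> A"
  unfolding mon_def by (intro prod_in power_in T_in)

lemma M_in [simp, intro]: "i < 3 \<Longrightarrow> M i \<in> A"
  unfolding M_def by (intro prod_in power_in T_in) (auto simp: Vs_V)

lemma A_retr: "a \<in> A \<Longrightarrow> a (retr x) = a x"
  by (auto simp: A_def rho_apply)

lemma mmono_V:
  "Poly_Mapping.keys m \<subseteq> V \<Longrightarrow> mmono m x = (\<Prod>v\<in>V. x v ^ Poly_Mapping.lookup m v)"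
  by (rule mmono_superset) auto

lemma keys_V: "mvars p \<subseteq> V \<Longrightarrow> m \<in> Poly_Mapping.keys p \<Longrightarrow> Poly_Mapping.keys m \<subseteq> V"
  by (auto simp: mvars_def)

lemma rho_eq_sum:
  assumes "mvars p \<subseteq> V"
  shows "rho p = (\<Sum>m\<in>Poly_Mapping.keys p. con (Poly_Mapping.lookup p m) * mon (Poly_Mapping.lookup m))"
proof
  fix x
  show "rho p x = (\<Sum>m\<in>Poly_Mapping.keys p. con (Poly_Mapping.lookup p m) * mon (Poly_Mapping.lookup m)) x"
    unfolding rho_apply meval_def fun_sum_apply
    by (rule sum.cong) (auto simp: mon_apply mmono_V keys_V[OF assms])
qed

lemma A_induct [consumes 1, case_names mon add]:
  assumes "a \<in> A" "\<And>c e. P (con c * mon e)" "\<And>a b. a \<in> A \<Longrightarrow> b \<in> A \<Longrightarrow> P a \<Longrightarrow> P b \<Longrightarrow> P (a + b)"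
  shows "P a"
proof -
  obtain p where p: "a = rho p" "mvars p \<subseteq> V" using assms(1) by (auto simp: A_def)
  have "P (\<Sum>m\<in>S. con (Poly_Mapping.lookup p m) * mon (Poly_Mapping.lookup m))" if "finite S" for S
    using that
  proof induction
    case empty
    show ?case using assms(2)[of 0] by (simp add: zero_fun_def[symmetric])
  next
    case (insert m S)
    show ?case
      unfolding sum.insert[OF insert(1,2)] by (intro assms(2,3) insert.IH sum_in mult_in con_in mon_in)
  qed
  then show ?thesis unfolding p(1) rho_eq_sum[OF p(2)] by auto
qed

lemma M_sum: "i < 3 \<Longrightarrow> j < 3 \<Longrightarrow> k < 3 \<Longrightarrow> distinct [i, j, k] \<Longrightarrow> M i + M j + M k = 0"
proof
  fix x assume a: "i < 3" "j < 3" "k < 3" "distinct [i, j, k]"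
  show "(M i + M j + M k) x = 0 x"
    using retr_in_X[of x] unfolding X_iff sum_3[OF a] by (simp add: M_apply)
qed

lemma mon_add: "mon (\<lambda>v. e v + e' v) = mon e * mon e'"
  by (simp add: mon_def power_add prod.distrib)

lemma mon_cong: "(\<And>v. v \<in> V \<Longrightarrow> e v = e' v) \<Longrightarrow> mon e = mon e'"
  by (simp add: mon_def)

lemma mon_zero: "(\<And>v. v \<in> V \<Longrightarrow> e v = 0) \<Longrightarrow> mon e = 1"
  by (simp add: mon_def)

lemma mon_group: "i < 3 \<Longrightarrow> mon (\<lambda>v. if v \<in> Vs i then e v else 0) = (\<Prod>v\<in>Vs i. T v ^ e v)"
  unfolding mon_def using Vs_V
  by (intro prod.mono_neutral_cong_right) auto

lemma mon_T: "v \<in> V \<Longrightarrow> mon (\<lambda>u. if u = v then 1 else 0) = T v"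
proof -
  assume "v \<in> V"
  have "mon (\<lambda>u. if u = v then 1 else 0) = (\<Prod>u\<in>V. if u = v then T u else 1)"
    unfolding mon_def by (rule prod.cong) auto
  then show ?thesis using \<open>v \<in> V\<close> by simp
qed

subsection \<open>The grading\<close>

definition lam :: "'v \<Rightarrow> nat" where "lam v = (\<Prod>u\<in>V - {v}. l u)"

definition lamV :: nat where "lamV = (\<Prod>u\<in>V. l u)"

definition ycoord :: "'v \<Rightarrow> int poly" where "ycoord v = monom 1 (Suc (to_nat v))"

definition nu :: "nat \<Rightarrow> nat" where "nu i = (\<Prod>j\<in>{..<3} - {i}. card (Vs j))"

text \<open>The degrees live in \<open>int poly\<close>, an ordered group with a basis given by the powers of the
  indeterminate. The degree of \<open>v\<close> is chosen such that the relations between the degrees are those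
  between the characters of the torus: up to a common factor it is
  \<open>(n y\<^sub>v - (\<Sum>u. y\<^sub>u) + const) / l v\<close>, where \<open>u\<close> ranges over the \<open>n\<close> variables of the group of \<open>v\<close>.
  Weighted with the exponents, the sum over a group no longer involves the \<open>y\<^sub>u\<close>, and the constant is
  chosen to make the sum independent of the group. The factors \<open>lam\<close> and \<open>nu\<close> clear denominators.\<close>
definition dg :: "'v \<Rightarrow> int poly"
  where "dg v = of_nat (lam v) *
    (of_nat (card (Vs (idx v))) * ycoord v - (\<Sum>u\<in>Vs (idx v). ycoord u) + of_nat (nu (idx v)))"

definition dge :: "('v \<Rightarrow> nat) \<Rightarrow> int poly"
  where "dge e = (\<Sum>v\<in>V. of_nat (e v) * dg v)"

text \<open>The common degree of the three monomials of the trinomial.\<close>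
definition delta :: "int poly" where "delta = of_nat (lamV * (\<Prod>i<3. card (Vs i)))"

lemma l_lam: "v \<in> V \<Longrightarrow> l v * lam v = lamV"
  unfolding lam_def lamV_def by (simp add: prod.remove[of V v])

lemma lamV_pos: "lamV > 0"
  unfolding lamV_def by (auto intro!: prod_pos l_pos)

lemma card_pos: "i < 3 \<Longrightarrow> card (Vs i) > 0"
  using Vs_nonempty by (simp add: card_gt_0_iff)

lemma card_nu: "i < 3 \<Longrightarrow> card (Vs i) * nu i = (\<Prod>i<3. card (Vs i))"
  unfolding nu_def by (simp add: prod.remove[of "{..<3}" i])

lemma delta_ne_0: "delta \<noteq> 0"
proof -
  have "lamV * (\<Prod>i<3. card (Vs i)) \<noteq> 0"
    using lamV_pos card_pos Vs_nonempty by (auto simp: card_eq_0_iff)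
  then show ?thesis unfolding delta_def by (simp only: of_nat_eq_0_iff not_False_eq_True)
qed

lemma dg_group:
  assumes "i < 3"
  shows "(\<Sum>v\<in>Vs i. of_nat (l v) * dg v) = delta"
proof -
  let ?n = "card (Vs i)" and ?Y = "\<Sum>u\<in>Vs i. ycoord u"
  have "(\<Sum>v\<in>Vs i. of_nat (l v) * dg v) =
      (\<Sum>v\<in>Vs i. of_nat lamV * (of_nat ?n * ycoord v - ?Y + of_nat (nu i)))"
  proof (rule sum.cong)
    fix v assume v: "v \<in> Vs i"
    have "of_nat (l v) * dg v = of_nat (l v * lam v) * (of_nat ?n * ycoord v - ?Y + of_nat (nu i))"
      unfolding dg_def idx_eq[OF assms v] of_nat_mult by (simp only: mult.assoc)
    then show "of_nat (l v) * dg v = of_nat lamV * (of_nat ?n * ycoord v - ?Y + of_nat (nu i))"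
      using l_lam[OF Vs_V[OF assms v]] by simp
  qed simp
  also have "\<dots> = of_nat lamV * (of_nat ?n * ?Y - of_nat ?n * ?Y + of_nat ?n * of_nat (nu i))"
    by (simp only: sum_distrib_left[symmetric] sum.distrib sum_subtractf sum_constant)
  also have "\<dots> = delta"
    unfolding delta_def card_nu[OF assms, symmetric] by simp
  finally show ?thesis .
qed

lemma coeff_dg:
  assumes "i < 3" "v \<in> Vs i" "u \<in> V"
  shows "coeff (dg v) (Suc (to_nat u)) =
    (if u \<in> Vs i then int (lam v) * (int (card (Vs i)) * (if v = u then 1 else 0) - 1) else 0)"
proof -
  have y: "coeff (ycoord w) (Suc (to_nat u)) = (if w = u then 1 else 0)" for w
    by (simp add: ycoord_def)
  have "coeff (dg v) (Suc (to_nat u)) = int (lam v) *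
      (int (card (Vs i)) * (if v = u then 1 else 0) - (\<Sum>w\<in>Vs i. if w = u then 1 else 0))"
    unfolding dg_def idx_eq[OF assms(1,2)]
    by (simp add: of_nat_poly coeff_sum y)
  then show ?thesis using assms by auto
qed

lemma coeff_dg_0: "i < 3 \<Longrightarrow> v \<in> Vs i \<Longrightarrow> coeff (dg v) 0 = int (lam v) * int (nu i)"
  by (simp add: dg_def idx_eq of_nat_poly coeff_sum ycoord_def)

text \<open>Comparing coefficients of the degrees, the difference of the exponents is on each group a rational
  multiple of the exponents of the monomial, and the three factors add up to zero. The denominator
  of each factor divides the gcd of its group, hence also, as the sum is zero, the product of the
  other two gcds; coprimality makes the factors integers.\<close>
lemma dge_eqD:
  assumes "dge e = dge e'"
  shows "\<exists>s. (\<Sum>i<3. s i) = 0 \<and> (\<forall>i<3. \<forall>v\<in>Vs i. int (e' v) = int (e v) + s i * int (l v))"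
proof -
  define d where "d v = int (e' v) - int (e v)" for v
  define al where "al v = d v * int (lam v)" for v
  have d0: "(\<Sum>v\<in>V. of_int (d v) * dg v) = 0"
    using assms by (simp add: dge_def d_def left_diff_distrib sum_subtractf)
  have sumV: "(\<Sum>i<3. \<Sum>v\<in>Vs i. d v * coeff (dg v) m) = 0" for m
  proof -
    have "(\<Sum>v\<in>V. d v * coeff (dg v) m) = coeff (\<Sum>v\<in>V. of_int (d v) * dg v) m"
      by (simp add: coeff_sum of_int_poly)
    then show ?thesis by (simp add: d0 sum_V)
  qed
  have al_const: "int (card (Vs i)) * al u = (\<Sum>v\<in>Vs i. al v)" if "i < 3" "u \<in> Vs i" for i u
  proof -
    have *: "(\<Sum>v\<in>Vs j. d v * coeff (dg v) (Suc (to_nat u))) =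
        (if j = i then int (card (Vs i)) * al u - (\<Sum>v\<in>Vs i. al v) else 0)" if "j < 3" for j
    proof (cases "j = i")
      case True
      have "(\<Sum>v\<in>Vs j. d v * coeff (dg v) (Suc (to_nat u))) =
          (\<Sum>v\<in>Vs i. (if v = u then int (card (Vs i)) * al u else 0) - al v)"
        using \<open>i < 3\<close> \<open>u \<in> Vs i\<close> True Vs_V
        by (intro sum.cong) (auto simp: coeff_dg al_def algebra_simps)
      then show ?thesis using True \<open>u \<in> Vs i\<close> \<open>i < 3\<close> by (simp add: sum_subtractf)
    next
      case False
      then have "u \<notin> Vs j" using Vs_disjoint[of i j] that \<open>i < 3\<close> \<open>u \<in> Vs i\<close> by auto
      then have "(\<Sum>v\<in>Vs j. d v * coeff (dg v) (Suc (to_nat u))) = 0"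
        using that Vs_V[OF \<open>i < 3\<close> \<open>u \<in> Vs i\<close>] by (intro sum.neutral) (auto simp: coeff_dg)
      then show ?thesis using False by simp
    qed
    have "(\<Sum>j<3. if j = i then int (card (Vs i)) * al u - (\<Sum>v\<in>Vs i. al v) else 0) =
        (\<Sum>j<3. \<Sum>v\<in>Vs j. d v * coeff (dg v) (Suc (to_nat u)))"
      by (rule sum.cong) (auto simp: *)
    also have "\<dots> = 0" by (rule sumV)
    finally show ?thesis using that by simp
  qed
  have "\<exists>a. \<forall>v\<in>Vs i. al v = a" if "i < 3" for i
  proof (intro exI ballI)
    fix v assume v: "v \<in> Vs i"
    have "int (card (Vs i)) * al v = int (card (Vs i)) * al (SOME u. u \<in> Vs i)"
      using al_const[OF that v] al_const[OF that someI[of "\<lambda>u. u \<in> Vs i", OF v]] by simp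
    then show "al v = al (SOME u. u \<in> Vs i)" using card_pos[OF that] by simp
  qed
  then obtain a where a: "\<And>i v. i < 3 \<Longrightarrow> v \<in> Vs i \<Longrightarrow> al v = a i" by metis
  have suma: "(\<Sum>i<3. a i) = 0"
  proof -
    let ?N = "int (\<Prod>i<3. card (Vs i))"
    have "(\<Sum>v\<in>Vs i. d v * coeff (dg v) 0) = a i * ?N" if "i < 3" for i
    proof -
      have "(\<Sum>v\<in>Vs i. d v * coeff (dg v) 0) = (\<Sum>v\<in>Vs i. a i * int (nu i))"
        using that a[OF that] by (intro sum.cong) (auto simp: coeff_dg_0 al_def)
      also have "\<dots> = a i * ?N" unfolding card_nu[OF that, symmetric] by simp
      finally show ?thesis .
    qed
    then have "(\<Sum>i<3. a i * ?N) = (\<Sum>i<3. \<Sum>v\<in>Vs i. d v * coeff (dg v) 0)"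
      by (intro sum.cong) auto
    then have "(\<Sum>i<3. a i) * ?N = 0" using sumV[of 0] by (simp add: sum_distrib_right)
    moreover have "?N \<noteq> 0" using Vs_nonempty by (auto simp: card_eq_0_iff)
    ultimately show ?thesis by simp
  qed
  have dl: "d v * int lamV = a i * int (l v)" if "i < 3" "v \<in> Vs i" for i v
    using a[OF that] l_lam[OF Vs_V[OF that]] unfolding al_def
    by (metis mult.assoc mult.commute of_nat_mult)
  have dvdG: "int lamV dvd a i * int (Gcd (l ` Vs i))" if "i < 3" for i
  proof -
    have "nat \<bar>int lamV\<bar> dvd Gcd ((*) (nat \<bar>a i\<bar>) ` (l ` Vs i))"
    proof (rule Gcd_greatest)
      fix b assume "b \<in> (*) (nat \<bar>a i\<bar>) ` l ` Vs i"
      then obtain v where v: "v \<in> Vs i" "b = nat \<bar>a i\<bar> * l v" by auto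
      have "int lamV dvd a i * int (l v)" using dl[OF that v(1)] by (metis dvd_triv_right)
      then have "int lamV dvd int b" unfolding v(2) by simp (metis abs_mult abs_of_nat dvd_abs_iff)
      then show "nat \<bar>int lamV\<bar> dvd b" by simp
    qed
    also have "Gcd ((*) (nat \<bar>a i\<bar>) ` (l ` Vs i)) = nat \<bar>a i\<bar> * Gcd (l ` Vs i)"
      by (simp add: Gcd_mult)
    finally have "lamV dvd nat \<bar>a i\<bar> * Gcd (l ` Vs i)" by simp
    then have "int lamV dvd int (nat \<bar>a i\<bar> * Gcd (l ` Vs i))" by (simp only: of_nat_dvd_iff)
    then have "int lamV dvd \<bar>a i\<bar> * int (Gcd (l ` Vs i))" unfolding of_nat_mult by simp
    then show ?thesis by (metis abs_mult abs_of_nat dvd_abs_iff)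
  qed
  have dvda: "int lamV dvd a i" if "i < 3" for i
  proof -
    obtain j where j: "j < 3" "j \<noteq> i" by (cases "i = 0") (auto intro: that[of 1] that[of 0])
    obtain k where k: "k < 3" "distinct [i, j, k]" using third_index[OF \<open>i < 3\<close> j(1)] j(2) by metis
    let ?G = "\<lambda>i. int (Gcd (l ` Vs i))"
    have ai: "a i = - a j - a k"
      using suma sum_3[of i j k a] \<open>i < 3\<close> j k by auto
    have "a i * (?G j * ?G k) = - (a j * ?G j) * ?G k - (a k * ?G k) * ?G j"
      unfolding ai by (simp add: algebra_simps)
    then have 1: "int lamV dvd a i * (?G j * ?G k)"
      using dvdG[OF j(1)] dvdG[OF k(1)] by (simp add: dvd_diff)
    have "coprime (?G i) (?G j * ?G k)"
      using coprime_Gcd[of i j] coprime_Gcd[of i k] that j k by (simp add: coprime_mult_right_iff)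
    then obtain u w where uw: "u * ?G i + w * (?G j * ?G k) = 1"
      using bezout_int[of "?G i" "?G j * ?G k"] by (auto simp: coprime_iff_gcd_eq_1)
    have "a i = (a i * ?G i) * u + (a i * (?G j * ?G k)) * w"
      using uw by (metis (no_types, opaque_lifting) distrib_left mult.assoc mult.commute mult_1_right)
    then show ?thesis using dvdG[OF that] 1 by (metis dvd_add dvd_mult2)
  qed
  define s where "s i = a i div int lamV" for i
  have s: "a i = s i * int lamV" if "i < 3" for i
    using dvda[OF that] by (simp add: s_def)
  have "(\<Sum>i<3. s i) * int lamV = (\<Sum>i<3. a i)"
    unfolding sum_distrib_right by (rule sum.cong) (auto simp: s)
  then have "(\<Sum>i<3. s i) = 0" using suma lamV_pos by simp
  moreover have "int (e' v) = int (e v) + s i * int (l v)" if "i < 3" "v \<in> Vs i" for i v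
  proof -
    have "d v * int lamV = s i * int (l v) * int lamV" using dl[OF that] s[OF that(1)] by simp
    then have "d v = s i * int (l v)" using lamV_pos by simp
    then show ?thesis by (simp add: d_def)
  qed
  ultimately show ?thesis by blast
qed

lemma dge_add: "dge (\<lambda>v. e v + e' v) = dge e + dge e'"
  by (simp add: dge_def distrib_right sum.distrib)

end

section \<open>Homogeneous components of regular functions\<close>

definition filt :: "('m \<Rightarrow> bool) \<Rightarrow> ('m \<Rightarrow>\<^sub>0 'k) \<Rightarrow> ('m \<Rightarrow>\<^sub>0 'k::zero)"
  where "filt P p = Abs_poly_mapping (\<lambda>m. Poly_Mapping.lookup p m when P m)"

lemma lookup_filt: "Poly_Mapping.lookup (filt P p) m = (Poly_Mapping.lookup p m when P m)"
proof -
  have "finite {m. (Poly_Mapping.lookup p m when P m) \<noteq> 0}"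
    by (rule finite_subset[of _ "Poly_Mapping.keys p"]) (auto simp: keys.rep_eq when_def split: if_splits)
  then show ?thesis unfolding filt_def by simp
qed

lemma keys_filt: "Poly_Mapping.keys (filt P p) = {m \<in> Poly_Mapping.keys p. P m}"
  by (auto simp: keys.rep_eq lookup_filt when_def)

lemma filt_id: "(\<And>m. m \<in> Poly_Mapping.keys p \<Longrightarrow> P m) \<Longrightarrow> filt P p = p"
  by (rule poly_mapping_eqI) (auto simp: lookup_filt when_def keys.rep_eq)

lemma filt_zero: "(\<And>m. m \<in> Poly_Mapping.keys p \<Longrightarrow> \<not> P m) \<Longrightarrow> filt P p = 0"
  by (rule poly_mapping_eqI) (auto simp: lookup_filt when_def keys.rep_eq)

lemma filt_add: "filt P (p + q) = filt P p + filt P q" for p q :: "'m \<Rightarrow>\<^sub>0 'k::comm_monoid_add"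
  by (rule poly_mapping_eqI) (auto simp: lookup_filt when_def lookup_add)

lemma mvars_filt: "mvars (filt P p) \<subseteq> mvars p"
  by (auto simp: mvars_def keys_filt)

lemma prod_power_int:
  assumes "(w::'k::field) \<noteq> 0"
  shows "(\<Prod>v\<in>S. w powi f v) = w powi (\<Sum>v\<in>S. f v)"
proof (induction S rule: infinite_finite_induct)
  case (insert v S)
  then show ?case using power_int_add[of w "f v" "sum f S"] assms by simp
qed auto

lemma power_int_power: "(w powi k) ^ n = w powi (int n * k)" for w :: "'k::field"
  by (subst mult.commute) (simp only: power_int_mult power_int_of_nat)

context trinomial_hypersurface
begin

definition pdeg :: "('v \<Rightarrow>\<^sub>0 nat) \<Rightarrow> int poly" where "pdeg m = dge (Poly_Mapping.lookup m)"

definition pcmp :: "int poly \<Rightarrow> ('v, 'k) mpoly \<Rightarrow> ('v, 'k) mpoly"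
  where "pcmp g = filt (\<lambda>m. pdeg m = g)"

lemma pdeg_add: "pdeg (m + m') = pdeg m + pdeg m'"
  by (simp add: pdeg_def dge_def lookup_add distrib_right sum.distrib)

lemma mvars_pcmp: "mvars p \<subseteq> V \<Longrightarrow> mvars (pcmp g p) \<subseteq> V"
  unfolding pcmp_def by (rule subset_trans[OF mvars_filt])

lemma pcmp_add: "pcmp g (p + q) = pcmp g p + pcmp g q"
  by (simp add: pcmp_def filt_add)

lemma pcmp_uminus: "pcmp g (- p) = - pcmp g p"
proof -
  have "pcmp g 0 = 0" unfolding pcmp_def by (rule filt_zero) simp
  then have "pcmp g p + pcmp g (- p) = 0" using pcmp_add[of g p "- p"] by simp
  then show ?thesis by (rule minus_unique[symmetric])
qed

lemma sum_pcmp: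
  assumes "finite G" "pdeg ` Poly_Mapping.keys p \<subseteq> G"
  shows "(\<Sum>g\<in>G. pcmp g p) = p"
proof (rule poly_mapping_eqI)
  fix m
  have "Poly_Mapping.lookup (\<Sum>g\<in>G. pcmp g p) m =
      (\<Sum>g\<in>G. if g = pdeg m then Poly_Mapping.lookup p m else 0)"
    unfolding lookup_sum pcmp_def by (rule sum.cong) (auto simp: lookup_filt when_def)
  also have "\<dots> = Poly_Mapping.lookup p m"
    using assms by (auto simp: keys.rep_eq image_subset_iff)
  finally show "Poly_Mapping.lookup (\<Sum>g\<in>G. pcmp g p) m = Poly_Mapping.lookup p m" .
qed

lemma poly_dge: "poly (dge e) N = (\<Sum>v\<in>V. int (e v) * poly (dg v) N)"
  by (simp add: dge_def poly_sum)

text \<open>A nonzero polynomial has finitely many roots, so a suitable integer distinguishes finitely many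
  degrees; this selects a one-parameter subgroup of the torus.\<close>
lemma separating_evaluation:
  fixes G :: "int poly set"
  assumes "finite G"
  shows "\<exists>N. inj_on (\<lambda>g. poly g N) G"
proof -
  let ?B = "\<Union>g\<in>G. \<Union>h\<in>G - {g}. {N. poly (g - h) N = 0}"
  have "finite ?B"
    using assms by (intro finite_UN_I finite_Diff poly_roots_finite) auto
  then obtain N where N: "N \<notin> ?B"
    using infinite_UNIV_int ex_new_if_finite by blast
  then have "inj_on (\<lambda>g. poly g N) G"
    by (intro inj_onI) (auto simp: poly_diff)
  then show ?thesis by blast
qed

text \<open>The torus acts on the hypersurface because the three monomials have the same degree.\<close>
lemma torus_point:
  assumes "x \<in> X" "w \<noteq> 0"
  shows "(\<lambda>v\<in>V. w powi (poly (dg v) N) * x v) \<in> X"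
proof -
  let ?y = "\<lambda>v\<in>V. w powi (poly (dg v) N) * x v"
  have "Mv i ?y = w powi (poly delta N) * Mv i x" if "i < 3" for i
  proof -
    have "Mv i ?y = (\<Prod>v\<in>Vs i. w powi (poly (of_nat (l v) * dg v) N) * x v ^ l v)"
      unfolding Mv_def
    proof (rule prod.cong)
      fix v assume "v \<in> Vs i"
      then have "v \<in> V" using that Vs_V by auto
      have "(w powi poly (dg v) N) ^ l v = w powi (int (l v) * poly (dg v) N)"
        by (rule power_int_power)
      then show "?y v ^ l v = w powi (poly (of_nat (l v) * dg v) N) * x v ^ l v"
        using \<open>v \<in> V\<close> by (simp add: power_mult_distrib)
    qed simp
    also have "\<dots> = w powi (poly (\<Sum>v\<in>Vs i. of_nat (l v) * dg v) N) * Mv i x"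
      unfolding prod.distrib prod_power_int[OF assms(2)] poly_sum Mv_def ..
    finally show ?thesis unfolding dg_group[OF that] .
  qed
  then have "(\<Sum>i<3. Mv i ?y) = w powi (poly delta N) * (\<Sum>i<3. Mv i x)"
    unfolding sum_distrib_left by (intro sum.cong) auto
  then show ?thesis using assms(1) by (simp add: X_iff)
qed

lemma mmono_torus_point:
  fixes w :: 'k
  assumes "Poly_Mapping.keys m \<subseteq> V" "w \<noteq> 0"
  shows "mmono m (\<lambda>v\<in>V. w powi (poly (dg v) N) * x v) = w powi (poly (pdeg m) N) * mmono m x"
proof -
  have "mmono m (\<lambda>v\<in>V. w powi (poly (dg v) N) * x v) =
      (\<Prod>v\<in>V. w powi (int (Poly_Mapping.lookup m v) * poly (dg v) N) * x v ^ Poly_Mapping.lookup m v)"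
    unfolding mmono_V[OF assms(1)]
  proof (rule prod.cong)
    fix v assume "v \<in> V"
    have "(w powi poly (dg v) N) ^ Poly_Mapping.lookup m v = w powi (int (Poly_Mapping.lookup m v) * poly (dg v) N)"
      by (rule power_int_power)
    then show "(\<lambda>v\<in>V. w powi (poly (dg v) N) * x v) v ^ Poly_Mapping.lookup m v =
        w powi (int (Poly_Mapping.lookup m v) * poly (dg v) N) * x v ^ Poly_Mapping.lookup m v"
      by (simp only: restrict_apply' \<open>v \<in> V\<close> power_mult_distrib)
  qed simp
  then show ?thesis
    unfolding prod.distrib prod_power_int[OF assms(2)] mmono_V[OF assms(1)] pdeg_def poly_dge .
qed

text \<open>Along an orbit of a one-parameter subgroup of the torus, a function that vanishes on the
  hypersurface becomes a Laurent polynomial that is zero, and its coefficients are the values of the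
  homogeneous components.\<close>
lemma pcmp_vanishes:
  assumes "mvars p \<subseteq> V" "\<And>x. x \<in> X \<Longrightarrow> meval p x = 0" "x \<in> X"
  shows "meval (pcmp g p) x = 0"
proof -
  let ?G = "pdeg ` Poly_Mapping.keys p"
  have fG: "finite ?G" by simp
  obtain N where N: "inj_on (\<lambda>g. poly g N) ?G" using separating_evaluation[OF fG] by blast
  let ?ev = "\<lambda>g. poly g N"
  define y where "y z = meval (pcmp (the_inv_into ?G ?ev z) p) x" for z
  have y: "y (?ev g) = meval (pcmp g p) x" if "g \<in> ?G" for g
    using the_inv_into_f_f[OF N that] by (simp add: y_def)
  have hom: "meval (pcmp g p) (\<lambda>v\<in>V. w powi (poly (dg v) N) * x v) = meval (pcmp g p) x * w powi (?ev g)"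
    if "w \<noteq> 0" for w g
    unfolding meval_def sum_distrib_right
  proof (rule sum.cong)
    fix m assume m: "m \<in> Poly_Mapping.keys (pcmp g p)"
    then have "Poly_Mapping.keys m \<subseteq> V" "pdeg m = g"
      using keys_V[OF assms(1)] by (auto simp: pcmp_def keys_filt)
    then show "Poly_Mapping.lookup (pcmp g p) m * mmono m (\<lambda>v\<in>V. w powi (poly (dg v) N) * x v) =
        Poly_Mapping.lookup (pcmp g p) m * mmono m x * w powi poly g N"
      using mmono_torus_point[OF _ that, of m N x] by simp
  qed simp
  have "(\<Sum>z\<in>?ev ` ?G. y z * w powi z) = 0" if "w \<noteq> 0" for w
  proof -
    let ?x = "\<lambda>v\<in>V. w powi (poly (dg v) N) * x v"
    have "(\<Sum>z\<in>?ev ` ?G. y z * w powi z) = (\<Sum>g\<in>?G. y (?ev g) * w powi (?ev g))"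
      by (subst sum.reindex[OF N]) simp
    also have "\<dots> = (\<Sum>g\<in>?G. meval (pcmp g p) ?x)"
      by (rule sum.cong) (auto simp: y hom[OF that])
    also have "\<dots> = meval p ?x"
      unfolding meval_sum[symmetric] using sum_pcmp[OF fG order_refl] by simp
    also have "\<dots> = 0" by (intro assms(2) torus_point assms(3) that)
    finally show ?thesis .
  qed
  then have "y (?ev g) = 0" if "g \<in> ?G" for g
    using that by (intro laurent_sum_zero[of "?ev ` ?G" "{}" y]) auto
  then have "meval (pcmp g p) x = 0" if "g \<in> ?G" using y that by simp
  moreover have "pcmp g p = 0" if "g \<notin> ?G"
    unfolding pcmp_def using that by (intro filt_zero) auto
  ultimately show ?thesis by (cases "g \<in> ?G") auto
qed

text \<open>Well defined by the homogeneity of the vanishing ideal, see \<open>cmp_rho\<close>.\<close>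
definition cmp :: "int poly \<Rightarrow> (('v \<Rightarrow> 'k) \<Rightarrow> 'k) \<Rightarrow> (('v \<Rightarrow> 'k) \<Rightarrow> 'k)"
  where "cmp g a = rho (pcmp g (SOME p. mvars p \<subseteq> V \<and> rho p = a))"

lemma rho_eqD: "rho p = rho q \<Longrightarrow> x \<in> X \<Longrightarrow> meval p x = meval q x"
  using rho_apply[of p x] rho_apply[of q x] by simp

lemma cmp_rho:
  assumes "mvars p \<subseteq> V"
  shows "cmp g (rho p) = rho (pcmp g p)"
proof -
  define q where "q = (SOME q. mvars q \<subseteq> V \<and> rho q = rho p)"
  have q: "mvars q \<subseteq> V" "rho q = rho p"
    using someI[of "\<lambda>q. mvars q \<subseteq> V \<and> rho q = rho p" p] assms unfolding q_def by auto
  have v: "mvars (q + - p) \<subseteq> V" using mvars_add[of q "- p"] q(1) assms by auto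
  have "meval (q + - p) x = 0" if "x \<in> X" for x
    using rho_eqD[OF q(2) that] by (simp only: meval_add meval_uminus right_minus)
  then have "meval (pcmp g (q + - p)) x = 0" if "x \<in> X" for x
    using pcmp_vanishes[OF v] that by blast
  then have "meval (pcmp g q) x = meval (pcmp g p) x" if "x \<in> X" for x
    by (simp only: pcmp_add pcmp_uminus meval_add meval_uminus that
        eq_neg_iff_add_eq_0[symmetric] minus_minus)
  then have "rho (pcmp g q) = rho (pcmp g p)"
    by (simp add: rho_def)
  then show ?thesis unfolding cmp_def q_def .
qed

lemma A_cases: "a \<in> A \<Longrightarrow> (\<And>p. mvars p \<subseteq> V \<Longrightarrow> a = rho p \<Longrightarrow> P) \<Longrightarrow> P"
  by (auto simp: A_def)

lemma rho_in: "mvars p \<subseteq> V \<Longrightarrow> rho p \<in> A"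
  by (auto simp: A_def)

lemma rho_0 [simp]: "rho 0 = 0"
  by (simp add: fun_eq_iff rho_apply)

lemma rho_sum: "rho (sum f I) = (\<Sum>i\<in>I. rho (f i))"
  by (induction I rule: infinite_finite_induct) (simp_all add: rho_add)

text \<open>Binary forms of degree \<open>N\<close> in the first two monomials of the trinomial. The third one is itself a
  linear form in these.\<close>
definition forms :: "nat \<Rightarrow> (('v \<Rightarrow> 'k) \<Rightarrow> 'k) set"
  where "forms N = {\<Sum>t\<le>N. con (c t) * (M 0 ^ t * M 1 ^ (N - t)) | c. True}"

lemma formsI: "a = (\<Sum>t\<le>N. con (c t) * (M 0 ^ t * M 1 ^ (N - t))) \<Longrightarrow> a \<in> forms N"
  unfolding forms_def by blast

lemma forms_add: "a \<in> forms N \<Longrightarrow> b \<in> forms N \<Longrightarrow> a + b \<in> forms N"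
proof -
  assume "a \<in> forms N" "b \<in> forms N"
  then obtain c d where
    "a = (\<Sum>t\<le>N. con (c t) * (M 0 ^ t * M 1 ^ (N - t)))"
    "b = (\<Sum>t\<le>N. con (d t) * (M 0 ^ t * M 1 ^ (N - t)))"
    unfolding forms_def by blast
  then have "a + b = (\<Sum>t\<le>N. con (c t + d t) * (M 0 ^ t * M 1 ^ (N - t)))"
    by (simp only: con_add distrib_right sum.distrib)
  then show ?thesis by (rule formsI)
qed

lemma forms_con: "a \<in> forms N \<Longrightarrow> con c * a \<in> forms N"
proof -
  assume "a \<in> forms N"
  then obtain d where "a = (\<Sum>t\<le>N. con (d t) * (M 0 ^ t * M 1 ^ (N - t)))"
    unfolding forms_def by blast
  then have "con c * a = (\<Sum>t\<le>N. con (c * d t) * (M 0 ^ t * M 1 ^ (N - t)))"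
    by (simp only: con_mult sum_distrib_left mult.assoc)
  then show ?thesis by (rule formsI)
qed

lemma forms_M0: "a \<in> forms N \<Longrightarrow> M 0 * a \<in> forms (Suc N)"
proof -
  assume "a \<in> forms N"
  then obtain d where d: "a = (\<Sum>t\<le>N. con (d t) * (M 0 ^ t * M 1 ^ (N - t)))"
    unfolding forms_def by blast
  define c where "c t = (case t of 0 \<Rightarrow> 0 | Suc t \<Rightarrow> d t)" for t
  have "(\<Sum>t\<le>Suc N. con (c t) * (M 0 ^ t * M 1 ^ (Suc N - t))) =
     (\<Sum>t\<le>N. con (d t) * (M 0 ^ Suc t * M 1 ^ (N - t)))"
    unfolding sum.atMost_Suc_shift by (simp only: c_def nat.case con_0 mult_zero_left add_0_left diff_Suc_Suc)
  also have "\<dots> = M 0 * a"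
    unfolding d sum_distrib_left by (rule sum.cong[OF refl]) (simp only: power_Suc ac_simps)
  finally show ?thesis by (intro formsI[where c = c]) (rule sym)
qed

lemma forms_M1: "a \<in> forms N \<Longrightarrow> M 1 * a \<in> forms (Suc N)"
proof -
  assume "a \<in> forms N"
  then obtain d where d: "a = (\<Sum>t\<le>N. con (d t) * (M 0 ^ t * M 1 ^ (N - t)))"
    unfolding forms_def by blast
  define c where "c t = (if t \<le> N then d t else 0)" for t
  have "(\<Sum>t\<le>Suc N. con (c t) * (M 0 ^ t * M 1 ^ (Suc N - t))) =
     (\<Sum>t\<le>N. con (d t) * (M 0 ^ t * M 1 ^ (Suc N - t)))"
    unfolding sum.atMost_Suc by (simp add: c_def)
  also have "\<dots> = M 1 * a"
    unfolding d sum_distrib_left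
  proof (rule sum.cong[OF refl])
    fix t assume "t \<in> {..N}"
    then have "Suc N - t = Suc (N - t)" by auto
    then show "con (d t) * (M 0 ^ t * M 1 ^ (Suc N - t)) = M 1 * (con (d t) * (M 0 ^ t * M 1 ^ (N - t)))"
      by (simp only: power_Suc ac_simps)
  qed
  finally show ?thesis by (intro formsI[where c = c]) (rule sym)
qed

lemma M2_eq: "M 2 = con (-1) * M 0 + con (-1) * M 1"
proof -
  have "M 0 + M 1 + M 2 = 0" by (rule M_sum) auto
  then have "M 2 = - M 0 - M 1" by (simp only: eq_neg_iff_add_eq_0 diff_conv_add_uminus minus_add_distrib[symmetric] ac_simps)
  then show ?thesis by (simp only: con_minus con_1 mult_minus_left mult_1_left diff_conv_add_uminus)
qed

lemma forms_M: "a \<in> forms N \<Longrightarrow> i < 3 \<Longrightarrow> M i * a \<in> forms (Suc N)"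
proof -
  assume a: "a \<in> forms N" and "i < 3"
  then consider "i = 0" | "i = 1" | "i = 2" by linarith
  then show ?thesis
  proof cases
    case 3
    have "M 2 * a = con (-1) * (M 0 * a) + con (-1) * (M 1 * a)"
      unfolding M2_eq by (simp only: distrib_right mult.assoc)
    then show ?thesis using a 3 by (simp only:) (intro forms_add forms_con forms_M0 forms_M1)
  qed (use a forms_M0 forms_M1 in auto)
qed

lemma forms_M_power: "a \<in> forms N \<Longrightarrow> i < 3 \<Longrightarrow> M i ^ k * a \<in> forms (k + N)"
proof (induction k)
  case (Suc k)
  then show ?case using forms_M[of "M i ^ k * a" "k + N" i] by (simp only: power_Suc mult.assoc add_Suc)
qed simp

lemma forms_1: "1 \<in> forms 0"
  by (rule formsI[where c = "\<lambda>_. 1"]) simp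

lemma forms_monomial: "M 0 ^ a * (M 1 ^ b * M 2 ^ c) \<in> forms (a + b + c)"
proof -
  have "M 0 ^ a * (M 1 ^ b * (M 2 ^ c * 1)) \<in> forms (a + (b + (c + 0)))"
    by (intro forms_M_power forms_1) auto
  then show ?thesis by (simp add: add.assoc)
qed

lemma forms_0: "0 \<in> forms N"
  by (rule formsI[where c = "\<lambda>_. 0"]) simp

lemma forms_sum: "(\<And>i. i \<in> I \<Longrightarrow> f i \<in> forms N) \<Longrightarrow> sum f I \<in> forms N"
  by (induction I rule: infinite_finite_induct) (auto intro: forms_0 forms_add)

lemma mon_groups:
  assumes "\<And>i v. i < 3 \<Longrightarrow> v \<in> Vs i \<Longrightarrow> e' v = e v + t i * l v"
  shows "mon e' = mon e * (M 0 ^ t 0 * (M 1 ^ t 1 * M 2 ^ t 2))"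
proof -
  have "mon e' = (\<Prod>v\<in>V. T v ^ e v * (T v ^ l v) ^ t (idx v))"
    unfolding mon_def
  proof (rule prod.cong)
    fix v assume "v \<in> V"
    then have "e' v = e v + l v * t (idx v)"
      using assms[OF idx_less[OF \<open>v \<in> V\<close>] idx_mem[OF \<open>v \<in> V\<close>]] by (simp add: mult.commute)
    then show "T v ^ e' v = T v ^ e v * (T v ^ l v) ^ t (idx v)"
      by (simp only: power_add power_mult)
  qed simp
  also have "\<dots> = mon e * (\<Prod>i<3. \<Prod>v\<in>Vs i. (T v ^ l v) ^ t (idx v))"
    unfolding prod.distrib mon_def prod_V[of "\<lambda>v. (T v ^ l v) ^ t (idx v)"] ..
  also have "(\<Prod>i<3. \<Prod>v\<in>Vs i. (T v ^ l v) ^ t (idx v)) = (\<Prod>i<3. M i ^ t i)"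
    unfolding M_def prod_power_distrib by (intro prod.cong) (auto simp: idx_eq)
  also have "\<dots> = M 0 ^ t 0 * (M 1 ^ t 1 * M 2 ^ t 2)"
    by (simp add: numeral_3_eq_3 numeral_2_eq_2 mult.assoc)
  finally show ?thesis .
qed

text \<open>Monomials of the same degree differ by integral powers of the three monomials of the trinomial;
  dividing by the smallest powers that occur leaves a form.\<close>
lemma homogeneous_form:
  assumes "mvars p \<subseteq> V" "\<And>m. m \<in> Poly_Mapping.keys p \<Longrightarrow> pdeg m = g"
  shows "\<exists>e N a. a \<in> forms N \<and> rho p = mon e * a"
proof (cases "Poly_Mapping.keys p = {}")
  case True
  then have "p = 0" by (rule keys_eq_empty[THEN iffD1])
  then show ?thesis using forms_0[of 0] by (intro exI[of _ "\<lambda>_. 0"] exI[of _ 0] exI[of _ 0]) simp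
next
  case False
  then obtain m0 where m0: "m0 \<in> Poly_Mapping.keys p" by blast
  have "\<exists>s. (\<Sum>i<3. s i) = 0 \<and> (\<forall>i<3. \<forall>v\<in>Vs i.
      int (Poly_Mapping.lookup m v) = int (Poly_Mapping.lookup m0 v) + s i * int (l v))"
    if "m \<in> Poly_Mapping.keys p" for m
    using assms(2)[OF m0] assms(2)[OF that] by (intro dge_eqD) (simp add: pdeg_def)
  then obtain s where s: "\<And>m. m \<in> Poly_Mapping.keys p \<Longrightarrow> (\<Sum>i<3. s m i) = 0"
    "\<And>m i v. m \<in> Poly_Mapping.keys p \<Longrightarrow> i < 3 \<Longrightarrow> v \<in> Vs i \<Longrightarrow>
      int (Poly_Mapping.lookup m v) = int (Poly_Mapping.lookup m0 v) + s m i * int (l v)"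
    by metis
  \<comment> \<open>The largest common factor of the monomials of the polynomial that differs from each of them by
     powers of the monomials of the trinomial.\<close>
  define mn where "mn i = Min ((\<lambda>m. s m i) ` Poly_Mapping.keys p)" for i
  have mn_le: "mn i \<le> s m i" if "m \<in> Poly_Mapping.keys p" for m i
    unfolding mn_def using that by (intro Min_le) auto
  have mn_at: "\<exists>m\<in>Poly_Mapping.keys p. mn i = s m i" for i
  proof -
    have "mn i \<in> (\<lambda>m. s m i) ` Poly_Mapping.keys p"
      unfolding mn_def using False by (intro Min_in) auto
    then show ?thesis by auto
  qed
  define e where "e v = nat (int (Poly_Mapping.lookup m0 v) + mn (idx v) * int (l v))" for v
  define t where "t m i = nat (s m i - mn i)" for m i
  have e: "int (e v) = int (Poly_Mapping.lookup m0 v) + mn i * int (l v)" if iv: "i < 3" "v \<in> Vs i" for i v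
  proof -
    obtain m where m: "m \<in> Poly_Mapping.keys p" "mn i = s m i" using mn_at by blast
    have "int (Poly_Mapping.lookup m v) = int (Poly_Mapping.lookup m0 v) + mn i * int (l v)"
      using s(2)[OF m(1) iv] m(2) by simp
    then have "int (Poly_Mapping.lookup m0 v) + mn i * int (l v) \<ge> 0"
      by (metis of_nat_0_le_iff)
    then show ?thesis unfolding e_def idx_eq[OF iv] by simp
  qed
  have t: "int (t m i) = s m i - mn i" if "m \<in> Poly_Mapping.keys p" for m i
    using mn_le[OF that] by (simp add: t_def)
  have lk: "Poly_Mapping.lookup m v = e v + t m i * l v"
    if "m \<in> Poly_Mapping.keys p" "i < 3" "v \<in> Vs i" for m i v
  proof -
    have si: "s m i = mn i + int (t m i)" using t[OF that(1), of i] by simp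
    have "int (Poly_Mapping.lookup m v) = int (e v + t m i * l v)"
      using s(2)[OF that] e[OF that(2,3)] unfolding si by (simp add: algebra_simps)
    then show ?thesis by (simp only: of_nat_eq_iff)
  qed
  define N where "N = nat (- (mn 0 + mn 1 + mn 2))"
  have N: "t m 0 + t m 1 + t m 2 = N" if "m \<in> Poly_Mapping.keys p" for m
  proof -
    have "s m 0 + s m 1 + s m 2 = 0"
      using s(1)[OF that] by (simp add: numeral_3_eq_3 numeral_2_eq_2)
    then have "int (t m 0 + t m 1 + t m 2) = - (mn 0 + mn 1 + mn 2)"
      using t[OF that] by simp
    then show ?thesis unfolding N_def by linarith
  qed
  define a where "a = (\<Sum>m\<in>Poly_Mapping.keys p. con (Poly_Mapping.lookup p m) *
      (M 0 ^ t m 0 * (M 1 ^ t m 1 * M 2 ^ t m 2)))"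
  have "a \<in> forms N"
    unfolding a_def
  proof (intro forms_sum forms_con)
    fix m assume "m \<in> Poly_Mapping.keys p"
    then show "M 0 ^ t m 0 * (M 1 ^ t m 1 * M 2 ^ t m 2) \<in> forms N"
      using forms_monomial[of "t m 0" "t m 1" "t m 2"] N by simp
  qed
  moreover have "rho p = mon e * a"
    unfolding rho_eq_sum[OF assms(1)] a_def sum_distrib_left
  proof (rule sum.cong[OF refl])
    fix m assume "m \<in> Poly_Mapping.keys p"
    then have "mon (Poly_Mapping.lookup m) = mon e * (M 0 ^ t m 0 * (M 1 ^ t m 1 * M 2 ^ t m 2))"
      by (intro mon_groups lk)
    then show "con (Poly_Mapping.lookup p m) * mon (Poly_Mapping.lookup m) =
        mon e * (con (Poly_Mapping.lookup p m) * (M 0 ^ t m 0 * (M 1 ^ t m 1 * M 2 ^ t m 2)))"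
      by (simp only: ac_simps)
  qed
  ultimately show ?thesis by blast
qed

text \<open>On points without vanishing coordinates and with second monomial equal to \<open>1\<close>, the form is a
  nonzero polynomial in the first monomial.\<close>
lemma form_generic:
  assumes "b \<in> forms N" "mon e * b \<noteq> 0"
  shows "\<exists>B. finite B \<and> (\<forall>x\<in>X. (\<forall>v\<in>V. x v \<noteq> 0) \<longrightarrow> Mv 1 x = 1 \<longrightarrow> Mv 0 x \<notin> B \<longrightarrow> (mon e * b) x \<noteq> 0)"
proof -
  obtain c where c: "b = (\<Sum>t\<le>N. con (c t) * (M 0 ^ t * M 1 ^ (N - t)))"
    using assms(1) unfolding forms_def by blast
  define q where "q = (\<Sum>t\<le>N. monom (c t) t)"
  have "q \<noteq> 0"
  proof
    assume "q = 0"
    have "c t = 0" if "t \<le> N" for t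
    proof -
      have "0 = coeff q t" using \<open>q = 0\<close> by simp
      also have "\<dots> = c t" unfolding q_def coeff_sum using that by simp
      finally show ?thesis by simp
    qed
    then have "b = 0" unfolding c by (intro sum.neutral) simp
    then show False using assms(2) by simp
  qed
  have val: "b x = poly q (Mv 0 x)" if "x \<in> X" "Mv 1 x = 1" for x
    unfolding c q_def fun_sum_apply poly_sum
    by (rule sum.cong) (simp_all add: fun_power_apply M_apply that poly_monom del: One_nat_def)
  show ?thesis
  proof (intro exI conjI ballI impI)
    show "finite {w. poly q w = 0}" using \<open>q \<noteq> 0\<close> by (rule poly_roots_finite)
    fix x assume x: "x \<in> X" "\<forall>v\<in>V. x v \<noteq> 0" "Mv 1 x = 1" "Mv 0 x \<notin> {w. poly q w = 0}"
    then show "(mon e * b) x \<noteq> 0" by (simp add: val mon_apply)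
  qed
qed

lemma infinite_avoid: "finite B \<Longrightarrow> \<exists>w::'k. w \<notin> B \<and> w \<noteq> 0 \<and> w \<noteq> -1"
proof -
  assume "finite B"
  then have "finite (insert 0 (insert (-1) B))" by simp
  then obtain w where "w \<notin> insert 0 (insert (-1) B)"
    using infinite_UNIV_char_0[where 'a='k] ex_new_if_finite by blast
  then show ?thesis by blast
qed

sublocale graded_domain A cmp
proof
  fix a b g h assume ab: "a \<in> A" "b \<in> A"
  obtain p where p: "mvars p \<subseteq> V" "a = rho p" using ab by (auto elim: A_cases)
  obtain q where q: "mvars q \<subseteq> V" "b = rho q" using ab by (auto elim: A_cases)
  have pq: "mvars (p + q) \<subseteq> V" using mvars_add[of p q] p q by auto
  show "cmp g (a + b) = cmp g a + cmp g b"
    unfolding p q rho_add[symmetric] cmp_rho[OF pq] cmp_rho[OF p(1)] cmp_rho[OF q(1)] pcmp_add ..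
  have pgqh: "mvars (pcmp g p * pcmp h q) \<subseteq> V"
    using mvars_mult[of "pcmp g p" "pcmp h q"] mvars_pcmp[OF p(1), of g] mvars_pcmp[OF q(1), of h] by auto
  have "pcmp (g + h) (pcmp g p * pcmp h q) = pcmp g p * pcmp h q"
    unfolding pcmp_def[of "g + h"]
  proof (rule filt_id)
    fix m assume "m \<in> Poly_Mapping.keys (pcmp g p * pcmp h q)"
    then obtain m1 m2 where "m = m1 + m2" "m1 \<in> Poly_Mapping.keys (pcmp g p)" "m2 \<in> Poly_Mapping.keys (pcmp h q)"
      using keys_mult by blast
    then show "pdeg m = g + h" by (simp add: pdeg_add pcmp_def keys_filt)
  qed
  then show "cmp (g + h) (cmp g a * cmp h b) = cmp g a * cmp h b"
    unfolding p q cmp_rho[OF p(1)] cmp_rho[OF q(1)] rho_mult[symmetric] cmp_rho[OF pgqh] by simp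
  show "cmp g a = 0 \<or> cmp h b = 0" if 0: "cmp g a * cmp h b = 0"
  proof (rule ccontr)
    assume nz: "\<not> (cmp g a = 0 \<or> cmp h b = 0)"
    have "\<exists>e N f. f \<in> forms N \<and> rho (pcmp g p) = mon e * f"
      by (rule homogeneous_form[OF mvars_pcmp[OF p(1)], of g g]) (simp add: pcmp_def keys_filt)
    then obtain e N f where f: "f \<in> forms N" "cmp g a = mon e * f" using p cmp_rho by metis
    have "\<exists>e N f. f \<in> forms N \<and> rho (pcmp h q) = mon e * f"
      by (rule homogeneous_form[OF mvars_pcmp[OF q(1)], of h h]) (simp add: pcmp_def keys_filt)
    then obtain e' N' f' where f': "f' \<in> forms N'" "cmp h b = mon e' * f'" using q cmp_rho by metis
    obtain B where B: "finite B"
      "\<And>x. x \<in> X \<Longrightarrow> \<forall>v\<in>V. x v \<noteq> 0 \<Longrightarrow> Mv 1 x = 1 \<Longrightarrow> Mv 0 x \<notin> B \<Longrightarrow> cmp g a x \<noteq> 0"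
      using form_generic[OF f(1), of e] nz f(2) by metis
    obtain B' where B': "finite B'"
      "\<And>x. x \<in> X \<Longrightarrow> \<forall>v\<in>V. x v \<noteq> 0 \<Longrightarrow> Mv 1 x = 1 \<Longrightarrow> Mv 0 x \<notin> B' \<Longrightarrow> cmp h b x \<noteq> 0"
      using form_generic[OF f'(1), of e'] nz f'(2) by metis
    obtain w where w: "w \<notin> B \<union> B'" "w \<noteq> 0" "w \<noteq> -1"
      using infinite_avoid[of "B \<union> B'"] B(1) B'(1) by blast
    obtain x where x: "x \<in> X" "\<forall>v\<in>V. x v \<noteq> 0" "Mv 0 x = w" "Mv 1 x = 1"
      using generic_point[of 0 1 w] w by auto
    have "(cmp g a * cmp h b) x \<noteq> 0"
      using B(2)[OF x(1,2,4)] B'(2)[OF x(1,2,4)] x(3) w(1) by simp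
    then show False unfolding 0 by simp
  qed
next
  fix a g h assume a: "a \<in> A"
  obtain p where p: "mvars p \<subseteq> V" "a = rho p" using a by (auto elim: A_cases)
  show "cmp g a \<in> A" unfolding p cmp_rho[OF p(1)] by (intro rho_in mvars_pcmp p)
  have "pcmp g (pcmp h p) = (if g = h then pcmp g p else 0)"
    by (rule poly_mapping_eqI) (auto simp: pcmp_def lookup_filt when_def)
  then show "cmp g (cmp h a) = (if g = h then cmp g a else 0)"
    unfolding p cmp_rho[OF p(1)] cmp_rho[OF mvars_pcmp[OF p(1)]] by simp
  have sub: "{g. cmp g a \<noteq> 0} \<subseteq> pdeg ` Poly_Mapping.keys p"
  proof
    fix g assume "g \<in> {g. cmp g a \<noteq> 0}"
    then have "rho (pcmp g p) \<noteq> 0" using p cmp_rho by auto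
    then have "pcmp g p \<noteq> 0" by auto
    then show "g \<in> pdeg ` Poly_Mapping.keys p"
      unfolding pcmp_def using filt_zero[of p "\<lambda>m. pdeg m = g"] by blast
  qed
  then show "finite {g. cmp g a \<noteq> 0}" by (rule finite_subset) simp
  have "(\<Sum>g | cmp g a \<noteq> 0. cmp g a) = (\<Sum>g\<in>pdeg ` Poly_Mapping.keys p. cmp g a)"
    using sub by (intro sum.mono_neutral_left) auto
  also have "\<dots> = rho (\<Sum>g\<in>pdeg ` Poly_Mapping.keys p. pcmp g p)"
    unfolding rho_sum p(2) by (simp only: cmp_rho[OF p(1)])
  also have "\<dots> = a" using sum_pcmp[of "pdeg ` Poly_Mapping.keys p" p] p(2) by simp
  finally show "(\<Sum>g | cmp g a \<noteq> 0. cmp g a) = a" .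
qed

end

section \<open>Homogeneous functions and normal forms\<close>

lemma lookup_single_mult:
  fixes p :: "('m::cancel_comm_monoid_add) \<Rightarrow>\<^sub>0 'k::comm_ring_1"
  shows "Poly_Mapping.lookup (Poly_Mapping.single n c * p) (n + m) = c * Poly_Mapping.lookup p m"
proof -
  let ?K = "Poly_Mapping.keys p"
  have "Poly_Mapping.single n c * p =
      Poly_Mapping.single n c * (\<Sum>m\<in>?K. Poly_Mapping.single m (Poly_Mapping.lookup p m))"
    by (rule arg_cong[where f = "(*) _"], rule poly_mapping_eqI)
       (simp add: lookup_sum lookup_single when_def keys.rep_eq)
  then have "Poly_Mapping.lookup (Poly_Mapping.single n c * p) (n + m) =
      (\<Sum>m'\<in>?K. if m' = m then c * Poly_Mapping.lookup p m else 0)"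
    by (auto simp: sum_distrib_left mult_single lookup_sum lookup_single when_def intro!: sum.cong)
  then show ?thesis by (simp add: keys.rep_eq)
qed

context trinomial_hypersurface
begin

text \<open>The exponent vector \<open>e\<close>, cut off outside the variables.\<close>
definition pm :: "('v \<Rightarrow> nat) \<Rightarrow> ('v \<Rightarrow>\<^sub>0 nat)"
  where "pm e = Abs_poly_mapping (\<lambda>v. if v \<in> V then e v else 0)"

lemma lookup_pm: "Poly_Mapping.lookup (pm e) v = (if v \<in> V then e v else 0)"
proof -
  have "finite {v. (if v \<in> V then e v else 0) \<noteq> 0}"
    by (rule finite_subset[OF _ finite_V]) auto
  then show ?thesis unfolding pm_def by simp
qed

lemma keys_pm: "Poly_Mapping.keys (pm e) \<subseteq> V"
  by (auto simp: keys.rep_eq lookup_pm)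

lemma mvars_single_pm: "mvars (Poly_Mapping.single (pm e) c) \<subseteq> V"
  using mvars_single[of "pm e" c] keys_pm[of e] by (rule subset_trans)

lemma rho_single:
  assumes "Poly_Mapping.keys m \<subseteq> V"
  shows "rho (Poly_Mapping.single m c) = con c * mon (Poly_Mapping.lookup m)"
  by (rule ext) (simp only: rho_apply meval_single mmono_V[OF assms] times_fun_apply con_apply mon_apply)

lemma mon_pm: "mon (Poly_Mapping.lookup (pm e)) = mon e"
  by (rule mon_cong) (simp add: lookup_pm)

lemma rho_single_pm: "rho (Poly_Mapping.single (pm e) c) = con c * mon e"
  using rho_single[OF keys_pm[of e], of c] unfolding mon_pm .

lemma pdeg_pm: "pdeg (pm e) = dge e"
  unfolding pdeg_def dge_def by (simp add: lookup_pm)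

lemma con_mon_H: "con c * mon e \<in> H (dge e)"
proof -
  have "pcmp (dge e) (Poly_Mapping.single (pm e) c) = Poly_Mapping.single (pm e) c"
    unfolding pcmp_def by (rule filt_id) (auto simp: pdeg_pm split: if_splits)
  then have "cmp (dge e) (con c * mon e) = con c * mon e"
    using cmp_rho[OF mvars_single_pm[of e c], of "dge e"] by (simp only: rho_single_pm)
  then show ?thesis unfolding H_def by auto
qed

lemma mon_H: "mon e \<in> H (dge e)"
  using con_mon_H[of 1 e] by simp

lemma con_H: "con c \<in> H 0"
  using con_mon_H[of c "\<lambda>_. 0"] by (simp add: mon_zero dge_def)

lemma dge_indicator: "v \<in> V \<Longrightarrow> dge (\<lambda>u. if u = v then 1 else 0) = dg v"
proof -
  assume v: "v \<in> V"
  have "dge (\<lambda>u. if u = v then 1 else 0) = (\<Sum>u\<in>V. if u = v then dg u else 0)"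
    unfolding dge_def by (rule sum.cong) auto
  then show ?thesis using v by simp
qed

lemma T_H: "v \<in> V \<Longrightarrow> T v \<in> H (dg v)"
  using mon_H[of "\<lambda>u. if u = v then 1 else 0"] mon_T[of v] dge_indicator[of v] by simp

lemma H_poly:
  assumes "a \<in> H g"
  shows "\<exists>p. mvars p \<subseteq> V \<and> (\<forall>m\<in>Poly_Mapping.keys p. pdeg m = g) \<and> a = rho p"
proof -
  obtain p where p: "mvars p \<subseteq> V" "a = rho p" using H_subset[OF assms] by (auto elim: A_cases)
  have "a = rho (pcmp g p)"
    using assms cmp_rho[OF p(1), of g] p(2) by (simp add: H_def)
  moreover have "\<forall>m\<in>Poly_Mapping.keys (pcmp g p). pdeg m = g"
    by (simp add: pcmp_def keys_filt)
  ultimately show ?thesis using mvars_pcmp[OF p(1), of g] by blast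
qed

lemma H_degree: "a \<in> H g \<Longrightarrow> a \<noteq> 0 \<Longrightarrow> \<exists>e. dge e = g"
proof -
  assume a: "a \<in> H g" "a \<noteq> 0"
  obtain p where p: "\<forall>m\<in>Poly_Mapping.keys p. pdeg m = g" "a = rho p" using H_poly[OF a(1)] by blast
  have "p \<noteq> 0" using p(2) a(2) by auto
  then obtain m where "m \<in> Poly_Mapping.keys p" using keys_eq_empty[of p] by blast
  then show ?thesis using p(1) unfolding pdeg_def by blast
qed

lemma H_form: "a \<in> H g \<Longrightarrow> \<exists>e N f. f \<in> forms N \<and> a = mon e * f"
  using H_poly[of a g] homogeneous_form[of _ g] by metis

lemma con_nonzero_mult: "a \<in> A \<Longrightarrow> a \<noteq> 0 \<Longrightarrow> c \<noteq> 0 \<Longrightarrow> con c * a \<noteq> 0"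
  using nzd[of "con c" a] by auto

lemma M_nonzero: "i < 3 \<Longrightarrow> M i \<noteq> 0"
proof
  assume i: "i < 3" "M i = 0"
  obtain j :: nat where j: "j < 3" "j \<noteq> i" by (cases "i = 0") (auto intro: that[of 1] that[of 0])
  obtain w :: 'k where "w \<noteq> 0" "w \<noteq> -1" using infinite_avoid[of "{}"] by auto
  then obtain x where "x \<in> X" "Mv i x = w" using generic_point[of i j w] i j by auto
  then have "M i x = w" by (simp add: M_apply)
  then show False using i(2) \<open>w \<noteq> 0\<close> by simp
qed

lemma mon_nonzero: "mon e \<noteq> 0"
proof
  assume "mon e = 0"
  obtain w :: 'k where "w \<noteq> 0" "w \<noteq> -1" using infinite_avoid[of "{}"] by auto
  then obtain x where "x \<in> X" "\<forall>v\<in>V. x v \<noteq> 0" using generic_point[of 0 1 w] by auto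
  then have "mon e x \<noteq> 0" by (simp add: mon_apply)
  then show False using \<open>mon e = 0\<close> by simp
qed

lemma T_nonzero: "v \<in> V \<Longrightarrow> T v \<noteq> 0"
  using mon_nonzero[of "\<lambda>u. if u = v then 1 else 0"] mon_T[of v] by simp

lemma M_independent:
  assumes "i < 3" "j < 3" "i \<noteq> j" "con \<alpha> * M i + con \<beta> * M j = 0"
  shows "\<alpha> = 0 \<and> \<beta> = 0"
proof -
  have *: "\<alpha> * w + \<beta> = 0" if w: "w \<noteq> 0" "w \<noteq> -1" for w
  proof -
    obtain x where x: "x \<in> X" "Mv i x = w" "Mv j x = 1" using generic_point[OF assms(1-3) w] by auto
    have "(con \<alpha> * M i + con \<beta> * M j) x = 0" unfolding assms(4) by simp
    then show ?thesis using x by (simp add: M_apply)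
  qed
  obtain w :: 'k where w: "w \<noteq> 0" "w \<noteq> -1" using infinite_avoid[of "{}"] by auto
  obtain w' :: 'k where w': "w' \<noteq> w" "w' \<noteq> 0" "w' \<noteq> -1" using infinite_avoid[of "{w}"] by auto
  have "\<alpha> * w + \<beta> = \<alpha> * w' + \<beta>" unfolding *[OF w] *[OF w'(2,3)] ..
  then have "\<alpha> * w = \<alpha> * w'" by simp
  then have "\<alpha> = 0" using w'(1) by simp
  then show ?thesis using *[OF w] by simp
qed

subsection \<open>Linear factors of homogeneous functions\<close>

text \<open>The nonzero elements of the two-dimensional space spanned by the monomials of the trinomial.\<close>
definition pencil :: "(('v \<Rightarrow> 'k) \<Rightarrow> 'k) set"
  where "pencil = {con \<alpha> * M 0 + con \<beta> * M 1 | \<alpha> \<beta>. \<alpha> \<noteq> 0 \<or> \<beta> \<noteq> 0}"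

lemma power_diff_factor: "a \<in> A \<Longrightarrow> b \<in> A \<Longrightarrow> \<exists>g\<in>A. a ^ t - b ^ t = (a - b) * g"
proof (induction t)
  case 0
  then show ?case by (intro bexI[of _ 0]) simp_all
next
  case (Suc t)
  then obtain g where g: "g \<in> A" "a ^ t - b ^ t = (a - b) * g" by blast
  have "a ^ Suc t - b ^ Suc t = (a - b) * a ^ t + b * (a ^ t - b ^ t)" by (simp add: algebra_simps)
  also have "\<dots> = (a - b) * (a ^ t + b * g)" unfolding g(2) by (simp add: algebra_simps)
  finally have "a ^ Suc t - b ^ Suc t = (a - b) * (a ^ t + b * g)" .
  moreover have "a ^ t + b * g \<in> A" using Suc.prems g(1) by (simp only: add_in mult_in power_in)
  ultimately show ?case by blast
qed

text \<open>A binary form over an algebraically closed field has a zero on the projective line. The zero at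
  infinity is treated separately.\<close>
lemma form_linear_factor:
  assumes "f \<in> forms N" "N > 0"
  shows "\<exists>q\<in>pencil. \<exists>g\<in>A. f = q * g"
proof -
  obtain c where c: "f = (\<Sum>t\<le>N. con (c t) * (M 0 ^ t * M 1 ^ (N - t)))"
    using assms(1) unfolding forms_def by blast
  show ?thesis
  proof (cases "c N = 0")
    case True
    have "f = M 1 * (\<Sum>t<N. con (c t) * (M 0 ^ t * M 1 ^ (N - 1 - t)))"
    proof -
      have "f = (\<Sum>t<N. con (c t) * (M 0 ^ t * M 1 ^ (N - t)))"
        unfolding c lessThan_Suc_atMost[symmetric] sum.lessThan_Suc using True by simp
      also have "\<dots> = (\<Sum>t<N. M 1 * (con (c t) * (M 0 ^ t * M 1 ^ (N - 1 - t))))"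
      proof (rule sum.cong[OF refl])
        fix t assume "t \<in> {..<N}"
        then have "N - t = Suc (N - 1 - t)" by auto
        then show "con (c t) * (M 0 ^ t * M 1 ^ (N - t)) = M 1 * (con (c t) * (M 0 ^ t * M 1 ^ (N - 1 - t)))"
          by (simp only: power_Suc ac_simps)
      qed
      finally show ?thesis by (simp only: sum_distrib_left)
    qed
    moreover have "M 1 \<in> pencil"
      unfolding pencil_def by (rule CollectI, rule exI[of _ 0], rule exI[of _ 1]) simp
    moreover have "(\<Sum>t<N. con (c t) * (M 0 ^ t * M 1 ^ (N - 1 - t))) \<in> A"
      by (intro sum_in mult_in power_in con_in M_in) auto
    ultimately show ?thesis by blast
  next
    case False
    then obtain r where r: "(\<Sum>t\<le>N. c t * r ^ t) = 0" using alg_closed[OF assms(2)] by blast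
    let ?b = "con r * M 1"
    have "\<exists>g\<in>A. M 0 ^ t - ?b ^ t = (M 0 - ?b) * g" for t
      by (rule power_diff_factor) auto
    then obtain g where g: "\<And>t. g t \<in> A" "\<And>t. M 0 ^ t - ?b ^ t = (M 0 - ?b) * g t" by metis
    have con_pow: "con (r ^ t) = con r ^ t" for t
      by (induction t) (simp_all only: power_0 con_1 power_Suc con_mult)
    have "(\<Sum>t\<le>N. con (c t) * (?b ^ t * M 1 ^ (N - t))) = (\<Sum>t\<le>N. con (c t * r ^ t) * M 1 ^ N)"
    proof (rule sum.cong[OF refl])
      fix t assume "t \<in> {..N}"
      then have "M 1 ^ N = M 1 ^ t * M 1 ^ (N - t)" by (simp flip: power_add)
      then show "con (c t) * (?b ^ t * M 1 ^ (N - t)) = con (c t * r ^ t) * M 1 ^ N"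
        by (simp only: con_mult con_pow power_mult_distrib ac_simps)
    qed
    also have "\<dots> = con (\<Sum>t\<le>N. c t * r ^ t) * M 1 ^ N"
      unfolding sum_distrib_right[symmetric] by (rule arg_cong[where f = "\<lambda>a. a * _"])
        (rule ext, simp only: fun_sum_apply con_apply)
    finally have z: "(\<Sum>t\<le>N. con (c t) * (?b ^ t * M 1 ^ (N - t))) = 0" using r by simp
    have "f = (\<Sum>t\<le>N. con (c t) * (M 0 ^ t * M 1 ^ (N - t))) - (\<Sum>t\<le>N. con (c t) * (?b ^ t * M 1 ^ (N - t)))"
      unfolding z c by simp
    also have "\<dots> = (\<Sum>t\<le>N. con (c t) * ((M 0 ^ t - ?b ^ t) * M 1 ^ (N - t)))"
      unfolding sum_subtractf[symmetric] by (simp only: left_diff_distrib right_diff_distrib)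
    also have "\<dots> = (M 0 - ?b) * (\<Sum>t\<le>N. con (c t) * (g t * M 1 ^ (N - t)))"
      unfolding g(2) sum_distrib_left by (rule sum.cong[OF refl]) (simp only: ac_simps)
    finally have "f = (M 0 - ?b) * (\<Sum>t\<le>N. con (c t) * (g t * M 1 ^ (N - t)))" .
    moreover have "M 0 - ?b \<in> pencil"
      unfolding pencil_def by (rule CollectI, rule exI[of _ 1], rule exI[of _ "- r"])
        (simp add: con_minus)
    moreover have "(\<Sum>t\<le>N. con (c t) * (g t * M 1 ^ (N - t))) \<in> A"
      by (intro sum_in mult_in power_in con_in M_in g) auto
    ultimately show ?thesis by blast
  qed
qed

text \<open>Being a monomial times a form, a homogeneous function is either a multiple of a monomial or
  divisible by a linear form.\<close>
lemma homogeneous_cases: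
  assumes "a \<in> H g"
  shows "(\<exists>c e. a = con c * mon e) \<or> (\<exists>q\<in>pencil. \<exists>b\<in>A. a = q * b)"
proof -
  obtain e N f where f: "f \<in> forms N" "a = mon e * f" using H_form[OF assms] by blast
  show ?thesis
  proof (cases "N = 0")
    case True
    then obtain c where "f = con (c 0)" using f(1) unfolding forms_def by auto
    then show ?thesis using f(2) by (auto simp only: mult.commute)
  next
    case False
    then obtain q b where "q \<in> pencil" "b \<in> A" "f = q * b" using form_linear_factor[OF f(1)] by auto
    then have "a = q * (mon e * b)" "mon e * b \<in> A" using f(2) by (simp_all only: ac_simps mult_in mon_in)
    then show ?thesis using \<open>q \<in> pencil\<close> by blast
  qed
qed

lemma pencil_in: "q \<in> pencil \<Longrightarrow> q \<in> A"
  unfolding pencil_def by auto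

lemma pencil_nonzero: "q \<in> pencil \<Longrightarrow> q \<noteq> 0"
  unfolding pencil_def using M_independent[of 0 1] by auto

text \<open>If one coefficient is zero, the other monomial is replaced by means of the equation.\<close>
lemma pencil_cases:
  assumes "q \<in> pencil"
  shows "\<exists>i j \<alpha> \<beta>. i < 3 \<and> j < 3 \<and> i \<noteq> j \<and> \<alpha> \<noteq> 0 \<and> \<beta> \<noteq> 0 \<and> q = con \<alpha> * M i + con \<beta> * M j"
proof -
  obtain \<alpha> \<beta> where q: "q = con \<alpha> * M 0 + con \<beta> * M 1" "\<alpha> \<noteq> 0 \<or> \<beta> \<noteq> 0"
    using assms unfolding pencil_def by blast
  have s: "M 0 + M 1 + M 2 = 0" by (rule M_sum) auto
  consider "\<alpha> \<noteq> 0" "\<beta> \<noteq> 0" | "\<alpha> = 0" "\<beta> \<noteq> 0" | "\<alpha> \<noteq> 0" "\<beta> = 0" using q(2) by blast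
  then show ?thesis
  proof cases
    case 1
    then show ?thesis using q(1) by (intro exI[of _ 0] exI[of _ 1] exI[of _ \<alpha>] exI[of _ \<beta>]) simp
  next
    case 2
    have "M 1 = - M 0 - M 2" using s by (simp add: eq_neg_iff_add_eq_0 algebra_simps)
    then have "q = con (- \<beta>) * M 0 + con (- \<beta>) * M 2"
      using q(1) 2 by (simp only: con_0 mult_zero_left add_0_left add_0_right con_minus distrib_left
          mult_minus_right mult_minus_left diff_conv_add_uminus)
    then show ?thesis using 2
      by (intro exI[of _ 0] exI[of _ 2] exI[of _ "- \<beta>"]) simp
  next
    case 3
    have "M 0 = - M 1 - M 2" using s by (simp add: eq_neg_iff_add_eq_0 algebra_simps)
    then have "q = con (- \<alpha>) * M 1 + con (- \<alpha>) * M 2"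
      using q(1) 3 by (simp only: con_0 mult_zero_left add_0_left add_0_right con_minus distrib_left
          mult_minus_right mult_minus_left diff_conv_add_uminus)
    then show ?thesis using 3
      by (intro exI[of _ 1] exI[of _ 2] exI[of _ "- \<alpha>"]) simp
  qed
qed

text \<open>Exponents of this degree arise from those of \<open>v\<close> by adding integral multiples of the exponents of
  the three monomials. As all \<open>l v\<close> are at least two, no factor can be negative, so all are zero.\<close>
lemma dge_eq_dg:
  assumes "v \<in> V" "dge e = dg v" "u \<in> V"
  shows "e u = (if u = v then 1 else 0)"
proof -
  let ?e = "\<lambda>u. if u = v then 1 else (0::nat)"
  obtain s where s: "(\<Sum>i<3. s i) = 0"
    "\<And>i u. i < 3 \<Longrightarrow> u \<in> Vs i \<Longrightarrow> int (e u) = int (?e u) + s i * int (l u)"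
    using dge_eqD[of ?e e] dge_indicator[OF assms(1)] assms(2) by auto
  have nonneg: "s i \<ge> 0" if i: "i < 3" for i
  proof (rule ccontr)
    assume "\<not> 0 \<le> s i"
    obtain u where u: "u \<in> Vs i" using Vs_nonempty[OF i] by auto
    have "s i * int (l u) \<le> -1 * int (l u)"
      using \<open>\<not> 0 \<le> s i\<close> by (intro mult_right_mono) auto
    then have "int (e u) < 0" using s(2)[OF i u] l_ge_2[OF i u] by (auto split: if_splits)
    then show False by simp
  qed
  have "s i = 0" if i: "i < 3" for i
    using s(1) nonneg i sum_nonneg_eq_0_iff[of "{..<3}" s] by auto
  then have "int (e u) = int (?e u)"
    using s(2)[OF idx_less[OF assms(3)] idx_mem[OF assms(3)]] idx_less[OF assms(3)] by simp
  then show ?thesis by (simp only: of_nat_eq_iff)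
qed

lemma H_dg:
  assumes "v \<in> V" "a \<in> H (dg v)"
  shows "\<exists>c. a = con c * T v"
proof -
  obtain p where p: "mvars p \<subseteq> V" "\<And>m. m \<in> Poly_Mapping.keys p \<Longrightarrow> pdeg m = dg v" "a = rho p"
    using H_poly[OF assms(2)] by blast
  have "a = (\<Sum>m\<in>Poly_Mapping.keys p. con (Poly_Mapping.lookup p m) * T v)"
    unfolding p(3) rho_eq_sum[OF p(1)]
  proof (rule sum.cong[OF refl])
    fix m assume m: "m \<in> Poly_Mapping.keys p"
    have "mon (Poly_Mapping.lookup m) = mon (\<lambda>u. if u = v then 1 else 0)"
      using p(2)[OF m] dge_eq_dg[OF assms(1)] by (intro mon_cong) (simp add: pdeg_def)
    then show "con (Poly_Mapping.lookup p m) * mon (Poly_Mapping.lookup m) = con (Poly_Mapping.lookup p m) * T v"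
      using mon_T[OF assms(1)] by simp
  qed
  also have "\<dots> = con (\<Sum>m\<in>Poly_Mapping.keys p. Poly_Mapping.lookup p m) * T v"
    unfolding sum_distrib_right[symmetric]
    by (rule arg_cong[where f = "\<lambda>a. a * _"]) (rule ext, simp only: fun_sum_apply con_apply)
  finally show ?thesis by blast
qed

subsection \<open>Normal forms\<close>

text \<open>Polynomials without monomials divisible by the \<open>k\<close>-th monomial of the trinomial. They represent
  the elements of the coordinate ring uniquely, and they are stable under multiplication by the
  variables of the other two groups.\<close>
definition normal :: "nat \<Rightarrow> ('v, 'k) mpoly set"
  where "normal k = {p. mvars p \<subseteq> V \<and>
    (\<forall>m\<in>Poly_Mapping.keys p. \<exists>v\<in>Vs k. Poly_Mapping.lookup m v < l v)}"

lemma normal_add: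
  assumes "p \<in> normal k" "q \<in> normal k"
  shows "p + q \<in> normal k"
proof -
  have "mvars (p + q) \<subseteq> V" using assms mvars_add[of p q] unfolding normal_def by auto
  then show ?thesis using assms keys_add[of p q] unfolding normal_def by fastforce
qed

lemma normal_single_mult:
  assumes "p \<in> normal k" "Poly_Mapping.keys n \<subseteq> V" "\<And>v. v \<in> Vs k \<Longrightarrow> Poly_Mapping.lookup n v = 0"
  shows "Poly_Mapping.single n c * p \<in> normal k"
proof -
  have "mvars (Poly_Mapping.single n c * p) \<subseteq> V"
  proof (rule subset_trans[OF mvars_mult Un_least])
    show "mvars (Poly_Mapping.single n c) \<subseteq> V" using mvars_single assms(2) by (rule subset_trans)
    show "mvars p \<subseteq> V" using assms(1) by (simp add: normal_def)
  qed
  moreover have "\<exists>v\<in>Vs k. Poly_Mapping.lookup m v < l v"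
    if m: "m \<in> Poly_Mapping.keys (Poly_Mapping.single n c * p)" for m
  proof -
    obtain a b where ab: "m = a + b" "a \<in> Poly_Mapping.keys (Poly_Mapping.single n c)" "b \<in> Poly_Mapping.keys p"
      using m keys_mult[of "Poly_Mapping.single n c" p] by blast
    then have "a = n" by (auto split: if_splits)
    obtain v where "v \<in> Vs k" "Poly_Mapping.lookup b v < l v"
      using ab(3) assms(1) unfolding normal_def by auto
    then show ?thesis using ab(1) \<open>a = n\<close> assms(3) by (auto simp: lookup_add intro!: bexI[of _ v])
  qed
  ultimately show ?thesis unfolding normal_def by auto
qed

lemma normal_uminus: "p \<in> normal k \<Longrightarrow> - p \<in> normal k"
  unfolding normal_def by (simp add: keys.rep_eq)

text \<open>Replace the \<open>k\<close>-th monomial by the negative of the sum of the other two until this is no longer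
  possible.\<close>
lemma normal_exists_mon:
  assumes ijk: "i < 3" "j < 3" "k < 3" "distinct [i, j, k]"
  shows "\<exists>p\<in>normal k. rho p = mon e"
proof (induction "\<Sum>v\<in>Vs k. e v" arbitrary: e rule: less_induct)
  case less
  show ?case
  proof (cases "\<exists>v\<in>Vs k. e v < l v")
    case True
    then have "Poly_Mapping.single (pm e) 1 \<in> normal k"
      unfolding normal_def using mvars_single_pm ijk by (auto simp: lookup_pm Vs_V)
    then show ?thesis using rho_single_pm[of e 1] by (intro bexI) auto
  next
    case False
    define d where "d v = (if v \<in> Vs k then e v - l v else e v)" for v
    have e: "e = (\<lambda>v. d v + (if v \<in> Vs k then l v else 0))"
      using False by (auto simp: d_def fun_eq_iff not_less)
    have "(\<Sum>v\<in>Vs k. d v) < (\<Sum>v\<in>Vs k. e v)"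
      using False Vs_nonempty[OF ijk(3)] l_ge_2[OF ijk(3)] ijk
      by (intro sum_strict_mono) (force simp: d_def not_less)+
    then obtain p where p: "p \<in> normal k" "rho p = mon d" using less by blast
    let ?n = "\<lambda>i. pm (\<lambda>v. if v \<in> Vs i then l v else 0)"
    let ?q = "Poly_Mapping.single (?n i) (-1) * p + Poly_Mapping.single (?n j) (-1) * p"
    have "?q \<in> normal k"
      using ijk p(1) Vs_disjoint[of i k] Vs_disjoint[of j k] keys_pm
      by (intro normal_add normal_single_mult) (auto simp: lookup_pm)
    moreover have "rho ?q = mon e"
    proof -
      have "M k = con (-1) * M i + con (-1) * M j"
        using M_sum[OF ijk] by (simp add: con_minus eq_neg_iff_add_eq_0 algebra_simps)
      moreover have "mon e = mon d * M k"
        by (subst e) (simp only: mon_add mon_group[OF ijk(3)] M_def)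
      ultimately have "mon e = (con (-1) * M i + con (-1) * M j) * mon d" by (simp only: mult.commute)
      then show ?thesis
        unfolding rho_add rho_mult rho_single_pm p(2) mon_group[OF ijk(1)] mon_group[OF ijk(2)] M_def
        by (simp only: distrib_right)
    qed
    ultimately show ?thesis by blast
  qed
qed

lemma normal_exists:
  assumes ijk: "i < 3" "j < 3" "k < 3" "distinct [i, j, k]" and a: "a \<in> A"
  shows "\<exists>p\<in>normal k. rho p = a"
  using a
proof (induction a rule: A_induct)
  case (mon c e)
  obtain p where p: "p \<in> normal k" "rho p = mon e" using normal_exists_mon[OF ijk] by blast
  have "rho (Poly_Mapping.single 0 c * p) = con c * mon e"
    using rho_mconst[of c] unfolding rho_mult p(2) mconst_def by simp
  moreover have "Poly_Mapping.single 0 c * p \<in> normal k"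
    by (rule normal_single_mult[OF p(1)]) auto
  ultimately show ?case by blast
next
  case (add a b)
  then show ?case using normal_add rho_add by metis
qed

text \<open>Normal monomials of the same degree differ by powers of the quotient of the two other monomials
  of the trinomial. At points where one of these equals \<open>1\<close>, a homogeneous normal polynomial is a
  monomial times a Laurent polynomial in the other one, with the same coefficients.\<close>
lemma normal_unique:
  assumes ijk: "i < 3" "j < 3" "k < 3" "distinct [i, j, k]" and p: "p \<in> normal k" and z: "rho p = 0"
  shows "p = 0"
proof (rule ccontr)
  assume "p \<noteq> 0"
  then have "Poly_Mapping.keys p \<noteq> {}" using keys_eq_empty[of p] by blast
  then obtain m0 where m0: "m0 \<in> Poly_Mapping.keys p" by blast
  have pV: "mvars p \<subseteq> V" using p by (simp add: normal_def)
  define q where "q = pcmp (pdeg m0) p"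
  have qk: "Poly_Mapping.keys q = {m \<in> Poly_Mapping.keys p. pdeg m = pdeg m0}"
    by (simp add: q_def pcmp_def keys_filt)
  have qV: "mvars q \<subseteq> V" using mvars_pcmp[OF pV] q_def by simp
  have vanish: "meval q x = 0" if "x \<in> X" for x
    unfolding q_def
  proof (rule pcmp_vanishes[OF pV _ that])
    fix y assume "y \<in> X"
    then show "meval p y = 0" using rho_apply[of p y] z by simp
  qed
  have "\<exists>s. \<forall>v\<in>V. int (Poly_Mapping.lookup m v) = int (Poly_Mapping.lookup m0 v) +
      (if v \<in> Vs i then s else if v \<in> Vs j then - s else 0) * int (l v)"
    if m: "m \<in> Poly_Mapping.keys q" for m
  proof -
    have "dge (Poly_Mapping.lookup m0) = dge (Poly_Mapping.lookup m)"
      using m unfolding qk pdeg_def by simp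
    from dge_eqD[OF this] obtain s where s: "(\<Sum>i<3. s i) = 0"
      "\<And>i v. i < 3 \<Longrightarrow> v \<in> Vs i \<Longrightarrow>
        int (Poly_Mapping.lookup m v) = int (Poly_Mapping.lookup m0 v) + s i * int (l v)" by blast
    obtain u where u: "u \<in> Vs k" "Poly_Mapping.lookup m u < l u" using p m unfolding normal_def qk by blast
    obtain u' where u': "u' \<in> Vs k" "Poly_Mapping.lookup m0 u' < l u'" using p m0 unfolding normal_def by blast
    have "s k * int (l u) < 1 * int (l u)" using s(2)[OF ijk(3) u(1)] u(2) by linarith
    then have 1: "s k < 1" using mult_less_cancel_right_pos[of "int (l u)"] l_ge_2[OF ijk(3) u(1)] by auto
    have "(- s k) * int (l u') < 1 * int (l u')" using s(2)[OF ijk(3) u'(1)] u'(2) by linarith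
    then have "- s k < 1" using mult_less_cancel_right_pos[of "int (l u')" "- s k" 1] l_ge_2[OF ijk(3) u'(1)] by force
    then have sk: "s k = 0" using 1 by simp
    have sj: "s j = - s i" using s(1) sum_3[OF ijk, of s] sk by simp
    show ?thesis
    proof (intro exI[of _ "s i"] ballI)
      fix v assume v: "v \<in> V"
      have "idx v = i \<or> idx v = j \<or> idx v = k" using idx_less[OF v] ijk by auto
      moreover have "v \<notin> Vs i" if "v \<in> Vs j" using that Vs_disjoint[of i j] ijk by auto
      moreover have "v \<notin> Vs i \<and> v \<notin> Vs j" if "v \<in> Vs k" using that Vs_disjoint[of i k] Vs_disjoint[of j k] ijk by auto
      ultimately show "int (Poly_Mapping.lookup m v) = int (Poly_Mapping.lookup m0 v) +
        (if v \<in> Vs i then s i else if v \<in> Vs j then - s i else 0) * int (l v)"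
        using s(2)[OF idx_less[OF v] idx_mem[OF v]] idx_mem[OF v] sk sj by auto
    qed
  qed
  then obtain s where s: "\<And>m v. m \<in> Poly_Mapping.keys q \<Longrightarrow> v \<in> V \<Longrightarrow>
      int (Poly_Mapping.lookup m v) = int (Poly_Mapping.lookup m0 v) +
      (if v \<in> Vs i then s m else if v \<in> Vs j then - s m else 0) * int (l v)"
    by metis
  have inj: "inj_on s (Poly_Mapping.keys q)"
  proof (rule inj_onI)
    fix m m' assume m: "m \<in> Poly_Mapping.keys q" "m' \<in> Poly_Mapping.keys q" "s m = s m'"
    show "m = m'"
    proof (rule poly_mapping_eqI)
      fix v
      show "Poly_Mapping.lookup m v = Poly_Mapping.lookup m' v"
      proof (cases "v \<in> V")
        case True
        have "int (Poly_Mapping.lookup m v) = int (Poly_Mapping.lookup m' v)"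
          using s[OF m(1) True] s[OF m(2) True] m(3) by simp
        then show ?thesis by simp
      next
        case False
        have "Poly_Mapping.keys m \<subseteq> V" "Poly_Mapping.keys m' \<subseteq> V" using keys_V[OF qV] m by auto
        then have "v \<notin> Poly_Mapping.keys m" "v \<notin> Poly_Mapping.keys m'" using False by auto
        then show ?thesis by (simp add: keys.rep_eq)
      qed
    qed
  qed
  have val: "mmono m x = mmono m0 x * w powi (s m)"
    if m: "m \<in> Poly_Mapping.keys q" and x: "\<forall>v\<in>V. x v \<noteq> 0" "Mv i x = w" "Mv j x = 1" for m x w
  proof -
    let ?f = "\<lambda>v. (x v ^ l v) powi (if v \<in> Vs i then s m else if v \<in> Vs j then - s m else 0)"
    have mV: "Poly_Mapping.keys m \<subseteq> V" "Poly_Mapping.keys m0 \<subseteq> V"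
      using keys_V[OF qV m] keys_V[OF pV m0] by auto
    have "mmono m x = (\<Prod>v\<in>V. x v ^ Poly_Mapping.lookup m0 v * ?f v)"
      unfolding mmono_V[OF mV(1)]
    proof (rule prod.cong[OF refl])
      fix v assume v: "v \<in> V"
      let ?s = "if v \<in> Vs i then s m else if v \<in> Vs j then - s m else 0"
      have "x v ^ Poly_Mapping.lookup m v = x v powi (int (Poly_Mapping.lookup m0 v) + int (l v) * ?s)"
        using s[OF m v] by (metis mult.commute power_int_of_nat)
      also have "\<dots> = x v powi int (Poly_Mapping.lookup m0 v) * x v powi (int (l v) * ?s)"
        using x(1) v by (intro power_int_add) auto
      also have "\<dots> = x v ^ Poly_Mapping.lookup m0 v * ?f v"
        unfolding power_int_mult by (simp only: power_int_of_nat)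
      finally show "x v ^ Poly_Mapping.lookup m v = x v ^ Poly_Mapping.lookup m0 v * ?f v" .
    qed
    also have "\<dots> = mmono m0 x * (\<Prod>v\<in>V. ?f v)"
      unfolding prod.distrib mmono_V[OF mV(2)] ..
    also have "(\<Prod>v\<in>V. ?f v) = (\<Prod>n<3. if n = i then w powi (s m) else 1)"
      unfolding prod_V
    proof (rule prod.cong[OF refl])
      fix n :: nat assume n: "n \<in> {..<3}"
      have pw: "(\<Prod>v\<in>S. y v powi t) = (\<Prod>v\<in>S. y v) powi t" for y :: "'v \<Rightarrow> 'k" and S t
        by (induction S rule: infinite_finite_induct) (auto simp: power_int_mult_distrib)
      have fi: "(\<Prod>v\<in>Vs i. ?f v) = w powi (s m)"
      proof -
        have "(\<Prod>v\<in>Vs i. ?f v) = (\<Prod>v\<in>Vs i. (x v ^ l v) powi s m)" by (rule prod.cong) auto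
        then show ?thesis unfolding pw using x(2) by (simp add: Mv_def)
      qed
      have fj: "(\<Prod>v\<in>Vs j. ?f v) = 1"
      proof -
        have "(\<Prod>v\<in>Vs j. ?f v) = (\<Prod>v\<in>Vs j. (x v ^ l v) powi (- s m))"
          using Vs_disjoint[of i j] ijk by (intro prod.cong) auto
        then show ?thesis unfolding pw using x(3) by (simp add: Mv_def)
      qed
      have fk: "(\<Prod>v\<in>Vs k. ?f v) = 1"
        using Vs_disjoint[of i k] Vs_disjoint[of j k] ijk by (intro prod.neutral) auto
      have "n = i \<or> n = j \<or> n = k" using n ijk by auto
      then show "(\<Prod>v\<in>Vs n. ?f v) = (if n = i then w powi s m else 1)"
        using fi fj fk ijk by auto
    qed
    also have "\<dots> = w powi (s m)" using ijk by simp
    finally show ?thesis .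
  qed
  define y where "y t = Poly_Mapping.lookup q (the_inv_into (Poly_Mapping.keys q) s t)" for t
  have y: "y (s m) = Poly_Mapping.lookup q m" if "m \<in> Poly_Mapping.keys q" for m
    using the_inv_into_f_f[OF inj that] by (simp add: y_def)
  have sum0: "(\<Sum>t\<in>s ` Poly_Mapping.keys q. y t * w powi t) = 0" if w: "w \<notin> {-1}" "w \<noteq> 0" for w
  proof -
    obtain x where x: "x \<in> X" "\<forall>v\<in>V. x v \<noteq> 0" "Mv i x = w" "Mv j x = 1"
      using generic_point[of i j w] ijk w by auto
    have m0V: "Poly_Mapping.keys m0 \<subseteq> V" using keys_V[OF pV m0] .
    have "mmono m0 x \<noteq> 0" unfolding mmono_V[OF m0V] using x(2) by simp
    have "(\<Sum>t\<in>s ` Poly_Mapping.keys q. y t * w powi t) * mmono m0 x =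
        (\<Sum>m\<in>Poly_Mapping.keys q. Poly_Mapping.lookup q m * mmono m x)"
      unfolding sum.reindex[OF inj] sum_distrib_right o_def
      by (rule sum.cong[OF refl]) (simp only: y val[OF _ x(2-4)] ac_simps)
    also have "\<dots> = 0" using vanish[OF x(1)] unfolding meval_def .
    finally show ?thesis using \<open>mmono m0 x \<noteq> 0\<close> by simp
  qed
  have m0q: "m0 \<in> Poly_Mapping.keys q" using m0 qk by simp
  have "y (s m0) = 0"
    by (rule laurent_sum_zero[of "s ` Poly_Mapping.keys q" "{-1}" y]) (use sum0 m0q in auto)
  then have "Poly_Mapping.lookup q m0 = 0" using y[OF m0q] by simp
  then show False using m0q by (simp add: keys.rep_eq)
qed

text \<open>Multiplication by variables of the groups \<open>i\<close> and \<open>j\<close> maps normal forms with respect to the third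
  group to normal forms, so divisibility can be read off from the exponents.\<close>
lemma coprime_groups:
  assumes ij: "i < 3" "j < 3" "i \<noteq> j" and ab: "a \<in> A" "b \<in> A"
    and eq: "(\<Prod>v\<in>Vs i. T v ^ e v) * a = (\<Prod>v\<in>Vs j. T v ^ e v) * b"
  shows "\<exists>c\<in>A. a = (\<Prod>v\<in>Vs j. T v ^ e v) * c"
proof -
  obtain k where k: "k < 3" "distinct [i, j, k]" using third_index[OF ij] by blast
  obtain p where p: "p \<in> normal k" "rho p = a" using normal_exists[OF ij(1,2) k ab(1)] by blast
  obtain q where q: "q \<in> normal k" "rho q = b" using normal_exists[OF ij(1,2) k ab(2)] by blast
  let ?n = "\<lambda>i. pm (\<lambda>v. if v \<in> Vs i then e v else 0)"
  have n0: "Poly_Mapping.lookup (?n i) v = 0" "Poly_Mapping.lookup (?n j) v = 0" if "v \<in> Vs k" for v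
    using that ij k Vs_disjoint[of i k] Vs_disjoint[of j k] by (auto simp: lookup_pm)
  let ?P = "Poly_Mapping.single (?n i) 1 * p" and ?Q = "Poly_Mapping.single (?n j) 1 * q"
  have "?P + - ?Q \<in> normal k"
    by (intro normal_add normal_uminus normal_single_mult p q keys_pm n0)
  moreover have "rho (?P + - ?Q) = 0"
    unfolding rho_add rho_uminus rho_mult rho_single_pm mon_group[OF ij(1)] mon_group[OF ij(2)] p(2) q(2)
    using eq by simp
  ultimately have "?P + - ?Q = 0" using normal_unique[OF ij(1,2) k] by blast
  then have PQ: "?P = ?Q" by simp
  have pV: "mvars p \<subseteq> V" using p(1) by (simp add: normal_def)
  have ge: "e v \<le> Poly_Mapping.lookup m v" if m: "m \<in> Poly_Mapping.keys p" and v: "v \<in> Vs j" for m v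
  proof -
    have "Poly_Mapping.lookup ?P (?n i + m) \<noteq> 0"
      using m unfolding lookup_single_mult by (simp add: keys.rep_eq)
    then have "?n i + m \<in> Poly_Mapping.keys ?Q" unfolding PQ keys.rep_eq by simp
    then obtain c d where cd: "?n i + m = c + d" "c \<in> Poly_Mapping.keys (Poly_Mapping.single (?n j) (1::'k))"
      using keys_mult[of "Poly_Mapping.single (?n j) 1" q] by blast
    then have "c = ?n j" by (auto split: if_splits)
    then have "Poly_Mapping.lookup (?n i + m) v = Poly_Mapping.lookup (?n j + d) v" using cd(1) by simp
    moreover have "v \<in> V" "v \<notin> Vs i" using v ij Vs_V Vs_disjoint[OF ij] by auto
    ultimately show ?thesis using v by (simp add: lookup_add lookup_pm)
  qed
  define c where "c = (\<Sum>m\<in>Poly_Mapping.keys p. con (Poly_Mapping.lookup p m) *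
    mon (\<lambda>v. Poly_Mapping.lookup m v - (if v \<in> Vs j then e v else 0)))"
  have "a = (\<Prod>v\<in>Vs j. T v ^ e v) * c"
    unfolding p(2)[symmetric] rho_eq_sum[OF pV] c_def sum_distrib_left
  proof (rule sum.cong[OF refl])
    fix m assume m: "m \<in> Poly_Mapping.keys p"
    let ?r = "\<lambda>v. Poly_Mapping.lookup m v - (if v \<in> Vs j then e v else 0)"
    have "mon (Poly_Mapping.lookup m) = mon (\<lambda>v. (if v \<in> Vs j then e v else 0) + ?r v)"
      using ge[OF m] by (intro mon_cong) auto
    also have "\<dots> = (\<Prod>v\<in>Vs j. T v ^ e v) * mon ?r"
      unfolding mon_add mon_group[OF ij(2)] ..
    finally show "con (Poly_Mapping.lookup p m) * mon (Poly_Mapping.lookup m) =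
      (\<Prod>v\<in>Vs j. T v ^ e v) * (con (Poly_Mapping.lookup p m) * mon ?r)"
      by (simp only: ac_simps)
  qed
  moreover have "c \<in> A" unfolding c_def by (intro sum_in mult_in con_in mon_in)
  ultimately show ?thesis by blast
qed

end

section \<open>Rigidity\<close>

context graded_domain
begin

lemma H_power: "1 \<in> H 0 \<Longrightarrow> a \<in> H g \<Longrightarrow> a ^ n \<in> H (of_nat n * g)"
proof (induction n)
  case (Suc n)
  have "a * a ^ n \<in> H (g + of_nat n * g)" using Suc by (intro H_mult) auto
  then show ?case by (simp add: distrib_right)
qed simp

end

context trinomial_hypersurface
begin

lemma one_H: "1 \<in> H 0"
  using con_H[of 1] by simp

lemma of_nat_con: "of_nat n = con (of_nat n)"
  by (rule ext) simp

lemma M_pencil: "i < 3 \<Longrightarrow> M i \<in> pencil"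
proof -
  assume "i < 3"
  then consider "i = 0" | "i = 1" | "i = 2" by linarith
  then show ?thesis
  proof cases
    case 1
    then show ?thesis unfolding pencil_def by (intro CollectI exI[of _ 1] exI[of _ 0]) simp
  next
    case 2
    then show ?thesis unfolding pencil_def by (intro CollectI exI[of _ 0] exI[of _ 1]) simp
  next
    case 3
    then show ?thesis
      unfolding pencil_def by (intro CollectI exI[of _ "-1"]) (use M2_eq in simp)
  qed
qed

text \<open>The coordinate functions generate the ring.\<close>
lemma derivation_zeroI:
  assumes "derivation_on A D" "\<And>c. D (con c) = 0" "\<And>v. v \<in> V \<Longrightarrow> D (T v) = 0" "a \<in> A"
  shows "D a = 0"
proof -
  interpret derivation_on A D by (rule assms(1))
  show ?thesis
    using assms(4)
  proof (induction a rule: A_induct)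
    case (mon c e)
    have "D (mon e) = 0" unfolding mon_def
      by (intro D_prod_zero D_power_zero power_in T_in assms(3))
    then show "D (con c * mon e) = 0" using D_mult[of "con c" "mon e"] assms(2)[of c] by simp
  next
    case (add a b)
    have "D a = 0" "D b = 0" by (rule add(3), rule add(4))
    then show "D (a + b) = 0" using D_add[OF add(1,2)] by simp
  qed
qed

end

text \<open>A locally nilpotent derivation of the coordinate ring, linear over the ground field.\<close>
locale trinomial_lnd = trinomial_hypersurface Vs l X + lnd A D
  for Vs :: "nat \<Rightarrow> 'v::countable set" and l and X :: "('v \<Rightarrow> 'k::{alg_closed_field, field_char_0}) set"
    and D :: "(('v \<Rightarrow> 'k) \<Rightarrow> 'k) \<Rightarrow> (('v \<Rightarrow> 'k) \<Rightarrow> 'k)" +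
  assumes D_con: "D (con c) = 0"
begin

lemma ldeg_con_mult: "c \<noteq> 0 \<Longrightarrow> a \<in> A \<Longrightarrow> a \<noteq> 0 \<Longrightarrow> ldeg (con c * a) = ldeg a"
  using ldeg_ltop_mult(1)[of "con c" a] ldeg_0_iff[of "con c"] D_con by simp

lemma D_con_mult: "a \<in> A \<Longrightarrow> D (con c * a) = con c * D a"
  using D_mult[of "con c" a] D_con by simp

lemma ldeg_T_prod:
  assumes "i < 3"
  shows "(\<Prod>v\<in>Vs i. T v ^ e v) \<noteq> 0" "ldeg (\<Prod>v\<in>Vs i. T v ^ e v) = (\<Sum>v\<in>Vs i. e v * ldeg (T v))"
proof -
  have "(\<Prod>v\<in>Vs i. T v ^ e v) \<noteq> 0 \<and>
      ldeg (\<Prod>v\<in>Vs i. T v ^ e v) = (\<Sum>v\<in>Vs i. ldeg (T v ^ e v))"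
    using assms by (intro ldeg_prod power_in T_in power_nonzero T_nonzero) (auto simp: Vs_V)
  moreover have "(\<Sum>v\<in>Vs i. ldeg (T v ^ e v)) = (\<Sum>v\<in>Vs i. e v * ldeg (T v))"
    using assms by (intro sum.cong refl ldeg_ltop_power(1) T_in T_nonzero) (auto simp: Vs_V)
  ultimately show "(\<Prod>v\<in>Vs i. T v ^ e v) \<noteq> 0"
    "ldeg (\<Prod>v\<in>Vs i. T v ^ e v) = (\<Sum>v\<in>Vs i. e v * ldeg (T v))" by auto
qed

text \<open>The Mason--Stothers argument. Let the degree be that of the derivation. The derivatives of \<open>M i\<close>
  and \<open>M j\<close> are proportional, hence divisible by both \<open>M i\<close> and \<open>M j\<close> divided by their radicals. As all
  exponents are at least two, each quotient has at least half the degree of the monomial, and the two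
  monomials have the same degree. So a nonzero derivative would have at least the degree of \<open>M i\<close>,
  but a derivation lowers the degree.\<close>
lemma proportional_mod_kernel:
  assumes ij: "i < 3" "j < 3" "i \<noteq> j" and ab: "\<alpha> \<noteq> 0" "\<beta> \<noteq> 0" "D (con \<alpha> * M i + con \<beta> * M j) = 0"
  shows "D (M i) = 0"
proof (rule ccontr)
  assume nz: "D (M i) \<noteq> 0"
  let ?P = "\<lambda>i. \<Prod>v\<in>Vs i. T v ^ (l v - 1)"
  have "\<exists>g\<in>A. D (M i) = ?P i * g" if "i < 3" for i
    unfolding M_def using that
    by (intro D_prod_powers_dvd T_in) (auto simp: Vs_V dest!: l_ge_2)
  then obtain g where g: "\<And>i. i < 3 \<Longrightarrow> g i \<in> A" "\<And>i. i < 3 \<Longrightarrow> D (M i) = ?P i * g i" by metis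
  have "con \<alpha> * D (M i) + con \<beta> * D (M j) = 0"
    using ab(3) ij by (simp only: D_add mult_in con_in M_in D_con_mult)
  then have rel: "con \<alpha> * D (M i) = con (- \<beta>) * D (M j)"
    by (simp only: con_minus mult_minus_left eq_neg_iff_add_eq_0)
  then have "?P i * (con \<alpha> * g i) = ?P j * (con (- \<beta>) * g j)"
    unfolding g(2)[OF ij(1)] g(2)[OF ij(2)] by (simp only: ac_simps)
  then obtain c where c: "c \<in> A" "con \<alpha> * g i = ?P j * c"
    using coprime_groups[OF ij, of "con \<alpha> * g i" "con (- \<beta>) * g j" "\<lambda>v. l v - 1"]
      mult_in[OF con_in g(1)[OF ij(1)]] mult_in[OF con_in g(1)[OF ij(2)]] by blast
  have PA: "?P n \<in> A" if "n < 3" for n using that by (intro prod_in power_in T_in) (auto simp: Vs_V)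
  have eq: "con \<alpha> * D (M i) = ?P i * (?P j * c)"
    unfolding g(2)[OF ij(1)] c(2)[symmetric] by (simp only: ac_simps)
  have DA: "D (M i) \<in> A" "D (M j) \<in> A" using ij by auto
  have nz1: "con \<alpha> * D (M i) \<noteq> 0" using con_nonzero_mult[OF DA(1) nz ab(1)] .
  then have nzc: "?P j * c \<noteq> 0" "c \<noteq> 0" unfolding eq by auto
  have "ldeg (D (M i)) = ldeg (?P i * (?P j * c))"
    using ldeg_con_mult[OF ab(1) DA(1) nz] unfolding eq by simp
  also have "\<dots> = ldeg (?P i) + (ldeg (?P j) + ldeg c)"
    using ldeg_ltop_mult(1)[OF PA[OF ij(1)] mult_in[OF PA[OF ij(2)] c(1)] ldeg_T_prod(1)[OF ij(1)] nzc(1)]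
      ldeg_ltop_mult(1)[OF PA[OF ij(2)] c(1) ldeg_T_prod(1)[OF ij(2)] nzc(2)] by simp
  finally have 1: "ldeg (D (M i)) \<ge> ldeg (?P i) + ldeg (?P j)" by simp
  have half: "2 * ldeg (?P n) \<ge> ldeg (M n)" if n: "n < 3" for n
  proof -
    have "ldeg (M n) = (\<Sum>v\<in>Vs n. l v * ldeg (T v))"
      unfolding M_def by (rule ldeg_T_prod(2)[OF n])
    also have "\<dots> \<le> (\<Sum>v\<in>Vs n. (2 * (l v - 1)) * ldeg (T v))"
      by (intro sum_mono mult_right_mono) (auto dest!: l_ge_2[OF n])
    also have "\<dots> = 2 * ldeg (?P n)"
      unfolding ldeg_T_prod(2)[OF n] sum_distrib_left by (simp only: mult.assoc)
    finally show ?thesis .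
  qed
  have nzj: "D (M j) \<noteq> 0"
    using nz1 unfolding rel by auto
  have "ldeg (D (M i)) = ldeg (D (M j))"
    using ldeg_con_mult[OF ab(1) DA(1) nz] ldeg_con_mult[OF _ DA(2) nzj, of "- \<beta>"] ab(2)
    unfolding rel by simp
  then have "ldeg (M i) = ldeg (M j)"
    using ldeg_D[OF M_in[OF ij(1)] nz] ldeg_D[OF M_in[OF ij(2)] nzj] by simp
  then show False
    using 1 half[OF ij(1)] half[OF ij(2)] ldeg_D[OF M_in[OF ij(1)] nz] by simp
qed

text \<open>By factorial closedness of the kernel it is enough that the three monomials are in the kernel.\<close>
lemma pencil_kernel:
  assumes "q \<in> pencil" "D q = 0" "v \<in> V"
  shows "D (T v) = 0"
proof -
  obtain i j \<alpha> \<beta> where q: "i < 3" "j < 3" "i \<noteq> j" "\<alpha> \<noteq> 0" "\<beta> \<noteq> 0" "q = con \<alpha> * M i + con \<beta> * M j"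
    using pencil_cases[OF assms(1)] by blast
  have "D (M i) = 0" using proportional_mod_kernel[OF q(1-5)] assms(2) q(6) by simp
  moreover have "D (M j) = 0"
    using proportional_mod_kernel[OF q(2,1) q(3)[symmetric] q(5,4)] assms(2) q(6) by (simp only: add.commute)
  moreover obtain k where k: "k < 3" "distinct [i, j, k]" using third_index[OF q(1-3)] by blast
  moreover have "D (M k) = 0"
  proof -
    have "D (M i + M j + M k) = 0" unfolding M_sum[OF q(1,2) k] by simp
    then show ?thesis using \<open>D (M i) = 0\<close> \<open>D (M j) = 0\<close> q k(1) by (simp add: D_add)
  qed
  moreover have "idx v = i \<or> idx v = j \<or> idx v = k" using idx_less[OF assms(3)] q k by auto
  ultimately have DM: "D (M (idx v)) = 0" by auto
  have iv: "idx v < 3" "v \<in> Vs (idx v)" using idx_less idx_mem assms(3) by auto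
  have "M (idx v) = T v ^ l v * (\<Prod>u\<in>Vs (idx v) - {v}. T u ^ l u)"
    unfolding M_def using iv by (intro prod.remove) auto
  also have "T v ^ l v = T v * T v ^ (l v - 1)"
    using l_pos[OF assms(3)] by (metis power_minus_mult mult.commute)
  finally have M: "M (idx v) = T v * (T v ^ (l v - 1) * (\<Prod>u\<in>Vs (idx v) - {v}. T u ^ l u))"
    by (simp only: mult.assoc)
  show ?thesis
  proof (rule ldeg_factor)
    show "T v \<in> A" using assms(3) by simp
    show "T v ^ (l v - 1) * (\<Prod>u\<in>Vs (idx v) - {v}. T u ^ l u) \<in> A"
      using assms(3) iv by (intro mult_in power_in T_in prod_in) (auto simp: Vs_V)
  qed (use M M_nonzero[OF iv(1)] DM in metis)+
qed

end

locale trinomial_homogeneous_lnd = trinomial_lnd Vs l X D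
  for Vs :: "nat \<Rightarrow> 'v::countable set" and l and X :: "('v \<Rightarrow> 'k::{alg_closed_field, field_char_0}) set" and D +
  fixes \<mu> :: "int poly"
  assumes D_H: "a \<in> H g \<Longrightarrow> D a \<in> H (g + \<mu>)"
begin

lemma iter_H: "a \<in> H g \<Longrightarrow> (D ^^ n) a \<in> H (g + of_nat n * \<mu>)"
proof (induction n)
  case (Suc n)
  have "(D ^^ Suc n) a \<in> H (g + of_nat n * \<mu> + \<mu>)" using D_H[OF Suc.IH[OF Suc.prems]] by simp
  then show ?case by (simp add: algebra_simps)
qed simp

text \<open>Otherwise the homogeneous elements of the kernel are multiples of monomials, in variables of the
  kernel, and each group contains a variable outside the kernel. Choose one in each group and give
  weights to these three only. Then the kernel has weight zero, so the derivation has negative weight,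
  and two of the three variables, raised to powers and corrected by elements of the kernel, have the
  same degree in both senses. A linear combination of them has a smaller nilpotency degree but the same
  weight; this is impossible, since the top derivative of an element determines its weight.\<close>
lemma pencil_meets_kernel: "\<exists>q\<in>pencil. D q = 0"
proof (rule ccontr)
  assume no: "\<not> (\<exists>q\<in>pencil. D q = 0)"
  have "\<exists>v\<in>Vs i. D (T v) \<noteq> 0" if "i < 3" for i
  proof (rule ccontr)
    assume "\<not> (\<exists>v\<in>Vs i. D (T v) \<noteq> 0)"
    then have "D (M i) = 0"
      unfolding M_def using that by (intro D_prod_zero D_power_zero power_in T_in) (auto simp: Vs_V)
    then show False using no M_pencil[OF that] by blast
  qed
  then obtain u where u: "\<And>i. i < 3 \<Longrightarrow> u i \<in> Vs i" "\<And>i. i < 3 \<Longrightarrow> D (T (u i)) \<noteq> 0" by metis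
  have uV: "u i \<in> V" if "i < 3" for i using that u Vs_V by auto
  \<comment> \<open>Weights for which only three of the variables have nonzero weight. They give the three
     monomials of the trinomial the same weight, so they are determined by the degree.\<close>
  define W where "W i = int (\<Prod>j\<in>{..<3} - {i}. l (u j))" for i
  define wt where "wt e = (\<Sum>i<3. int (e (u i)) * W i)" for e
  have Wpos: "W i > 0" for i
    unfolding W_def of_nat_0_less_iff by (rule prod_pos) (auto intro: l_pos uV)
  have lW: "int (l (u i)) * W i = int (\<Prod>j<3. l (u j))" if "i < 3" for i
    unfolding W_def of_nat_mult[symmetric] using that by (simp add: prod.remove[of "{..<3}" i])
  have wt_eq: "wt e = wt e'" if deq: "dge e = dge e'" for e e'
  proof -
    obtain s where s: "(\<Sum>i<3. s i) = 0"
      "\<And>i v. i < 3 \<Longrightarrow> v \<in> Vs i \<Longrightarrow> int (e' v) = int (e v) + s i * int (l v)"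
      using dge_eqD[OF deq] by blast
    have "wt e' = (\<Sum>i<3. int (e (u i)) * W i + s i * int (\<Prod>j<3. l (u j)))"
      unfolding wt_def
    proof (rule sum.cong[OF refl])
      fix i :: nat assume "i \<in> {..<3}"
      then have i: "i < 3" by simp
      show "int (e' (u i)) * W i = int (e (u i)) * W i + s i * int (\<Prod>j<3. l (u j))"
        unfolding s(2)[OF i u(1)[OF i]] lW[OF i, symmetric] by (simp add: algebra_simps)
    qed
    also have "\<dots> = wt e" unfolding sum.distrib sum_distrib_right[symmetric] s(1) wt_def by simp
    finally show ?thesis by simp
  qed
  have wt_add: "wt (\<lambda>v. e v + e' v) = wt e + wt e'" for e e'
    by (simp add: wt_def distrib_right sum.distrib)
  have wt_scale: "wt (\<lambda>v. n * e v) = int n * wt e" for n e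
    by (simp add: wt_def sum_distrib_left mult.assoc)
  have dge_scale: "dge (\<lambda>v. n * e v) = of_nat n * dge e" for n e
    by (simp add: dge_def sum_distrib_left mult.assoc)
  define ind where "ind v = (\<lambda>u. if u = v then 1 else (0::nat))" for v :: 'v
  have ind: "dge (ind v) = dg v" if "v \<in> V" for v
    unfolding ind_def using dge_indicator[OF that] .
  have wt_ind: "wt (ind (u i)) = W i" if i: "i < 3" for i
  proof -
    have "u j = u i \<longleftrightarrow> j = i" if "j < 3" for j
      using idx_eq[OF i u(1)[OF i]] idx_eq[OF that u(1)[OF that]] by metis
    then have "wt (ind (u i)) = (\<Sum>j<3. if j = i then W i else 0)"
      unfolding wt_def ind_def by (intro sum.cong) auto
    then show ?thesis using i by simp
  qed
  obtain e0 where e0: "dge e0 = dg (u 0) + \<mu>"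
    using H_degree[OF D_H[OF T_H[OF uV[of 0]]]] u(2)[of 0] by auto
  define \<omega> where "\<omega> = wt e0 - W 0"
  have wt_mu: "wt b = wt a + int n * \<omega>" if "dge b = dge a + of_nat n * \<mu>" for a b n
  proof -
    have "dge (\<lambda>v. b v + n * ind (u 0) v) = dge (\<lambda>v. a v + n * e0 v)"
      unfolding dge_add dge_scale that e0 ind[OF uV[of 0, simplified]] by (simp add: algebra_simps)
    from wt_eq[OF this] show ?thesis
      unfolding wt_add wt_scale wt_ind[of 0, simplified] \<omega>_def by (simp add: algebra_simps)
  qed
  have ker: "\<exists>c e. c \<noteq> 0 \<and> h = con c * mon e \<and> dge e = g \<and> wt e = 0 \<and> (\<forall>i<3. e (u i) = 0)"
    if h: "h \<in> H g" "h \<noteq> 0" "D h = 0" for h g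
  proof -
    have "\<not> (\<exists>q\<in>pencil. \<exists>b\<in>A. h = q * b)"
      using no ldeg_factor pencil_in h(2,3) by metis
    then obtain c e where ce: "h = con c * mon e" using homogeneous_cases[OF h(1)] by blast
    have c: "c \<noteq> 0" using h(2) ce by auto
    have "dge e = g" using H_disjoint[OF _ h(1,2), of "dge e"] con_mon_H[of c e] ce by simp
    moreover have z: "e (u i) = 0" if i: "i < 3" for i
    proof (rule ccontr)
      assume "e (u i) \<noteq> 0"
      then have "mon e = mon (\<lambda>v. ind (u i) v + (e v - ind (u i) v))"
        by (intro mon_cong) (auto simp: ind_def)
      also have "\<dots> = T (u i) * mon (\<lambda>v. e v - ind (u i) v)"
        unfolding mon_add using mon_T[OF uV[OF i]] by (simp add: ind_def)
      finally have "h = T (u i) * (con c * mon (\<lambda>v. e v - ind (u i) v))"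
        unfolding ce by (simp only: ac_simps)
      then have "D (T (u i)) = 0"
        using ldeg_factor[of "T (u i)" "con c * mon (\<lambda>v. e v - ind (u i) v)"] h(2,3) uV[OF i] by simp
      then show False using u(2)[OF i] by simp
    qed
    moreover have "wt e = 0" unfolding wt_def using z by simp
    ultimately show ?thesis using ce c by blast
  qed
  define E where "E i = ldeg (T (u i))" for i
  define h where "h i = ltop (T (u i))" for i
  have TA: "T (u i) \<in> A" "T (u i) \<noteq> 0" if "i < 3" for i using T_nonzero uV[OF that] by auto
  have Epos: "E i > 0" if "i < 3" for i
    using ldeg_0_iff[OF TA(1)[OF that]] u(2)[OF that] unfolding E_def by auto
  have hA: "h i \<in> A" "h i \<noteq> 0" "D (h i) = 0" if "i < 3" for i
    unfolding h_def using TA[OF that] ltop_nonzero D_ltop by auto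
  have hH: "h i \<in> H (dg (u i) + of_nat (E i) * \<mu>)" if "i < 3" for i
    unfolding h_def ltop_def E_def using iter_H[OF T_H[OF uV[OF that]]] .
  have "\<forall>i. \<exists>cb. i < 3 \<longrightarrow> fst cb \<noteq> 0 \<and> h i = con (fst cb) * mon (snd cb) \<and>
      dge (snd cb) = dg (u i) + of_nat (E i) * \<mu> \<and> wt (snd cb) = 0 \<and> (\<forall>j<3. snd cb (u j) = 0)"
    using ker[OF hH hA(2,3)] by simp
  from choice[OF this] obtain cb where cb': "\<forall>i. i < 3 \<longrightarrow> fst (cb i) \<noteq> 0 \<and>
      h i = con (fst (cb i)) * mon (snd (cb i)) \<and>
      dge (snd (cb i)) = dg (u i) + of_nat (E i) * \<mu> \<and> wt (snd (cb i)) = 0 \<and>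
      (\<forall>j<3. snd (cb i) (u j) = 0)" ..
  define c b where "c i = fst (cb i)" and "b i = snd (cb i)" for i
  have cb: "c i \<noteq> 0" "h i = con (c i) * mon (b i)" "dge (b i) = dg (u i) + of_nat (E i) * \<mu>" "wt (b i) = 0"
    "\<And>j. j < 3 \<Longrightarrow> b i (u j) = 0" if "i < 3" for i
    using cb' that unfolding c_def b_def by blast+
  have om: "W 0 + int (E 0) * \<omega> = 0"
    using wt_mu[of "b 0" "ind (u 0)" "E 0"] cb(3,4)[of 0] ind[OF uV[of 0]] wt_ind[of 0] by simp
  \<comment> \<open>The top derivatives of the three variables have weight zero.\<close>
  have "\<omega> < 0"
  proof (rule ccontr)
    assume "\<not> \<omega> < 0"
    then have "int (E 0) * \<omega> \<ge> 0" by (intro mult_nonneg_nonneg) auto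
    then show False using om Wpos[of 0] by simp
  qed
  \<comment> \<open>Two products with the same degree and the same nilpotency degree, and with proportional top
     derivatives.\<close>
  define P where "P = T (u 0) ^ E 1 * h 1 ^ E 0"
  define Q where "Q = T (u 1) ^ E 0 * h 0 ^ E 1"
  define Z where "Z = h 0 ^ E 1 * h 1 ^ E 0"
  define g where "g = of_nat (E 1) * dg (u 0) + of_nat (E 0) * dg (u 1) + of_nat (E 0 * E 1) * \<mu>"
  have top: "ldeg (T (u i) ^ E j * h j ^ E i) = E j * E i \<and>
      (\<exists>n>0. ltop (T (u i) ^ E j * h j ^ E i) = of_nat n * (h i ^ E j * h j ^ E i))"
    if ij: "i < 3" "j < 3" for i j
  proof -
    have nz: "T (u i) ^ E j \<noteq> 0" "h j ^ E i \<noteq> 0" and inA: "T (u i) ^ E j \<in> A" "h j ^ E i \<in> A"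
      using power_nonzero TA[OF ij(1)] hA[OF ij(2)] by auto
    have "D (h j ^ E i) = 0" using D_power_zero hA[OF ij(2)] by blast
    then have h0: "ldeg (h j ^ E i) = 0" "ltop (h j ^ E i) = h j ^ E i"
      using ldeg_0_iff[OF inA(2)] unfolding ltop_def by auto
    obtain n where n: "n > 0" "ltop (T (u i) ^ E j) = of_nat n * h i ^ E j"
      using ldeg_ltop_power(2)[OF TA[OF ij(1)]] unfolding h_def by blast
    obtain n' where n': "n' > 0"
      "ltop (T (u i) ^ E j * h j ^ E i) = of_nat n' * (ltop (T (u i) ^ E j) * ltop (h j ^ E i))"
      using ldeg_ltop_mult(2)[OF inA nz] by blast
    have "ltop (T (u i) ^ E j * h j ^ E i) = of_nat (n' * n) * (h i ^ E j * h j ^ E i)"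
      unfolding n'(2) n(2) h0(2) of_nat_mult by (simp only: ac_simps)
    moreover have "ldeg (T (u i) ^ E j * h j ^ E i) = E j * E i"
      unfolding ldeg_ltop_mult(1)[OF inA nz] ldeg_ltop_power(1)[OF TA[OF ij(1)]] h0(1) E_def[symmetric] by simp
    ultimately show ?thesis using n(1) n'(1) by (metis nat_0_less_mult_iff)
  qed
  obtain n1 where n1: "n1 > 0" "ltop P = of_nat n1 * Z" "ldeg P = E 0 * E 1"
    using top[of 0 1] unfolding P_def Z_def by (auto simp: mult.commute)
  obtain n2 where n2: "n2 > 0" "ltop Q = of_nat n2 * (h 1 ^ E 0 * h 0 ^ E 1)" "ldeg Q = E 0 * E 1"
    using top[of 1 0] unfolding Q_def by auto
  have n2Z: "ltop Q = of_nat n2 * Z" unfolding n2(2) Z_def by (simp only: mult.commute)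
  have inA: "P \<in> A" "Q \<in> A" "Z \<in> A" unfolding P_def Q_def Z_def using TA hA by auto
  have PH: "P \<in> H g"
  proof -
    have "P \<in> H (of_nat (E 1) * dg (u 0) + of_nat (E 0) * (dg (u 1) + of_nat (E 1) * \<mu>))"
      unfolding P_def by (intro H_mult H_power one_H T_H hH uV) auto
    then show ?thesis unfolding g_def by (simp add: algebra_simps)
  qed
  have QH: "Q \<in> H g"
  proof -
    have "Q \<in> H (of_nat (E 0) * dg (u 1) + of_nat (E 1) * (dg (u 0) + of_nat (E 0) * \<mu>))"
      unfolding Q_def by (intro H_mult H_power one_H T_H hH uV) auto
    then show ?thesis unfolding g_def by (simp add: algebra_simps)
  qed
  have ZH: "Z \<in> H (g + of_nat (E 0 * E 1) * \<mu>)"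
  proof -
    have "Z \<in> H (of_nat (E 1) * (dg (u 0) + of_nat (E 0) * \<mu>) + of_nat (E 0) * (dg (u 1) + of_nat (E 1) * \<mu>))"
      unfolding Z_def by (intro H_mult H_power one_H hH) auto
    then show ?thesis unfolding g_def by (simp add: algebra_simps)
  qed
  have Z0: "Z \<noteq> 0" "D Z = 0"
    unfolding Z_def using hA[of 0] hA[of 1] power_nonzero D_power_zero
    by (auto simp: D_mult nonzero_mult)
  define U where "U = con (of_nat n2) * P + con (- of_nat n1) * Q"
  have UA: "U \<in> A" unfolding U_def using inA by auto
  have con_mult_H: "con c * a \<in> H g'" if "a \<in> H g'" for c a g'
    using H_mult[OF con_H[of c] that] by simp
  have UH: "U \<in> H g" unfolding U_def by (intro H_add con_mult_H PH QH)
  have "(D ^^ (E 0 * E 1)) U = con (of_nat n2) * ltop P + con (- of_nat n1) * ltop Q"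
    unfolding U_def ltop_def n1(3) n2(3) using inA
    by (simp only: iter_add mult_in con_in iter_const_mult D_con)
  also have "\<dots> = 0"
    unfolding n1(2) n2Z of_nat_con con_minus mult_minus_left
    by (subst mult.left_commute) (rule right_minus)
  finally have DU: "(D ^^ (E 0 * E 1)) U = 0" .
  have "U \<noteq> 0"
  proof
    assume "U = 0"
    \<comment> \<open>A point where \<open>u 0\<close> is the only vanishing coordinate separates the two products.\<close>
    define y where "y = (\<lambda>v. if v = u 0 then 0 else (1::'k))"
    have y0: "Mv 0 y = 0" unfolding Mv_def y_def
      using u(1)[of 0] l_pos[OF uV[of 0]] by (intro prod_zero) (auto intro!: bexI[of _ "u 0"])
    have "u 0 \<notin> Vs 1" using u(1)[of 0] Vs_disjoint[of 0 1] by auto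
    then have y1: "Mv 1 y = 1" unfolding Mv_def y_def by (intro prod.neutral) auto
    obtain x where x: "x \<in> X" "\<forall>v\<in>Vs 0 \<union> Vs 1. x v = y v" "\<forall>v\<in>V - Vs 0 - Vs 1. x v \<noteq> 0"
      using point_exists[of 0 1 y] y0 y1 by auto
    have xu: "x (u 0) = 0" using x(2) u(1)[of 0] by (simp add: y_def)
    have xv: "x v \<noteq> 0" if "v \<in> V" "v \<noteq> u 0" for v
      using x(2,3) that by (cases "v \<in> Vs 0 \<union> Vs 1") (auto simp: y_def)
    have Px: "P x = 0"
      unfolding P_def using x(1) xu Epos[of 1] by (simp add: fun_power_apply)
    have "h 0 x \<noteq> 0"
      unfolding cb(2)[of 0, simplified] times_fun_apply con_apply mon_apply retr_X[OF x(1)]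
    proof -
      have "x v ^ b 0 v \<noteq> 0" if "v \<in> V" for v
        using xv[OF that] cb(5)[of 0 0] by (cases "v = u 0") auto
      then show "c 0 * (\<Prod>v\<in>V. x v ^ b 0 v) \<noteq> 0" using cb(1)[of 0] by auto
    qed
    moreover have "u 1 \<noteq> u 0" using u(1)[of 1] \<open>u 0 \<notin> Vs 1\<close> by auto
    ultimately have Qx: "Q x \<noteq> 0"
      unfolding Q_def using x(1) xv[OF uV[of 1]] by (simp add: fun_power_apply)
    have "U x = - of_nat n1 * Q x" unfolding U_def using Px by simp
    then show False using \<open>U = 0\<close> Qx n1(1) by simp
  qed
  define k where "k = ldeg U"
  have k: "k < E 0 * E 1" unfolding k_def using ldeg_less[OF DU \<open>U \<noteq> 0\<close>] .
  have "ltop U \<in> H (g + of_nat k * \<mu>)" unfolding ltop_def k_def[symmetric] using iter_H[OF UH] .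
  then obtain e1 where e1: "dge e1 = g + of_nat k * \<mu>" "wt e1 = 0"
    using ker[of "ltop U"] ltop_nonzero[OF \<open>U \<noteq> 0\<close>] D_ltop[OF UA] by blast
  obtain e2 where e2: "dge e2 = g + of_nat (E 0 * E 1) * \<mu>" "wt e2 = 0"
    using ker[OF ZH Z0] by blast
  have "dge e2 = dge e1 + of_nat (E 0 * E 1 - k) * \<mu>"
    unfolding e1(1) e2(1) using k by (simp add: of_nat_diff less_imp_le left_diff_distrib)
  from wt_mu[OF this] show False using e1(2) e2(2) \<open>\<omega> < 0\<close> k by simp
qed

lemma zero: "a \<in> A \<Longrightarrow> D a = 0"
proof -
  obtain q where "q \<in> pencil" "D q = 0" using pencil_meets_kernel by blast
  then show "a \<in> A \<Longrightarrow> D a = 0"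
    using derivation_zeroI[OF derivation_on_axioms D_con] pencil_kernel by blast
qed

end

section \<open>Automorphisms permute the variables up to constants\<close>

text \<open>An automorphism of the coordinate ring over the ground field, together with its inverse.\<close>
locale trinomial_automorphism = trinomial_hypersurface Vs l X
  for Vs :: "nat \<Rightarrow> 'v::countable set" and l and X :: "('v \<Rightarrow> 'k::{alg_closed_field, field_char_0}) set" +
  fixes \<Phi> \<Psi> :: "(('v \<Rightarrow> 'k) \<Rightarrow> 'k) \<Rightarrow> (('v \<Rightarrow> 'k) \<Rightarrow> 'k)"
  assumes \<Phi>_in [intro]: "a \<in> A \<Longrightarrow> \<Phi> a \<in> A"
    and \<Phi>_add: "a \<in> A \<Longrightarrow> b \<in> A \<Longrightarrow> \<Phi> (a + b) = \<Phi> a + \<Phi> b"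
    and \<Phi>_mult: "a \<in> A \<Longrightarrow> b \<in> A \<Longrightarrow> \<Phi> (a * b) = \<Phi> a * \<Phi> b"
    and \<Phi>_con: "\<Phi> (con c) = con c"
    and \<Psi>_in [intro]: "a \<in> A \<Longrightarrow> \<Psi> a \<in> A"
    and \<Psi>_\<Phi>: "a \<in> A \<Longrightarrow> \<Psi> (\<Phi> a) = a"
    and \<Phi>_\<Psi>: "a \<in> A \<Longrightarrow> \<Phi> (\<Psi> a) = a"
begin

lemma \<Psi>_eqI: "a \<in> A \<Longrightarrow> b \<in> A \<Longrightarrow> \<Phi> a = b \<Longrightarrow> \<Psi> b = a"
  using \<Psi>_\<Phi> by auto

lemma inverse_automorphism: "trinomial_automorphism Vs l X \<Psi> \<Phi>"
proof unfold_locales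
  fix a b assume ab: "a \<in> A" "b \<in> A"
  then have in': "\<Psi> a \<in> A" "\<Psi> b \<in> A" by auto
  show "\<Psi> (a + b) = \<Psi> a + \<Psi> b"
    using \<Phi>_add[OF in'] ab by (intro \<Psi>_eqI add_in in') (simp_all add: \<Phi>_\<Psi> del: plus_fun_apply)
  show "\<Psi> (a * b) = \<Psi> a * \<Psi> b"
    using \<Phi>_mult[OF in'] ab by (intro \<Psi>_eqI mult_in in') (simp_all add: \<Phi>_\<Psi> del: times_fun_apply)
next
  show "\<Psi> (con c) = con c" for c using \<Phi>_con by (intro \<Psi>_eqI) auto
qed (auto simp: \<Phi>_\<Psi> \<Psi>_\<Phi>)

lemma \<Phi>_0: "\<Phi> 0 = 0" using \<Phi>_con[of 0] by simp
lemma \<Phi>_1: "\<Phi> 1 = 1" using \<Phi>_con[of 1] by simp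

lemma \<Phi>_power: "a \<in> A \<Longrightarrow> \<Phi> (a ^ n) = \<Phi> a ^ n"
  by (induction n) (simp_all only: power_0 power_Suc \<Phi>_1 \<Phi>_mult power_in)

lemma \<Phi>_prod: "(\<And>i. i \<in> I \<Longrightarrow> f i \<in> A) \<Longrightarrow> \<Phi> (prod f I) = (\<Prod>i\<in>I. \<Phi> (f i))"
  by (induction I rule: infinite_finite_induct) (simp_all add: \<Phi>_1 \<Phi>_mult prod_in)

lemma \<Phi>_sum: "(\<And>i. i \<in> I \<Longrightarrow> f i \<in> A) \<Longrightarrow> \<Phi> (sum f I) = (\<Sum>i\<in>I. \<Phi> (f i))"
  by (induction I rule: infinite_finite_induct) (simp_all add: \<Phi>_0 \<Phi>_add sum_in)

lemma \<Phi>_con_mult: "a \<in> A \<Longrightarrow> \<Phi> (con c * a) = con c * \<Phi> a"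
  using \<Phi>_mult[of "con c" a] \<Phi>_con by simp

lemma \<Phi>_nonzero: "a \<in> A \<Longrightarrow> a \<noteq> 0 \<Longrightarrow> \<Phi> a \<noteq> 0"
proof
  assume "a \<in> A" "a \<noteq> 0" "\<Phi> a = 0"
  then have "a = \<Psi> 0" using \<Psi>_\<Phi>[of a] by simp
  also have "\<Psi> 0 = 0" using \<Psi>_eqI[OF zero_in zero_in \<Phi>_0] .
  finally show False using \<open>a \<noteq> 0\<close> by simp
qed

end

context trinomial_hypersurface
begin

text \<open>The derivation by which a one-parameter subgroup of the torus acts, namely multiplication of
  homogeneous elements by the \<open>k\<close>-th coordinate of their degree.\<close>
definition Eu :: "nat \<Rightarrow> (('v \<Rightarrow> 'k) \<Rightarrow> 'k) \<Rightarrow> (('v \<Rightarrow> 'k) \<Rightarrow> 'k)"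
  where "Eu k a = (\<Sum>g\<in>supp a. con (of_int (coeff g k)) * cmp g a)"

lemma Eu_eq:
  assumes "finite S" "supp a \<subseteq> S"
  shows "Eu k a = (\<Sum>g\<in>S. con (of_int (coeff g k)) * cmp g a)"
  unfolding Eu_def using assms by (intro sum.mono_neutral_left) (auto simp: supp_def)

lemma Eu_H: "a \<in> H g \<Longrightarrow> Eu k a = con (of_int (coeff g k)) * a"
  by (subst Eu_eq[of "{g}"]) (auto simp: supp_def cmp_H split: if_splits)

lemma Eu_in [intro]: "a \<in> A \<Longrightarrow> Eu k a \<in> A"
  unfolding Eu_def by (intro sum_in mult_in con_in cmp_in)

lemma Eu_add:
  assumes "a \<in> A" "b \<in> A"
  shows "Eu k (a + b) = Eu k a + Eu k b"
proof -
  let ?S = "supp a \<union> supp b"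
  have "finite ?S" "supp (a + b) \<subseteq> ?S"
    using assms by (auto simp: supp_def cmp_add finite_cmp)
  moreover have "(\<Sum>g\<in>?S. con (of_int (coeff g k)) * cmp g (a + b)) =
      (\<Sum>g\<in>?S. con (of_int (coeff g k)) * cmp g a) + (\<Sum>g\<in>?S. con (of_int (coeff g k)) * cmp g b)"
    by (simp only: cmp_add[OF assms] distrib_left sum.distrib)
  ultimately show ?thesis by (simp only: Eu_eq[of ?S] Un_upper1 Un_upper2)
qed

lemma Eu_mult:
  assumes "a \<in> A" "b \<in> A"
  shows "Eu k (a * b) = Eu k a * b + a * Eu k b"
proof -
  have hom: "Eu k (c * d) = Eu k c * d + c * Eu k d" if cd: "c \<in> H g" "d \<in> H h" for c d g h
    unfolding Eu_H[OF H_mult[OF cd]] Eu_H[OF cd(1)] Eu_H[OF cd(2)]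
    by (simp only: coeff_add of_int_add con_add distrib_left distrib_right ac_simps)
  have left: "Eu k (c * d) = Eu k c * d + c * Eu k d" if c: "c \<in> H g" and d: "d \<in> A" for c d g
    using d
  proof (induction d rule: H_induct)
    case (add d d')
    have cA: "c \<in> A" using H_subset[OF c] .
    have "Eu k (c * (d + d')) = Eu k (c * d) + Eu k (c * d')"
      unfolding distrib_left by (intro Eu_add mult_in cA add)
    also have "\<dots> = (Eu k c * d + c * Eu k d) + (Eu k c * d' + c * Eu k d')"
      using add(3,4) by (simp only:)
    also have "\<dots> = Eu k c * (d + d') + c * Eu k (d + d')"
      unfolding Eu_add[OF add(1,2)] distrib_left by (simp only: ac_simps)
    finally show ?case .
  next
    case (hom h d)
    then show ?case using \<open>\<And>h g d c. c \<in> H g \<Longrightarrow> d \<in> H h \<Longrightarrow> Eu k (c * d) = Eu k c * d + c * Eu k d\<close> c by blast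
  qed
  show ?thesis
    using assms(1)
  proof (induction a rule: H_induct)
    case (add c c')
    have "Eu k ((c + c') * b) = Eu k (c * b) + Eu k (c' * b)"
      unfolding distrib_right by (intro Eu_add mult_in assms(2) add)
    also have "\<dots> = (Eu k c * b + c * Eu k b) + (Eu k c' * b + c' * Eu k b)"
      using add(3,4) by (simp only:)
    also have "\<dots> = Eu k (c + c') * b + (c + c') * Eu k b"
      unfolding Eu_add[OF add(1,2)] distrib_right by (simp only: ac_simps)
    finally show ?case .
  next
    case (hom g c)
    then show ?case by (rule left[OF _ assms(2)])
  qed
qed

lemma cmp_con_mult: "a \<in> A \<Longrightarrow> cmp g (con c * a) = con c * cmp g a"
  using cmp_mult_H[of a "con c" 0 g] con_H[of c] by (simp add: mult.commute)

lemma cmp_Eu: "a \<in> A \<Longrightarrow> cmp g (Eu k a) = con (of_int (coeff g k)) * cmp g a"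
proof -
  assume a: "a \<in> A"
  have "cmp g (Eu k a) = (\<Sum>h\<in>supp a. con (of_int (coeff h k)) * cmp g (cmp h a))"
    unfolding Eu_def using a by (subst cmp_sum) (auto simp: cmp_con_mult)
  also have "\<dots> = (\<Sum>h\<in>supp a. if h = g then con (of_int (coeff g k)) * cmp g a else 0)"
    by (rule sum.cong[OF refl]) (simp add: cmp_cmp a)
  also have "\<dots> = con (of_int (coeff g k)) * cmp g a"
    using a by (subst sum.delta) (auto simp: supp_def finite_cmp)
  finally show ?thesis .
qed

text \<open>In characteristic zero the eigenvalues recover all coordinates of the degree, so that only one
  degree can occur.\<close>
lemma Eu_eigenvector_H:
  assumes a: "a \<in> A" and eig: "\<And>k. \<exists>c. Eu k a = con c * a"
  shows "\<exists>g. a \<in> H g"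
proof (cases "a = 0")
  case False
  obtain c where c: "\<And>k. Eu k a = con (c k) * a" using eig by metis
  have ck: "of_int (coeff g k) = c k" if g: "g \<in> supp a" for g k
  proof -
    have "con (of_int (coeff g k)) * cmp g a = con (c k) * cmp g a"
      using cmp_Eu[OF a, of g k] unfolding c cmp_con_mult[OF a] by simp
    then have "con (of_int (coeff g k) - c k) * cmp g a = 0"
      by (simp add: con_diff left_diff_distrib)
    then show ?thesis
      using nzd[of "con (of_int (coeff g k) - c k)" "cmp g a"] g a by (auto simp: supp_def)
  qed
  obtain g where g: "g \<in> supp a" using supp_nonempty[OF a False] by blast
  have "h = g" if h: "h \<in> supp a" for h
  proof (rule poly_eqI)
    fix k
    have "(of_int (coeff h k) :: 'k) = of_int (coeff g k)" using ck[OF g] ck[OF h] by simp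
    then show "coeff h k = coeff g k" by simp
  qed
  then have "supp a = {g}" using g by blast
  then have "cmp g a = a" using sum_supp[OF a] by simp
  then show ?thesis using a unfolding H_def by blast
qed simp

lemma iter_Eu: "b \<in> A \<Longrightarrow> (Eu k ^^ n) b = (\<Sum>g\<in>supp b. con (of_int (coeff g k) ^ n) * cmp g b)"
proof (induction n)
  case 0
  show ?case using sum_supp[OF 0] by simp
next
  case (Suc n)
  have add0: "Eu k 0 = 0" by (simp add: Eu_def supp_def)
  have Eu_sum: "Eu k (sum f I) = (\<Sum>i\<in>I. Eu k (f i))" if "finite I" "\<And>i. i \<in> I \<Longrightarrow> f i \<in> A" for f and I :: "int poly set"
    using that by (induction I rule: finite_induct) (simp_all add: add0 Eu_add sum_in)
  have mem: "con c * cmp g b \<in> H g" for c g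
    using H_mult[OF con_H[of c] cmp_in_H[OF Suc.prems, of g]] by simp
  have "(Eu k ^^ Suc n) b = Eu k (\<Sum>g\<in>supp b. con (of_int (coeff g k) ^ n) * cmp g b)"
    unfolding funpow.simps o_apply Suc.IH[OF Suc.prems] ..
  also have "\<dots> = (\<Sum>g\<in>supp b. Eu k (con (of_int (coeff g k) ^ n) * cmp g b))"
    using Suc.prems by (intro Eu_sum) auto
  also have "\<dots> = (\<Sum>g\<in>supp b. con (of_int (coeff g k) ^ Suc n) * cmp g b)"
    unfolding Eu_H[OF mem] by (simp only: power_Suc con_mult mult.assoc)
  finally show ?case .
qed

lemma dge_eq_0:
  assumes "dge e = 0" "u \<in> V"
  shows "e u = 0"
proof -
  have "dge (\<lambda>_. 0) = dge e" using assms(1) by (simp add: dge_def)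
  from dge_eqD[OF this] obtain s where s: "(\<Sum>i<3. s i) = 0"
    "\<And>i v. i < 3 \<Longrightarrow> v \<in> Vs i \<Longrightarrow> int (e v) = s i * int (l v)" by auto
  have nonneg: "s i \<ge> 0" if i: "i < 3" for i
  proof -
    obtain v where v: "v \<in> Vs i" using Vs_nonempty[OF i] by auto
    have "0 \<le> s i * int (l v)" using s(2)[OF i v] by (metis of_nat_0_le_iff)
    then show ?thesis using l_ge_2[OF i v] by (simp add: zero_le_mult_iff)
  qed
  have "s i = 0" if i: "i < 3" for i
    using s(1) nonneg i sum_nonneg_eq_0_iff[of "{..<3}" s] by auto
  then have "int (e u) = 0"
    using s(2)[OF idx_less[OF assms(2)] idx_mem[OF assms(2)]] idx_less[OF assms(2)] by simp
  then show ?thesis by simp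
qed

lemma H_0_con:
  assumes "a \<in> H 0"
  shows "\<exists>c. a = con c"
proof -
  obtain p where p: "mvars p \<subseteq> V" "\<And>m. m \<in> Poly_Mapping.keys p \<Longrightarrow> pdeg m = 0" "a = rho p"
    using H_poly[OF assms] by blast
  have "a = (\<Sum>m\<in>Poly_Mapping.keys p. con (Poly_Mapping.lookup p m))"
    unfolding p(3) rho_eq_sum[OF p(1)]
  proof (rule sum.cong[OF refl])
    fix m assume m: "m \<in> Poly_Mapping.keys p"
    have "mon (Poly_Mapping.lookup m) = 1"
      using p(2)[OF m] dge_eq_0 by (intro mon_zero) (simp add: pdeg_def)
    then show "con (Poly_Mapping.lookup p m) * mon (Poly_Mapping.lookup m) = con (Poly_Mapping.lookup p m)"
      by simp
  qed
  also have "\<dots> = con (\<Sum>m\<in>Poly_Mapping.keys p. Poly_Mapping.lookup p m)"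
    by (rule ext) (simp only: fun_sum_apply con_apply)
  finally show ?thesis by blast
qed

text \<open>The factors are homogeneous. Exponents of their degrees add up to an exponent of the degree of a
  variable, which is the variable itself; so one of the degrees is zero.\<close>
lemma T_irreducible:
  assumes v: "v \<in> V" and ab: "a \<in> A" "b \<in> A" "a * b = T v"
  shows "(\<exists>c. a = con c) \<or> (\<exists>c. b = con c)"
proof -
  have "a * b \<in> H (dg v)" "a * b \<noteq> 0" using ab(3) T_H[OF v] T_nonzero[OF v] by simp_all
  then obtain h where h: "a \<in> H h" "b \<in> H (dg v - h)" using homogeneous_factor[OF ab(1,2)] by blast
  have "a \<noteq> 0" "b \<noteq> 0" using \<open>a * b \<noteq> 0\<close> by auto
  then obtain e e' where e: "dge e = h" "dge e' = dg v - h" using H_degree[OF h(1)] H_degree[OF h(2)] by blast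
  have "dge (\<lambda>u. e u + e' u) = dg v" unfolding dge_add e by simp
  then have ee: "e u + e' u = (if u = v then 1 else 0)" if "u \<in> V" for u
    using dge_eq_dg[OF v] that by blast
  have "(\<forall>u\<in>V. e u = 0) \<or> (\<forall>u\<in>V. e' u = 0)"
  proof (cases "e v = 0")
    case True
    then have "e u = 0" if "u \<in> V" for u using ee[OF that] by (cases "u = v") auto
    then show ?thesis by blast
  next
    case False
    then have "e' u = 0" if "u \<in> V" for u using ee[OF that] ee[OF v] by (cases "u = v") auto
    then show ?thesis by blast
  qed
  then have "h = 0 \<or> dg v - h = 0" using e by (auto simp: dge_def)
  then show ?thesis using h H_0_con by metis
qed

lemma T_origin: "v \<in> V \<Longrightarrow> T v origin = 0"
  using origin_in_X by (simp add: origin_def)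

lemma M_origin: "i < 3 \<Longrightarrow> M i origin = 0"
  using origin_in_X by (simp add: M_apply Mv_origin)

lemma T_not_con: "v \<in> V \<Longrightarrow> T v \<noteq> con c"
proof
  assume v: "v \<in> V" "T v = con c"
  have "con c origin = 0" using T_origin[OF v(1)] unfolding v(2) .
  then show False using T_nonzero[OF v(1)] v(2) by simp
qed

lemma pencil_not_con: "q \<in> pencil \<Longrightarrow> q \<noteq> con c"
proof
  assume q: "q \<in> pencil" "q = con c"
  then obtain \<alpha> \<beta> where "q = con \<alpha> * M 0 + con \<beta> * M 1" unfolding pencil_def by blast
  then have "q origin = 0" using M_origin[of 0] M_origin[of 1] by simp
  then have "c = 0" using q(2) by simp
  then show False using pencil_nonzero[OF q(1)] q(2) by simp
qed

end

context trinomial_automorphism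
begin

text \<open>The conjugate by the automorphism of an infinitesimal torus action.\<close>
definition Dk :: "nat \<Rightarrow> (('v \<Rightarrow> 'k) \<Rightarrow> 'k) \<Rightarrow> (('v \<Rightarrow> 'k) \<Rightarrow> 'k)"
  where "Dk k a = \<Phi> (Eu k (\<Psi> a))"

lemma derivation_Dk: "derivation_on A (Dk k)"
proof -
  interpret i: trinomial_automorphism Vs l X \<Psi> \<Phi> by (rule inverse_automorphism)
  show ?thesis
  proof
    fix a b assume ab: "a \<in> A" "b \<in> A"
    show "Dk k a \<in> A" unfolding Dk_def using ab by auto
    have in': "\<Psi> a \<in> A" "\<Psi> b \<in> A" "Eu k (\<Psi> a) \<in> A" "Eu k (\<Psi> b) \<in> A" using ab by auto
    show "Dk k (a + b) = Dk k a + Dk k b"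
      unfolding Dk_def i.\<Phi>_add[OF ab] Eu_add[OF in'(1,2)] by (rule \<Phi>_add[OF in'(3,4)])
    have "Dk k (a * b) = \<Phi> (Eu k (\<Psi> a) * \<Psi> b) + \<Phi> (\<Psi> a * Eu k (\<Psi> b))"
      unfolding Dk_def i.\<Phi>_mult[OF ab] Eu_mult[OF in'(1,2)] by (intro \<Phi>_add mult_in in')
    then show "Dk k (a * b) = Dk k a * b + a * Dk k b"
      unfolding \<Phi>_mult[OF in'(3,2)] \<Phi>_mult[OF in'(1,4)] \<Phi>_\<Psi>[OF ab(1)] \<Phi>_\<Psi>[OF ab(2)] Dk_def .
  qed
qed

lemma Dk_con: "Dk k (con c) = 0"
proof -
  interpret i: trinomial_automorphism Vs l X \<Psi> \<Phi> by (rule inverse_automorphism)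
  have "Eu k (con c) = 0" using Eu_H[OF con_H[of c], of k] by simp
  then show ?thesis unfolding Dk_def i.\<Phi>_con by (simp only: \<Phi>_0)
qed

lemma iter_Dk: "a \<in> A \<Longrightarrow> (Dk k ^^ n) a = \<Phi> ((Eu k ^^ n) (\<Psi> a))"
proof (induction n)
  case (Suc n)
  have "(Eu k ^^ n) (\<Psi> a) \<in> A"
    using Suc.prems by (induction n) auto
  then show ?case using Suc by (simp add: Dk_def \<Psi>_\<Phi>)
qed (simp add: \<Phi>_\<Psi>)

text \<open>The conjugate of a diagonalizable derivation is locally finite. By rigidity all its components of
  nonzero degree vanish.\<close>
lemma Dk_H: "a \<in> H g \<Longrightarrow> Dk k a \<in> H g"
proof -
  interpret d: graded_derivation A cmp "Dk k"
  proof -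
    interpret derivation_on A "Dk k" by (rule derivation_Dk)
    show "graded_derivation A cmp (Dk k)" by unfold_locales
  qed
  have lf: d.locally_finite
    unfolding d.locally_finite_def
  proof
    fix a assume a: "a \<in> A"
    let ?b = "\<Psi> a"
    have b: "?b \<in> A" using a by auto
    let ?S = "\<Union>g\<in>supp ?b. supp (\<Phi> (cmp g ?b))"
    have "supp ((Dk k ^^ n) a) \<subseteq> ?S" for n
    proof
      fix h assume h: "h \<in> supp ((Dk k ^^ n) a)"
      have "cmp h ((Dk k ^^ n) a) =
          (\<Sum>g\<in>supp ?b. con (of_int (coeff g k) ^ n) * cmp h (\<Phi> (cmp g ?b)))"
        unfolding iter_Dk[OF a] iter_Eu[OF b]
        using b by (subst \<Phi>_sum cmp_sum, force)+ (simp add: \<Phi>_con_mult cmp_con_mult \<Phi>_in)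
      moreover have "cmp h ((Dk k ^^ n) a) \<noteq> 0" using h by (simp add: supp_def)
      ultimately obtain g where "g \<in> supp ?b" "con (of_int (coeff g k) ^ n) * cmp h (\<Phi> (cmp g ?b)) \<noteq> 0"
        by (metis (no_types, lifting) sum.neutral)
      then have "h \<in> supp (\<Phi> (cmp g ?b))" unfolding supp_def by auto
      then show "h \<in> ?S" using \<open>g \<in> supp ?b\<close> by blast
    qed
    moreover have "finite ?S" using b by auto
    ultimately show "\<exists>S. finite S \<and> (\<forall>n. supp ((Dk k ^^ n) a) \<subseteq> S)" by blast
  qed
  have Dcon: "d.Dcmp \<mu> (con c) = 0" for \<mu> c
    unfolding d.Dcmp_H[OF con_H] Dk_con by simp
  have fin: "finite {\<mu>. \<exists>a\<in>A. d.Dcmp \<mu> a \<noteq> 0}"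
  proof (rule finite_subset)
    show "{\<mu>. \<exists>a\<in>A. d.Dcmp \<mu> a \<noteq> 0} \<subseteq> (\<Union>v\<in>V. (\<lambda>h. h - dg v) ` supp (Dk k (T v)))"
    proof
      fix \<mu> assume "\<mu> \<in> {\<mu>. \<exists>a\<in>A. d.Dcmp \<mu> a \<noteq> 0}"
      then obtain v where v: "v \<in> V" "d.Dcmp \<mu> (T v) \<noteq> 0"
        using derivation_zeroI[OF d.derivation_Dcmp Dcon] by blast
      then have "dg v + \<mu> \<in> supp (Dk k (T v))"
        using d.Dcmp_H[OF T_H[OF v(1)]] by (simp add: supp_def)
      then have "\<mu> \<in> (\<lambda>h. h - dg v) ` supp (Dk k (T v))"
        by (intro image_eqI[of _ _ "dg v + \<mu>"]) simp_all
      then show "\<mu> \<in> (\<Union>v\<in>V. (\<lambda>h. h - dg v) ` supp (Dk k (T v)))" using v(1) by blast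
    qed
    show "finite (\<Union>v\<in>V. (\<lambda>h. h - dg v) ` supp (Dk k (T v)))"
      by (intro finite_UN_I finite_imageI finite_supp d.D_in T_in finite_V)
  qed
  have rigid: "d.Dcmp \<mu> a = 0" if "\<mu> \<noteq> 0" "lnd A (d.Dcmp \<mu>)" "a \<in> A" for \<mu> a
  proof -
    interpret n: lnd A "d.Dcmp \<mu>" by (rule that(2))
    interpret t: trinomial_homogeneous_lnd Vs l X "d.Dcmp \<mu>" \<mu>
      by unfold_locales (auto simp: Dcon d.Dcmp_H_in)
    show ?thesis using t.zero[OF that(3)] .
  qed
  show "a \<in> H g \<Longrightarrow> Dk k a \<in> H g"
    using d.preserves_degrees[OF lf fin rigid] by blast
qed

text \<open>The degree of a variable has multiplicity one, so the variable is an eigenvector of the conjugate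
  of each infinitesimal torus action, which preserves degrees.\<close>
lemma \<Psi>_T_homogeneous:
  assumes "v \<in> V"
  shows "\<exists>g. \<Psi> (T v) \<in> H g"
proof (rule Eu_eigenvector_H)
  interpret i: trinomial_automorphism Vs l X \<Psi> \<Phi> by (rule inverse_automorphism)
  show TA: "\<Psi> (T v) \<in> A" using assms by auto
  fix k
  obtain c where c: "Dk k (T v) = con c * T v" using H_dg[OF assms Dk_H[OF T_H[OF assms]]] by blast
  have "Eu k (\<Psi> (T v)) = \<Psi> (Dk k (T v))"
    unfolding Dk_def using TA by (simp add: \<Psi>_\<Phi> Eu_in)
  also have "\<dots> = con c * \<Psi> (T v)"
    unfolding c using assms by (intro i.\<Phi>_con_mult) auto
  finally show "\<exists>c. Eu k (\<Psi> (T v)) = con c * \<Psi> (T v)" by blast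
qed

lemma \<Phi>_T_homogeneous: "v \<in> V \<Longrightarrow> \<exists>g. \<Phi> (T v) \<in> H g"
  using trinomial_automorphism.\<Psi>_T_homogeneous[OF inverse_automorphism] .

lemma \<Phi>_T_irreducible:
  assumes v: "v \<in> V" and ab: "a \<in> A" "b \<in> A" "\<Phi> (T v) = a * b"
  shows "(\<exists>c. a = con c) \<or> (\<exists>c. b = con c)"
proof -
  interpret i: trinomial_automorphism Vs l X \<Psi> \<Phi> by (rule inverse_automorphism)
  have "T v = \<Psi> (\<Phi> (T v))" using v by (simp add: \<Psi>_\<Phi>)
  then have "\<Psi> a * \<Psi> b = T v" unfolding ab(3) i.\<Phi>_mult[OF ab(1,2)] by simp
  then have "(\<exists>c. \<Psi> a = con c) \<or> (\<exists>c. \<Psi> b = con c)"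
    using T_irreducible[OF v] ab by blast
  then show ?thesis using \<Phi>_\<Psi>[OF ab(1)] \<Phi>_\<Psi>[OF ab(2)] \<Phi>_con by metis
qed

lemma \<Phi>_M_homogeneous:
  assumes "i < 3"
  shows "\<exists>g. \<Phi> (M i) \<in> H g"
proof -
  have *: "\<exists>g. (\<Prod>v\<in>S. \<Phi> (T v) ^ l v) \<in> H g" if "finite S" "S \<subseteq> V" for S
    using that
  proof (induction S rule: finite_induct)
    case empty
    show ?case by (intro exI[of _ 0]) (simp only: prod.empty one_H)
  next
    case (insert v S)
    then obtain g g' where "(\<Prod>v\<in>S. \<Phi> (T v) ^ l v) \<in> H g" "\<Phi> (T v) \<in> H g'"
      using \<Phi>_T_homogeneous by blast
    then have "\<Phi> (T v) ^ l v * (\<Prod>v\<in>S. \<Phi> (T v) ^ l v) \<in> H (of_nat (l v) * g' + g)"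
      by (intro H_mult H_power one_H)
    then show ?case unfolding prod.insert[OF insert(1,2)] by blast
  qed
  have "\<Phi> (M i) = (\<Prod>v\<in>Vs i. \<Phi> (T v) ^ l v)"
    unfolding M_def using assms Vs_V by (subst \<Phi>_prod) (auto simp: \<Phi>_power)
  moreover have "\<exists>g. (\<Prod>v\<in>Vs i. \<Phi> (T v) ^ l v) \<in> H g"
    using assms Vs_V by (intro *) auto
  ultimately show ?thesis by simp
qed

text \<open>Three nonzero homogeneous elements with sum zero have the same degree.\<close>
lemma \<Phi>_M_same_degree: "\<exists>g. \<forall>i<3. \<Phi> (M i) \<in> H g"
proof -
  obtain g where g: "\<And>i. i < 3 \<Longrightarrow> \<Phi> (M i) \<in> H (g i)" using \<Phi>_M_homogeneous by metis
  have nz: "\<Phi> (M i) \<noteq> 0" if "i < 3" for i using \<Phi>_nonzero M_nonzero that by auto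
  have eq: "g i = g j" if ij: "i < 3" "j < 3" "i \<noteq> j" for i j
  proof (rule ccontr)
    assume ne: "g i \<noteq> g j"
    obtain k where k: "k < 3" "distinct [i, j, k]" using third_index[OF ij] by blast
    have s: "\<Phi> (M i) + \<Phi> (M j) + \<Phi> (M k) = 0"
      using \<Phi>_add[of "M i + M j" "M k"] \<Phi>_add[of "M i" "M j"] M_sum[OF ij(1,2) k] ij k \<Phi>_0
      by (simp del: plus_fun_apply)
    have inA: "\<Phi> (M i) \<in> A" "\<Phi> (M j) \<in> A" "\<Phi> (M k) \<in> A" using ij k by auto
    have c: "cmp h (\<Phi> (M i)) + cmp h (\<Phi> (M j)) + cmp h (\<Phi> (M k)) = 0" for h
      using arg_cong[OF s, of "cmp h"] inA by (simp only: cmp_add add_in cmp_0)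
    have "g k = g i"
    proof (rule ccontr)
      assume "g k \<noteq> g i"
      then show False
        using c[of "g i"] ne nz[OF ij(1)] unfolding cmp_H[OF g[OF ij(1)]] cmp_H[OF g[OF ij(2)]] cmp_H[OF g[OF k(1)]]
        by simp
    qed
    moreover have "g k = g j"
    proof (rule ccontr)
      assume "g k \<noteq> g j"
      then show False
        using c[of "g j"] ne nz[OF ij(2)] unfolding cmp_H[OF g[OF ij(1)]] cmp_H[OF g[OF ij(2)]] cmp_H[OF g[OF k(1)]]
        by simp
    qed
    ultimately show False using ne by simp
  qed
  have "\<Phi> (M i) \<in> H (g 0)" if "i < 3" for i
    using g[OF that] eq[of i 0] that by (cases "i = 0") auto
  then show ?thesis by blast
qed

text \<open>The image of a variable is homogeneous and irreducible, hence up to a constant a variable or an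
  element of the pencil. The latter is impossible: the inverse automorphism would map the whole pencil
  to elements of the degree of a variable, and these form a one-dimensional space.\<close>
lemma \<Phi>_T:
  assumes v: "v \<in> V"
  shows "\<exists>u\<in>V. \<exists>c. c \<noteq> 0 \<and> \<Phi> (T v) = con c * T u"
proof -
  interpret i: trinomial_automorphism Vs l X \<Psi> \<Phi> by (rule inverse_automorphism)
  obtain g where g: "\<Phi> (T v) \<in> H g" using \<Phi>_T_homogeneous[OF v] by blast
  have nz: "\<Phi> (T v) \<noteq> 0" using v T_nonzero \<Phi>_nonzero by auto
  have nc: "\<Phi> (T v) \<noteq> con c" for c
  proof
    assume "\<Phi> (T v) = con c"
    then have "T v = con c" using \<Psi>_\<Phi>[of "T v"] v i.\<Phi>_con by simp
    then show False using T_not_con[OF v] by simp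
  qed
  have "\<not> (\<exists>q\<in>pencil. \<exists>b\<in>A. \<Phi> (T v) = q * b)"
  proof
    assume "\<exists>q\<in>pencil. \<exists>b\<in>A. \<Phi> (T v) = q * b"
    then obtain q b where q: "q \<in> pencil" "b \<in> A" "\<Phi> (T v) = q * b" by blast
    then obtain c where c: "b = con c" using \<Phi>_T_irreducible[OF v pencil_in[OF q(1)] q(2,3)] pencil_not_con by blast
    have T: "T v = con c * \<Psi> q"
      using \<Psi>_\<Phi>[of "T v"] v unfolding q(3) c mult.commute[of q] i.\<Phi>_con_mult[OF pencil_in[OF q(1)]] by simp
    obtain g' where g': "\<And>i. i < 3 \<Longrightarrow> \<Psi> (M i) \<in> H g'" using i.\<Phi>_M_same_degree by blast
    obtain \<alpha> \<beta> where ab: "q = con \<alpha> * M 0 + con \<beta> * M 1" using q(1) unfolding pencil_def by blast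
    have "\<Psi> q = con \<alpha> * \<Psi> (M 0) + con \<beta> * \<Psi> (M 1)"
      unfolding ab by (simp add: i.\<Phi>_add i.\<Phi>_con_mult del: plus_fun_apply times_fun_apply)
    then have "T v = con (c * \<alpha>) * \<Psi> (M 0) + con (c * \<beta>) * \<Psi> (M 1)"
      unfolding T by (simp only: con_mult distrib_left mult.assoc)
    moreover have cH: "con d * a \<in> H g'" if "a \<in> H g'" for d a
      using H_mult[OF con_H[of d] that] by simp
    ultimately have "T v \<in> H g'" using g'[of 0] g'[of 1] by (simp only:) (intro H_add cH, simp_all)
    then have gv: "g' = dg v" using H_disjoint[OF _ T_H[OF v] T_nonzero[OF v]] by blast
    obtain a where a: "\<Psi> (M 0) = con a * T v" using H_dg[OF v, of "\<Psi> (M 0)"] g'[of 0] gv by auto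
    obtain b' where b': "\<Psi> (M 1) = con b' * T v" using H_dg[OF v, of "\<Psi> (M 1)"] g'[of 1] gv by auto
    have "\<Psi> (con b' * M 0 + con (- a) * M 1) = con b' * \<Psi> (M 0) + con (- a) * \<Psi> (M 1)"
      by (simp add: i.\<Phi>_add i.\<Phi>_con_mult del: plus_fun_apply times_fun_apply)
    also have "\<dots> = 0"
      unfolding a b' con_minus mult_minus_left by (subst mult.left_commute) (rule right_minus)
    finally have "con b' * M 0 + con (- a) * M 1 = 0"
      using i.\<Phi>_nonzero[of "con b' * M 0 + con (- a) * M 1"] by auto
    then have "a = 0" using M_independent[of 0 1 b' "- a"] by simp
    then have "\<Psi> (M 0) = 0" using a by simp
    then show False using i.\<Phi>_nonzero[of "M 0"] M_nonzero[of 0] by simp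
  qed
  then obtain c e where ce: "\<Phi> (T v) = con c * mon e" using homogeneous_cases[OF g] by blast
  have "\<exists>u\<in>V. e u > 0"
  proof (rule ccontr)
    assume "\<not> (\<exists>u\<in>V. e u > 0)"
    then have "mon e = 1" by (intro mon_zero) auto
    then show False using ce nc[of c] by simp
  qed
  then obtain u where u: "u \<in> V" "e u > 0" by blast
  let ?e = "\<lambda>w. e w - (if w = u then 1 else 0)"
  have "mon e = mon (\<lambda>w. (if w = u then 1 else 0) + ?e w)"
    using u(2) by (intro mon_cong) auto
  also have "\<dots> = T u * mon ?e" unfolding mon_add mon_T[OF u(1)] ..
  finally have eq: "\<Phi> (T v) = T u * (con c * mon ?e)" unfolding ce by (simp only: ac_simps)
  then obtain d where "con c * mon ?e = con d"
    using \<Phi>_T_irreducible[OF v _ _ eq] T_not_con[OF u(1)] u(1) by auto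
  then have "\<Phi> (T v) = con d * T u" using eq by (simp only: mult.commute)
  moreover have "d \<noteq> 0" using calculation nz by auto
  ultimately show ?thesis using u(1) by blast
qed

end

section \<open>The permutation fixes the trinomial\<close>

lemma eliminate_third:
  fixes a b c x y z :: "'a::comm_ring"
  assumes "a + b + c = 0" "x * a + y * b + z * c = 0"
  shows "(y - x) * b + (z - x) * c = 0"
proof -
  have "(y - x) * b + (z - x) * c = (x * a + y * b + z * c) - x * (a + b + c)"
    by (simp add: algebra_simps)
  then show ?thesis using assms by simp
qed

context trinomial_hypersurface
begin

lemma T_proportional:
  assumes "u \<in> V" "v \<in> V" "T u = con c * T v"
  shows "u = v"
proof -
  have "con c * T v \<in> H (0 + dg v)" using con_H T_H[OF assms(2)] by (rule H_mult)
  then have "dg u = dg v"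
    using H_disjoint[OF T_H[OF assms(1)] _ T_nonzero[OF assms(1)]] assms(3) by simp
  then have "dge (\<lambda>w. if w = v then 1 else 0) = dg u" using dge_indicator[OF assms(2)] by simp
  from dge_eq_dg[OF assms(1) this assms(1)] show ?thesis by (auto split: if_splits)
qed

text \<open>Two distinct monomials of the same degree and with disjoint supports: by comparison of exponents
  the support of each contains a whole group. So the images of the three groups contain, and then are,
  the three groups. On each group the exponents get multiplied by a common factor, which is \<open>1\<close>
  because the total degree is unchanged.\<close>
lemma groups_permuted:
  assumes bij: "bij_betw \<tau> V V"
    and e: "\<And>i u. i < 3 \<Longrightarrow> e i u = (if u \<in> \<tau> ` Vs i then l (inv_into V \<tau> u) else 0)"
    and deg: "\<And>i. i < 3 \<Longrightarrow> dge (e i) = g"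
  shows "(\<forall>i<3. \<exists>j<3. \<tau> ` Vs i = Vs j) \<and> (\<forall>v\<in>V. l (\<tau> v) = l v)"
proof -
  have inj: "inj_on \<tau> V" and im: "\<tau> ` V = V" using bij by (auto simp: bij_betw_def)
  have Vi: "Vs i \<subseteq> V" if "i < 3" for i using Vs_V[OF that] by auto
  have disj: "\<tau> ` Vs i \<inter> \<tau> ` Vs j = {}" if ij: "i < 3" "j < 3" "i \<noteq> j" for i j
    using inj_on_image_Int[OF inj Vi[OF ij(1)] Vi[OF ij(2)]] Vs_disjoint[OF ij] by simp
  have e_tau: "e i (\<tau> v) = l v" if "i < 3" "v \<in> Vs i" for i v
  proof -
    have "inv_into V \<tau> (\<tau> v) = v" using inv_into_f_f[OF inj] Vi that by blast
    then show ?thesis unfolding e[OF that(1)] using that(2) by simp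
  qed
  have e_pos: "e i u > 0" if "i < 3" "u \<in> \<tau> ` Vs i" for i u
    using that e_tau l_pos Vi by force
  have e_0: "e i u = 0" if "i < 3" "u \<notin> \<tau> ` Vs i" for i u
    using e[OF that(1)] that(2) by simp
  have "\<exists>k t. k < 3 \<and> t > 0 \<and> Vs k \<subseteq> \<tau> ` Vs i \<and> (\<forall>v\<in>Vs k. e i v = t * l v)" if i: "i < 3" for i
  proof -
    obtain j :: nat where j: "j < 3" "j \<noteq> i" by (cases "i = 0") (auto intro: that[of 1] that[of 0])
    have "dge (e i) = dge (e j)" using deg[OF i] deg[OF j(1)] by simp
    from dge_eqD[OF this] obtain s where s: "(\<Sum>i<3. s i) = 0"
      "\<And>k v. k < 3 \<Longrightarrow> v \<in> Vs k \<Longrightarrow> int (e j v) = int (e i v) + s k * int (l v)" by blast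
    have "\<exists>k<3. s k < 0"
    proof (rule ccontr)
      assume "\<not> (\<exists>k<3. s k < 0)"
      then have nn: "\<And>k. k \<in> {..<3} \<Longrightarrow> 0 \<le> s k" by force
      have "\<And>k. k < 3 \<Longrightarrow> s k = 0"
        using s(1) sum_nonneg_eq_0_iff[of "{..<3}" s, OF finite_lessThan nn] by simp
      obtain v where v: "v \<in> Vs i" using Vs_nonempty[OF i] by blast
      have tv: "\<tau> v \<in> V" using Vi[OF i] v im by auto
      have "e j (\<tau> v) = e i (\<tau> v)"
        using s(2)[OF idx_less[OF tv] idx_mem[OF tv]] \<open>\<And>k. k < 3 \<Longrightarrow> s k = 0\<close> idx_less[OF tv] by simp
      moreover have "e j (\<tau> v) = 0" using e_0[OF j(1)] disj[OF i j(1)] j(2) v by blast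
      ultimately show False using e_pos[OF i, of "\<tau> v"] v by simp
    qed
    then obtain k where k: "k < 3" "s k < 0" by blast
    have pos: "e i v > 0" if v: "v \<in> Vs k" for v
    proof -
      have "s k * int (l v) < 0" using k(2) l_ge_2[OF k(1) v] by (intro mult_neg_pos) auto
      then show ?thesis using s(2)[OF k(1) v] by linarith
    qed
    have sub: "Vs k \<subseteq> \<tau> ` Vs i" using pos e_0[OF i] by force
    have "e i v = nat (- s k) * l v" if v: "v \<in> Vs k" for v
    proof -
      have "v \<notin> \<tau> ` Vs j" using disj[OF i j(1)] j(2) subsetD[OF sub v] by auto
      then have "e j v = 0" by (rule e_0[OF j(1)])
      then have "int (e i v) = (- s k) * int (l v)" using s(2)[OF k(1) v] by simp
      also have "\<dots> = int (nat (- s k) * l v)" using k(2) by simp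
      finally show ?thesis by (simp only: of_nat_eq_iff)
    qed
    then show ?thesis using k sub by (intro exI[of _ k] exI[of _ "nat (- s k)"]) auto
  qed
  then obtain k t where kt: "\<And>i. i < 3 \<Longrightarrow> k i < (3::nat)" "\<And>i. i < 3 \<Longrightarrow> t i > (0::nat)"
    "\<And>i. i < 3 \<Longrightarrow> Vs (k i) \<subseteq> \<tau> ` Vs i" "\<And>i v. i < 3 \<Longrightarrow> v \<in> Vs (k i) \<Longrightarrow> e i v = t i * l v"
    by metis
  have kinj: "inj_on k {..<3}"
  proof (rule inj_onI)
    fix i j assume ij: "i \<in> {..<3}" "j \<in> {..<(3::nat)}" "k i = k j"
    show "i = j"
    proof (rule ccontr)
      assume "i \<noteq> j"
      then have "Vs (k i) = {}" using kt(3)[of i] kt(3)[of j] disj[of i j] ij by auto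
      then show False using Vs_nonempty kt(1)[of i] ij by auto
    qed
  qed
  have kim: "k ` {..<3} = {..<3}"
    by (rule endo_inj_surj[OF _ _ kinj]) (use kt(1) in auto)
  have grp: "\<tau> ` Vs i = Vs (k i)" if i: "i < 3" for i
  proof
    show "\<tau> ` Vs i \<subseteq> Vs (k i)"
    proof
      fix v assume v: "v \<in> \<tau> ` Vs i"
      then have vV: "v \<in> V" using Vi[OF i] im by auto
      obtain j where j: "j < 3" "idx v = k j" using kim idx_less[OF vV] by (metis imageE lessThan_iff)
      then have "v \<in> \<tau> ` Vs j" using kt(3)[of j] idx_mem[OF vV] by auto
      then have "j = i" using disj[OF j(1) i] v by auto
      then show "v \<in> Vs (k i)" using j idx_mem[OF vV] by simp
    qed
  qed (rule kt(3)[OF i])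
  have dge_e: "dge (e i) = of_nat (t i) * delta" if i: "i < 3" for i
  proof -
    have "dge (e i) = (\<Sum>v\<in>Vs (k i). of_nat (e i v) * dg v)"
      unfolding dge_def using grp[OF i] e_0[OF i] Vi[OF kt(1)[OF i]]
      by (intro sum.mono_neutral_right) auto
    also have "\<dots> = of_nat (t i) * (\<Sum>v\<in>Vs (k i). of_nat (l v) * dg v)"
      unfolding sum_distrib_left by (rule sum.cong) (simp_all add: kt(4)[OF i] mult.assoc)
    finally show ?thesis unfolding dg_group[OF kt(1)[OF i]] .
  qed
  have t_eq: "t i = t 0" if i: "i < 3" for i
  proof -
    have "of_nat (t i) * delta = of_nat (t 0) * delta"
      using dge_e[OF i] dge_e[of 0] deg[OF i] deg[of 0] by simp
    then show ?thesis using delta_ne_0 by simp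
  qed
  have "(\<Sum>i<3. \<Sum>v\<in>Vs i. l v) = (\<Sum>i<3. t 0 * (\<Sum>v\<in>Vs (k i). l v))"
  proof (rule sum.cong[OF refl])
    fix i :: nat assume "i \<in> {..<3}"
    then have i: "i < 3" by simp
    have "(\<Sum>v\<in>Vs i. l v) = (\<Sum>v\<in>Vs i. e i (\<tau> v))" using e_tau[OF i] by simp
    also have "\<dots> = (\<Sum>u\<in>\<tau> ` Vs i. e i u)"
      using inj_on_subset[OF inj Vi[OF i]] by (simp add: sum.reindex)
    also have "\<dots> = t 0 * (\<Sum>v\<in>Vs (k i). l v)"
      unfolding grp[OF i] sum_distrib_left using kt(4)[OF i] t_eq[OF i] by (intro sum.cong) auto
    finally show "(\<Sum>v\<in>Vs i. l v) = t 0 * (\<Sum>v\<in>Vs (k i). l v)" .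
  qed
  also have "\<dots> = t 0 * (\<Sum>j\<in>k ` {..<3}. \<Sum>v\<in>Vs j. l v)"
    unfolding sum_distrib_left[symmetric] sum.reindex[OF kinj] o_def ..
  finally have "(\<Sum>v\<in>V. l v) = t 0 * (\<Sum>v\<in>V. l v)" unfolding kim sum_V .
  moreover have "(\<Sum>v\<in>V. l v) > 0"
  proof -
    obtain v where "v \<in> Vs 0" using Vs_nonempty[of 0] by auto
    then have "v \<in> V" using Vs_V[of 0] by simp
    then show ?thesis using l_pos by (intro sum_pos) auto
  qed
  ultimately have t1: "t 0 = 1" by (metis less_irrefl mult_cancel2 nat_mult_1)
  have "l (\<tau> v) = l v" if v: "v \<in> V" for v
  proof -
    let ?i = "idx v"
    have i: "?i < 3" "v \<in> Vs ?i" using idx_less[OF v] idx_mem[OF v] by auto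
    have "\<tau> v \<in> Vs (k ?i)" using grp[OF i(1)] i(2) by blast
    then have "e ?i (\<tau> v) = l (\<tau> v)" using kt(4)[OF i(1)] t_eq[OF i(1)] t1 by simp
    then show ?thesis using e_tau[OF i] by simp
  qed
  then show ?thesis using grp kt(1) by blast
qed

end

context trinomial_automorphism
begin

text \<open>The constants satisfy the equations of the torus, because the images of the three monomials add up
  to zero and this is the only linear relation between the monomials.\<close>
lemma monomial_form:
  "\<exists>\<tau> c. \<tau> permutes V \<and> (\<forall>i<3. \<exists>j<3. \<tau> ` Vs i = Vs j) \<and> (\<forall>v\<in>V. l (\<tau> v) = l v) \<and>
     (\<forall>v\<in>V. c v \<noteq> 0 \<and> \<Phi> (T v) = con (c v) * T (\<tau> v)) \<and>
     (\<exists>d. \<forall>i<3. (\<Prod>v\<in>Vs i. c v ^ l v) = d)"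
proof -
  interpret i: trinomial_automorphism Vs l X \<Psi> \<Phi> by (rule inverse_automorphism)
  obtain \<tau>0 c where tc: "\<And>v. v \<in> V \<Longrightarrow> \<tau>0 v \<in> V" "\<And>v. v \<in> V \<Longrightarrow> c v \<noteq> 0"
    "\<And>v. v \<in> V \<Longrightarrow> \<Phi> (T v) = con (c v) * T (\<tau>0 v)"
    using \<Phi>_T by metis
  obtain \<tau>1 c1 where tc1: "\<And>v. v \<in> V \<Longrightarrow> \<tau>1 v \<in> V" "\<And>v. v \<in> V \<Longrightarrow> c1 v \<noteq> 0"
    "\<And>v. v \<in> V \<Longrightarrow> \<Psi> (T v) = con (c1 v) * T (\<tau>1 v)"
    using i.\<Phi>_T by metis
  have inv1: "\<tau>1 (\<tau>0 v) = v" if v: "v \<in> V" for v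
  proof -
    have "T v = \<Psi> (\<Phi> (T v))" using v by (simp add: \<Psi>_\<Phi>)
    also have "\<dots> = con (c v) * (con (c1 (\<tau>0 v)) * T (\<tau>1 (\<tau>0 v)))"
      unfolding tc(3)[OF v] i.\<Phi>_con_mult[OF T_in[OF tc(1)[OF v]]] tc1(3)[OF tc(1)[OF v]] ..
    also have "\<dots> = con (c v * c1 (\<tau>0 v)) * T (\<tau>1 (\<tau>0 v))" by (simp only: con_mult mult.assoc)
    finally show ?thesis by (intro T_proportional[OF v tc1(1)[OF tc(1)[OF v]], symmetric])
  qed
  have inv2: "\<tau>0 (\<tau>1 v) = v" if v: "v \<in> V" for v
  proof -
    have "T v = \<Phi> (\<Psi> (T v))" using v by (simp add: \<Phi>_\<Psi>)
    also have "\<dots> = con (c1 v) * (con (c (\<tau>1 v)) * T (\<tau>0 (\<tau>1 v)))"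
      unfolding tc1(3)[OF v] \<Phi>_con_mult[OF T_in[OF tc1(1)[OF v]]] tc(3)[OF tc1(1)[OF v]] ..
    also have "\<dots> = con (c1 v * c (\<tau>1 v)) * T (\<tau>0 (\<tau>1 v))" by (simp only: con_mult mult.assoc)
    finally show ?thesis by (intro T_proportional[OF v tc(1)[OF tc1(1)[OF v]], symmetric])
  qed
  define \<tau> where "\<tau> v = (if v \<in> V then \<tau>0 v else v)" for v
  have bij: "bij_betw \<tau> V V"
    by (rule bij_betw_byWitness[of _ \<tau>1]) (auto simp: \<tau>_def inv1 inv2 tc tc1)
  then have perm: "\<tau> permutes V" by (rule bij_imp_permutes) (simp add: \<tau>_def)
  have \<Phi>T: "\<Phi> (T v) = con (c v) * T (\<tau> v)" if "v \<in> V" for v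
    using tc(3)[OF that] that by (simp add: \<tau>_def)
  have inj: "inj_on \<tau> V" using bij by (simp add: bij_betw_def)
  have Vi: "Vs i \<subseteq> V" if "i < 3" for i using Vs_V[OF that] by auto
  have tV: "\<tau> v \<in> V" if "v \<in> V" for v using that tc(1) by (simp add: \<tau>_def)
  define C where "C i = (\<Prod>v\<in>Vs i. c v ^ l v)" for i
  define e where "e i u = (if u \<in> \<tau> ` Vs i then l (inv_into V \<tau> u) else 0)" for i u
  have con_pow: "con (a ^ n) = con a ^ n" for a :: 'k and n
    by (induction n) (simp_all only: power_0 con_1 power_Suc con_mult)
  have con_prod: "con (prod f S) = (\<Prod>v\<in>S. con (f v))" for f and S :: "'v set"
    by (rule ext) (simp only: fun_prod_apply con_apply)
  have \<Phi>M: "\<Phi> (M i) = con (C i) * (\<Prod>v\<in>Vs i. T (\<tau> v) ^ l v)" if i: "i < 3" for i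
  proof -
    have TA: "T v \<in> A" if "v \<in> Vs i" for v using that Vi[OF i] by auto
    have "\<Phi> (M i) = (\<Prod>v\<in>Vs i. \<Phi> (T v ^ l v))"
      unfolding M_def by (rule \<Phi>_prod) (intro power_in TA)
    also have "\<dots> = (\<Prod>v\<in>Vs i. con (c v ^ l v) * T (\<tau> v) ^ l v)"
    proof (rule prod.cong[OF refl])
      fix v assume v: "v \<in> Vs i"
      then have "v \<in> V" using Vi[OF i] by auto
      show "\<Phi> (T v ^ l v) = con (c v ^ l v) * T (\<tau> v) ^ l v"
        unfolding \<Phi>_power[OF TA[OF v]] \<Phi>T[OF \<open>v \<in> V\<close>] con_pow by (rule power_mult_distrib)
    qed
    finally show ?thesis unfolding prod.distrib C_def con_prod .
  qed
  have mone: "(\<Prod>v\<in>Vs i. T (\<tau> v) ^ l v) = mon (e i)" if i: "i < 3" for i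
  proof -
    have "(\<Prod>v\<in>Vs i. T (\<tau> v) ^ l v) = (\<Prod>v\<in>Vs i. T (\<tau> v) ^ e i (\<tau> v))"
    proof (rule prod.cong[OF refl])
      fix v assume v: "v \<in> Vs i"
      then have "e i (\<tau> v) = l v" unfolding e_def using inv_into_f_f[OF inj] Vi[OF i] by auto
      then show "T (\<tau> v) ^ l v = T (\<tau> v) ^ e i (\<tau> v)" by (simp only:)
    qed
    also have "\<dots> = (\<Prod>u\<in>\<tau> ` Vs i. T u ^ e i u)"
      unfolding prod.reindex[OF inj_on_subset[OF inj Vi[OF i]]] o_def ..
    also have "\<dots> = mon (e i)"
      unfolding mon_def using Vi[OF i] tV
      by (intro prod.mono_neutral_left) (auto simp: e_def)
    finally show ?thesis .
  qed
  have Cnz: "C i \<noteq> 0" if "i < 3" for i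
    unfolding C_def using that tc(2) Vi by auto
  obtain g where g: "\<And>i. i < 3 \<Longrightarrow> \<Phi> (M i) \<in> H g" using \<Phi>_M_same_degree by blast
  have deg: "dge (e i) = g" if i: "i < 3" for i
  proof -
    have "con (C i) * mon (e i) \<in> H g" using g[OF i] unfolding \<Phi>M[OF i] mone[OF i] .
    moreover have "con (C i) * mon (e i) \<noteq> 0"
      by (intro con_nonzero_mult mon_in mon_nonzero Cnz i)
    ultimately show ?thesis using H_disjoint[OF con_mon_H] by blast
  qed
  have gp: "(\<forall>i<3. \<exists>j<3. \<tau> ` Vs i = Vs j) \<and> (\<forall>v\<in>V. l (\<tau> v) = l v)"
    by (rule groups_permuted[where e = e, OF bij _ deg]) (simp_all only: e_def)
  then obtain k where k: "\<And>i. i < 3 \<Longrightarrow> k i < (3::nat)" "\<And>i. i < 3 \<Longrightarrow> \<tau> ` Vs i = Vs (k i)" by metis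
  have \<Phi>Mk: "\<Phi> (M i) = con (C i) * M (k i)" if i: "i < 3" for i
  proof -
    have "(\<Prod>v\<in>Vs i. T (\<tau> v) ^ l v) = (\<Prod>v\<in>Vs i. T (\<tau> v) ^ l (\<tau> v))"
      using gp Vi[OF i] by (intro prod.cong refl) auto
    also have "\<dots> = M (k i)"
      unfolding M_def k(2)[OF i, symmetric] prod.reindex[OF inj_on_subset[OF inj Vi[OF i]]] o_def ..
    finally show ?thesis unfolding \<Phi>M[OF i] by (simp only:)
  qed
  have kne: "k i \<noteq> k j" if "i < 3" "j < 3" "i \<noteq> j" for i j
  proof
    assume "k i = k j"
    then have "\<tau> ` Vs i = \<tau> ` Vs j" using k(2) that by simp
    then have "Vs i = Vs j" using inj_on_image_eq_iff[OF inj Vi Vi] that by blast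
    then show False using Vs_disjoint[OF that] Vs_nonempty[OF that(1)] by auto
  qed
  have Ceq: "C i = C j" if ij: "i < 3" "j < 3" "i \<noteq> j" for i j
  proof -
    obtain n where n: "n < 3" "distinct [i, j, n]" using third_index[OF ij] by blast
    have dk: "distinct [k i, k j, k n]" using kne ij n by auto
    have "\<Phi> (M i + M j + M n) = \<Phi> (M i) + \<Phi> (M j) + \<Phi> (M n)"
      using ij n by (simp only: \<Phi>_add M_in add_in)
    then have "con (C i) * M (k i) + con (C j) * M (k j) + con (C n) * M (k n) = 0"
      unfolding M_sum[OF ij(1,2) n] \<Phi>_0 \<Phi>Mk[OF ij(1)] \<Phi>Mk[OF ij(2)] \<Phi>Mk[OF n(1)] by simp
    then have "con (C j - C i) * M (k j) + con (C n - C i) * M (k n) = 0"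
      unfolding con_diff
      using M_sum[OF k(1)[OF ij(1)] k(1)[OF ij(2)] k(1)[OF n(1)] dk] by (intro eliminate_third)
    moreover have "j \<noteq> n" using n(2) by simp
    ultimately have "C j - C i = 0"
      using M_independent[OF k(1)[OF ij(2)] k(1)[OF n(1)] kne[OF ij(2) n(1)]] by blast
    then show ?thesis by simp
  qed
  have "\<exists>d. \<forall>i<3. C i = d"
    by (rule exI[of _ "C 0"]) (metis Ceq zero_less_numeral)
  then show ?thesis
    using perm gp tc(2) \<Phi>T unfolding C_def by blast
qed

end

section \<open>Laurent monomials and the parametrization of the torus\<close>

text \<open>Laurent monomials in the variables of \<open>S\<close>, as functions on points without zero coordinates.\<close>
definition laurent :: "'i set \<Rightarrow> (('i \<Rightarrow> 'k::field) \<Rightarrow> 'k) \<Rightarrow> bool"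
  where "laurent S g \<longleftrightarrow> (\<exists>a. \<forall>c. (\<forall>i\<in>S. c i \<noteq> 0) \<longrightarrow> g c = (\<Prod>i\<in>S. c i powi a i))"

lemma laurentI:
  assumes "\<And>c. \<forall>i\<in>S. c i \<noteq> 0 \<Longrightarrow> g c = (\<Prod>i\<in>S. c i powi a i)"
  shows "laurent S g"
  unfolding laurent_def by (rule exI[of _ a]) (use assms in simp)

lemma laurent_cong:
  assumes "laurent S g" "\<And>c. \<forall>i\<in>S. c i \<noteq> 0 \<Longrightarrow> h c = g c"
  shows "laurent S h"
proof -
  obtain a where "\<And>c. \<forall>i\<in>S. c i \<noteq> 0 \<Longrightarrow> g c = (\<Prod>i\<in>S. c i powi a i)"
    using assms(1) unfolding laurent_def by blast
  then show ?thesis using assms(2) by (intro laurentI[of _ _ a]) simp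
qed

lemma laurent_coord: "finite S \<Longrightarrow> i \<in> S \<Longrightarrow> laurent S (\<lambda>c. c i)"
proof -
  assume S: "finite S" "i \<in> S"
  have "c i = (\<Prod>j\<in>S. c j powi (if j = i then 1 else 0))" for c :: "'a \<Rightarrow> 'b"
  proof -
    have "(\<Prod>j\<in>S. c j powi (if j = i then 1 else 0)) = (\<Prod>j\<in>S. if j = i then c j else 1)"
      by (rule prod.cong) auto
    then show ?thesis using S by simp
  qed
  then show ?thesis by (rule laurentI)
qed

lemma laurent_one: "laurent S (\<lambda>_. 1)"
  by (rule laurentI[of _ _ "\<lambda>_. 0"]) simp

lemma laurent_mult:
  assumes "laurent S g" "laurent S h"
  shows "laurent S (\<lambda>c. g c * h c)"
proof -
  obtain a where a: "\<And>c. \<forall>i\<in>S. c i \<noteq> 0 \<Longrightarrow> g c = (\<Prod>i\<in>S. c i powi a i)"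
    using assms(1) unfolding laurent_def by blast
  obtain b where b: "\<And>c. \<forall>i\<in>S. c i \<noteq> 0 \<Longrightarrow> h c = (\<Prod>i\<in>S. c i powi b i)"
    using assms(2) unfolding laurent_def by blast
  have "g c * h c = (\<Prod>i\<in>S. c i powi (a i + b i))" if c: "\<forall>i\<in>S. c i \<noteq> 0" for c
    unfolding a[OF c] b[OF c] prod.distrib[symmetric]
  proof (rule prod.cong[OF refl])
    fix i assume "i \<in> S"
    then have "c i \<noteq> 0" using c by blast
    then show "c i powi a i * c i powi b i = c i powi (a i + b i)"
      by (intro power_int_add[symmetric]) simp
  qed
  then show ?thesis by (rule laurentI)
qed

lemma prod_powi: "(\<Prod>i\<in>S. f i powi k) = (\<Prod>i\<in>S. f i) powi (k::int)" for f :: "'i \<Rightarrow> 'k::field"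
proof (induction S rule: infinite_finite_induct)
  case (insert i S)
  show ?case
    unfolding prod.insert[OF insert(1,2)] insert(3) power_int_mult_distrib ..
qed simp_all

lemma laurent_powi: "laurent S g \<Longrightarrow> laurent S (\<lambda>c. g c powi k)"
proof -
  assume "laurent S g"
  then obtain a where a: "\<And>c. \<forall>i\<in>S. c i \<noteq> 0 \<Longrightarrow> g c = (\<Prod>i\<in>S. c i powi a i)"
    unfolding laurent_def by blast
  have "g c powi k = (\<Prod>i\<in>S. c i powi (a i * k))" if c: "\<forall>i\<in>S. c i \<noteq> 0" for c
    unfolding a[OF c] prod_powi[symmetric] by (simp only: power_int_mult)
  then show ?thesis by (rule laurentI)
qed

lemma laurent_power: "laurent S g \<Longrightarrow> laurent S (\<lambda>c. g c ^ k)"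
  using laurent_powi[of S g "int k"] by simp

lemma laurent_prod: "(\<And>j. j \<in> J \<Longrightarrow> laurent S (g j)) \<Longrightarrow> laurent S (\<lambda>c. \<Prod>j\<in>J. g j c)"
  by (induction J rule: infinite_finite_induct) (auto intro: laurent_one laurent_mult)

lemma laurent_nonzero:
  assumes "finite S" "laurent S g" "\<forall>i\<in>S. c i \<noteq> 0"
  shows "g c \<noteq> 0"
proof -
  obtain a where "\<And>c. \<forall>i\<in>S. c i \<noteq> 0 \<Longrightarrow> g c = (\<Prod>i\<in>S. c i powi a i)"
    using assms(2) unfolding laurent_def by blast
  then show ?thesis using assms(1,3) by (simp add: power_int_not_zero)
qed

lemma laurent_compose:
  assumes "finite S" "laurent W g" "\<And>w. w \<in> W \<Longrightarrow> laurent S (\<lambda>c. h c w)"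
  shows "laurent S (\<lambda>c. g (h c))"
proof -
  obtain a where a: "\<And>c. \<forall>w\<in>W. c w \<noteq> 0 \<Longrightarrow> g c = (\<Prod>w\<in>W. c w powi a w)"
    using assms(2) unfolding laurent_def by blast
  have "laurent S (\<lambda>c. \<Prod>w\<in>W. h c w powi a w)"
    by (intro laurent_prod laurent_powi assms(3))
  then show ?thesis
    by (rule laurent_cong) (use a laurent_nonzero[OF assms(1) assms(3)] in blast)
qed

text \<open>The Euclidean algorithm on the exponents: if \<open>0 < e a \<le> e b\<close>, replacing the coordinate \<open>a\<close> by its
  quotient by the coordinate \<open>b\<close> subtracts \<open>e a\<close> from \<open>e b\<close>. It ends with a single nonzero exponent, the
  gcd.\<close>
lemma euclid_coordinates:
  fixes e :: "'i \<Rightarrow> nat"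
  assumes W: "finite W" and ne: "\<exists>w\<in>W. e w > 0"
  shows "\<exists>w0\<in>W. \<exists>\<Theta> \<Xi> :: ('i \<Rightarrow> 'k::field) \<Rightarrow> ('i \<Rightarrow> 'k).
    (\<forall>w\<in>W. laurent W (\<lambda>c. \<Theta> c w) \<and> laurent W (\<lambda>c. \<Xi> c w)) \<and>
    (\<forall>c. (\<forall>w\<in>W. c w \<noteq> 0) \<longrightarrow> (\<forall>w\<in>W. \<Theta> (\<Xi> c) w = c w \<and> \<Xi> (\<Theta> c) w = c w) \<and>
      (\<Prod>w\<in>W. \<Theta> c w ^ e w) = c w0 ^ Gcd (e ` W))"
  using ne
proof (induction "\<Sum>w\<in>W. e w" arbitrary: e rule: less_induct)
  case less
  show ?case
  proof (cases "\<exists>a\<in>W. \<exists>b\<in>W. a \<noteq> b \<and> 0 < e a \<and> e a \<le> e b")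
    case False
    obtain w0 where w0: "w0 \<in> W" "e w0 > 0" using less.prems by blast
    have z: "e w = 0" if "w \<in> W" "w \<noteq> w0" for w
    proof (rule ccontr)
      assume "e w \<noteq> 0"
      then show False using False w0 that by (metis gr0I nat_le_linear)
    qed
    have "e ` W = insert (e w0) (e ` (W - {w0}))" using w0 by auto
    then have "Gcd (e ` W) = gcd (e w0) (Gcd (e ` (W - {w0})))" by simp
    also have "Gcd (e ` (W - {w0})) = 0" using z by (auto simp: Gcd_0_iff)
    finally have G: "Gcd (e ` W) = e w0" by simp
    have "(\<Prod>w\<in>W. c w ^ e w) = c w0 ^ e w0" for c :: "'i \<Rightarrow> 'k"
    proof -
      have "(\<Prod>w\<in>W. c w ^ e w) = (\<Prod>w\<in>W. if w = w0 then c w0 ^ e w0 else 1)"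
        using z by (intro prod.cong) auto
      then show ?thesis using W w0 by simp
    qed
    then show ?thesis
      using w0(1) W G by (intro bexI[of _ w0] exI[of _ "\<lambda>c. c"]) (auto intro: laurent_coord)
  next
    case True
    then obtain a b where ab: "a \<in> W" "b \<in> W" "a \<noteq> b" "0 < e a" "e a \<le> e b" by blast
    define e' where "e' = e(b := e b - e a)"
    have e'a: "e' a = e a" "e' b = e b - e a" using ab by (simp_all add: e'_def)
    have "(\<Sum>w\<in>W. e' w) < (\<Sum>w\<in>W. e w)"
      using ab W by (intro sum_strict_mono_ex1) (auto simp: e'_def)
    moreover have "\<exists>w\<in>W. e' w > 0" using ab e'a by (intro bexI[of _ a]) auto
    ultimately obtain w0 \<Theta> \<Xi> where IH: "w0 \<in> W"
      "\<And>w. w \<in> W \<Longrightarrow> laurent W (\<lambda>c::'i \<Rightarrow> 'k. \<Theta> c w)" "\<And>w. w \<in> W \<Longrightarrow> laurent W (\<lambda>c. \<Xi> c w)"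
      "\<And>c w. \<forall>w\<in>W. c w \<noteq> 0 \<Longrightarrow> w \<in> W \<Longrightarrow> \<Theta> (\<Xi> c) w = c w"
      "\<And>c w. \<forall>w\<in>W. c w \<noteq> 0 \<Longrightarrow> w \<in> W \<Longrightarrow> \<Xi> (\<Theta> c) w = c w"
      "\<And>c. \<forall>w\<in>W. c w \<noteq> 0 \<Longrightarrow> (\<Prod>w\<in>W. \<Theta> c w ^ e' w) = c w0 ^ Gcd (e' ` W)"
      using less.hyps[of e'] by (elim impE bexE exE conjE) (simp, blast)
    have Gdvd: "d dvd Gcd (e' ` W) \<longleftrightarrow> d dvd Gcd (e ` W)" for d
    proof -
      have "(\<forall>w\<in>W. d dvd e' w) \<longleftrightarrow> (\<forall>w\<in>W. d dvd e w)"
      proof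
        assume d: "\<forall>w\<in>W. d dvd e' w"
        have "d dvd e a" "d dvd e b - e a" using d ab e'a by (metis, metis)
        then have "d dvd e b" using ab(5) by (metis dvd_diffD)
        then show "\<forall>w\<in>W. d dvd e w" using d by (metis e'_def fun_upd_other)
      next
        assume "\<forall>w\<in>W. d dvd e w"
        then show "\<forall>w\<in>W. d dvd e' w" using ab by (auto simp: e'_def intro: dvd_diff_nat)
      qed
      then show ?thesis by (simp add: dvd_Gcd_iff)
    qed
    have G: "Gcd (e' ` W) = Gcd (e ` W)"
    proof (rule dvd_antisym)
      show "Gcd (e' ` W) dvd Gcd (e ` W)" using Gdvd[of "Gcd (e' ` W)"] by (simp only: dvd_refl)
      show "Gcd (e ` W) dvd Gcd (e' ` W)" using Gdvd[of "Gcd (e ` W)"] by (simp only: dvd_refl)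
    qed
    define E where "E = (\<lambda>c::'i \<Rightarrow> 'k. c(a := c a / c b))"
    define F where "F = (\<lambda>c::'i \<Rightarrow> 'k. c(a := c a * c b))"
    have lE: "laurent W (\<lambda>c. E c w)" if "w \<in> W" for w
    proof (cases "w = a")
      case True
      have "laurent W (\<lambda>c::'i \<Rightarrow> 'k. c a * c b powi (-1))"
        using ab W by (intro laurent_mult laurent_powi laurent_coord)
      then show ?thesis using True by (simp add: E_def field_class.field_divide_inverse power_int_minus)
    next
      case False
      then show ?thesis using laurent_coord[OF W that] by (simp add: E_def)
    qed
    have lF: "laurent W (\<lambda>c. F c w)" if "w \<in> W" for w
    proof (cases "w = a")
      case True
      have "laurent W (\<lambda>c::'i \<Rightarrow> 'k. c a * c b)"
        using ab W by (intro laurent_mult laurent_coord)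
      then show ?thesis using True by (simp add: F_def)
    next
      case False
      then show ?thesis using laurent_coord[OF W that] by (simp add: F_def)
    qed
    have EF: "E (F c) = c" "F (E c) = c" if "\<forall>w\<in>W. c w \<noteq> 0" for c
      using that ab by (auto simp: E_def F_def fun_eq_iff)
    have nzF: "\<forall>w\<in>W. F c w \<noteq> 0" if "\<forall>w\<in>W. c w \<noteq> 0" for c
      using laurent_nonzero[OF W lF] that by blast
    have nzT: "\<forall>w\<in>W. \<Theta> c w \<noteq> 0" if "\<forall>w\<in>W. c w \<noteq> 0" for c
      using laurent_nonzero[OF W IH(2)] that by blast
    have E_eq: "(\<Prod>w\<in>W. E c w ^ e w) = (\<Prod>w\<in>W. c w ^ e' w)" if "\<forall>w\<in>W. c w \<noteq> 0" for c
    proof -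
      have W': "W = insert a (insert b (W - {a, b}))" using ab by auto
      have rest: "(\<Prod>w\<in>W - {a, b}. E c w ^ e w) = (\<Prod>w\<in>W - {a, b}. c w ^ e' w)"
        by (rule prod.cong) (auto simp: E_def e'_def)
      have cb: "c b \<noteq> 0" using that ab by simp
      have "c b ^ e b = c b ^ e a * c b ^ (e b - e a)" using ab(5) by (simp flip: power_add)
      then have "(c a / c b) ^ e a * c b ^ e b = c a ^ e a * c b ^ (e b - e a)"
        using cb by (simp add: power_divide)
      then have "E c a ^ e a * E c b ^ e b = c a ^ e' a * c b ^ e' b"
        using ab(3) by (simp add: E_def e'_def)
      then show ?thesis
        using W ab(3) rest by (subst (1 2) W') (simp add: mult.assoc[symmetric])
    qed
    have E\<Theta>: "laurent W (\<lambda>c. E (\<Theta> c) w)" if "w \<in> W" for w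
      by (rule laurent_compose[where h = \<Theta> and W = W]) (use W lE[OF that] IH(2) in auto)
    have \<Xi>F: "laurent W (\<lambda>c. \<Xi> (F c) w)" if "w \<in> W" for w
      by (rule laurent_compose[where h = F and W = W]) (use W lF IH(3)[OF that] in auto)
    have E_cong: "E c w = E d w" if "\<And>w. w \<in> W \<Longrightarrow> c w = d w" "w \<in> W" for c d w
      using that ab by (auto simp: E_def)
    show ?thesis
    proof (rule bexI[OF _ IH(1)], rule exI[of _ "\<lambda>c. E (\<Theta> c)"], rule exI[of _ "\<lambda>c. \<Xi> (F c)"],
        intro conjI ballI allI impI)
      fix w assume w: "w \<in> W"
      show "laurent W (\<lambda>c. E (\<Theta> c) w)" "laurent W (\<lambda>c. \<Xi> (F c) w)"
        using E\<Theta>[OF w] \<Xi>F[OF w] by auto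
    next
      fix c :: "'i \<Rightarrow> 'k" and w assume c: "\<forall>w\<in>W. c w \<noteq> 0" and w: "w \<in> W"
      have "E (\<Theta> (\<Xi> (F c))) w = E (F c) w"
        by (rule E_cong[OF _ w]) (rule IH(4)[OF nzF[OF c]])
      then show "E (\<Theta> (\<Xi> (F c))) w = c w" using EF(1)[OF c] by simp
      show "\<Xi> (F (E (\<Theta> c))) w = c w" unfolding EF(2)[OF nzT[OF c]] by (rule IH(5)[OF c w])
    next
      fix c :: "'i \<Rightarrow> 'k" assume c: "\<forall>w\<in>W. c w \<noteq> 0"
      show "(\<Prod>w\<in>W. E (\<Theta> c) w ^ e w) = c w0 ^ Gcd (e ` W)"
        unfolding E_eq[OF nzT[OF c]] IH(6)[OF c] G ..
    qed
  qed
qed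

lemma three_term_bezout:
  fixes d :: "nat \<Rightarrow> nat"
  assumes "coprime (d 0) (d 1)" "coprime (d 0) (d 2)" "coprime (d 1) (d 2)"
  shows "\<exists>\<alpha> \<beta> \<gamma>. \<alpha> * int (d 1 * d 2) + \<beta> * int (d 0 * d 2) + \<gamma> * int (d 0 * d 1) = 1"
proof -
  obtain x y where xy: "x * int (d 0) + y * int (d 1) = 1"
    using bezout_int[of "int (d 0)" "int (d 1)"] assms(1) by (auto simp: coprime_iff_gcd_eq_1)
  have "coprime (int (d 2)) (int (d 0 * d 1))"
    using assms by (simp add: coprime_commute)
  then obtain z w where zw: "z * int (d 2) + w * int (d 0 * d 1) = 1"
    using bezout_int[of "int (d 2)" "int (d 0 * d 1)"] by (auto simp: coprime_iff_gcd_eq_1)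
  have "(z * y) * int (d 1 * d 2) + (z * x) * int (d 0 * d 2) + w * int (d 0 * d 1) =
      z * int (d 2) * (x * int (d 0) + y * int (d 1)) + w * int (d 0 * d 1)"
    by (simp add: algebra_simps)
  also have "\<dots> = 1" unfolding xy using zw by simp
  finally show ?thesis by blast
qed

context trinomial_hypersurface
begin

text \<open>The diagonal torus: the elements that multiply the three monomials of the trinomial by the same
  factor.\<close>
definition Tset :: "('v \<Rightarrow> 'k) set"
  where "Tset = {c \<in> V \<rightarrow>\<^sub>E UNIV - {0}. \<exists>d. \<forall>i<3. (\<Prod>v\<in>Vs i. c v ^ l v) = d}"

text \<open>After a change of coordinates in each group the equations of the torus become
  \<open>u\<^sub>0\<^sup>a = u\<^sub>1\<^sup>b = u\<^sub>2\<^sup>c\<close> with the pairwise coprime gcds \<open>a\<close>, \<open>b\<close>, \<open>c\<close> as exponents. The solutions are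
  parametrized bijectively by \<open>s \<mapsto> (s\<^sup>b\<^sup>c, s\<^sup>a\<^sup>c, s\<^sup>a\<^sup>b)\<close>; the inverse is a Laurent monomial with Bezout
  coefficients of \<open>bc\<close>, \<open>ac\<close>, \<open>ab\<close> as exponents.\<close>
lemma torus_parametrization:
  "\<exists>(s::nat) \<Theta>. (\<forall>v\<in>V. laurent {..<s} (\<lambda>t. \<Theta> t v)) \<and>
     bij_betw (\<lambda>t. \<lambda>v\<in>V. \<Theta> t v) ({..<s} \<rightarrow>\<^sub>E UNIV - {0}) Tset"
proof -
  let ?d = "\<lambda>i. Gcd (l ` Vs i)"
  have Vi: "Vs i \<subseteq> V" if "i < 3" for i using Vs_V[OF that] by auto
  have "\<forall>i. \<exists>w0 \<Theta> \<Xi>. i < 3 \<longrightarrow> w0 \<in> Vs i \<and>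
    (\<forall>w\<in>Vs i. laurent (Vs i) (\<lambda>c::'v \<Rightarrow> 'k. \<Theta> c w) \<and> laurent (Vs i) (\<lambda>c::'v \<Rightarrow> 'k. \<Xi> c w)) \<and>
    (\<forall>c. (\<forall>w\<in>Vs i. c w \<noteq> 0) \<longrightarrow> (\<forall>w\<in>Vs i. \<Theta> (\<Xi> c) w = c w \<and> \<Xi> (\<Theta> c) w = c w) \<and>
      (\<Prod>w\<in>Vs i. \<Theta> c w ^ l w) = c w0 ^ ?d i)"
  proof
    fix i
    show "\<exists>w0 \<Theta> \<Xi>. i < 3 \<longrightarrow> w0 \<in> Vs i \<and>
    (\<forall>w\<in>Vs i. laurent (Vs i) (\<lambda>c::'v \<Rightarrow> 'k. \<Theta> c w) \<and> laurent (Vs i) (\<lambda>c::'v \<Rightarrow> 'k. \<Xi> c w)) \<and>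
    (\<forall>c. (\<forall>w\<in>Vs i. c w \<noteq> 0) \<longrightarrow> (\<forall>w\<in>Vs i. \<Theta> (\<Xi> c) w = c w \<and> \<Xi> (\<Theta> c) w = c w) \<and>
      (\<Prod>w\<in>Vs i. \<Theta> c w ^ l w) = c w0 ^ ?d i)"
    proof (cases "i < 3")
      case True
      have "\<exists>w\<in>Vs i. l w > 0" using Vs_nonempty[OF True] l_ge_2[OF True] by fastforce
      from euclid_coordinates[OF finite_Vs[OF True] this] show ?thesis by blast
    qed simp
  qed
  then obtain w \<Theta> \<Xi> where
    "\<forall>i. i < 3 \<longrightarrow> w i \<in> Vs i \<and>
    (\<forall>u\<in>Vs i. laurent (Vs i) (\<lambda>c::'v \<Rightarrow> 'k. \<Theta> i c u) \<and> laurent (Vs i) (\<lambda>c::'v \<Rightarrow> 'k. \<Xi> i c u)) \<and>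
    (\<forall>c. (\<forall>u\<in>Vs i. c u \<noteq> 0) \<longrightarrow> (\<forall>u\<in>Vs i. \<Theta> i (\<Xi> i c) u = c u \<and> \<Xi> i (\<Theta> i c) u = c u) \<and>
      (\<Prod>u\<in>Vs i. \<Theta> i c u ^ l u) = c (w i) ^ ?d i)"
    by (elim choice[THEN exE]) blast
  then have w: "\<And>i. i < 3 \<Longrightarrow> w i \<in> Vs i"
    and lT: "\<And>i u. i < 3 \<Longrightarrow> u \<in> Vs i \<Longrightarrow> laurent (Vs i) (\<lambda>c. \<Theta> i c u)"
    and lX: "\<And>i u. i < 3 \<Longrightarrow> u \<in> Vs i \<Longrightarrow> laurent (Vs i) (\<lambda>c. \<Xi> i c u)"
    and TX: "\<And>i c u. i < 3 \<Longrightarrow> \<forall>u\<in>Vs i. c u \<noteq> 0 \<Longrightarrow> u \<in> Vs i \<Longrightarrow> \<Theta> i (\<Xi> i c) u = c u"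
    and XT: "\<And>i c u. i < 3 \<Longrightarrow> \<forall>u\<in>Vs i. c u \<noteq> 0 \<Longrightarrow> u \<in> Vs i \<Longrightarrow> \<Xi> i (\<Theta> i c) u = c u"
    and Tprod: "\<And>i c. i < 3 \<Longrightarrow> \<forall>u\<in>Vs i. c u \<noteq> 0 \<Longrightarrow> (\<Prod>u\<in>Vs i. \<Theta> i c u ^ l u) = c (w i) ^ ?d i"
    by blast+
  have l_cong: "\<Theta> i c u = \<Theta> i c' u" "\<Xi> i c u = \<Xi> i c' u"
    if "i < 3" "u \<in> Vs i" "\<forall>u\<in>Vs i. c u \<noteq> 0" "\<And>u. u \<in> Vs i \<Longrightarrow> c' u = c u" for i u c c'
  proof -
    have "g c = g c'" if "laurent (Vs i) g" for g :: "('v \<Rightarrow> 'k) \<Rightarrow> 'k"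
    proof -
      obtain a where a: "\<And>c. \<forall>i\<in>Vs i. c i \<noteq> 0 \<Longrightarrow> g c = (\<Prod>i\<in>Vs i. c i powi a i)"
        using \<open>laurent (Vs i) g\<close> unfolding laurent_def by blast
      have "\<forall>u\<in>Vs i. c' u \<noteq> 0" using \<open>\<forall>u\<in>Vs i. c u \<noteq> 0\<close> \<open>\<And>u. u \<in> Vs i \<Longrightarrow> c' u = c u\<close> by simp
      then show ?thesis using a \<open>\<forall>u\<in>Vs i. c u \<noteq> 0\<close> \<open>\<And>u. u \<in> Vs i \<Longrightarrow> c' u = c u\<close> by simp
    qed
    then show "\<Theta> i c u = \<Theta> i c' u" "\<Xi> i c u = \<Xi> i c' u" using lT lX that by blast+
  qed
  define Dp where "Dp i = (\<Prod>j\<in>{..<3} - {i}. ?d j)" for i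
  have Dp3: "Dp i = ?d j * ?d k" if "i < 3" "j < 3" "k < 3" "distinct [i, j, k]" for i j k
  proof -
    have "{..<3} - {i} = {j, k}" using that by auto
    then show ?thesis unfolding Dp_def using that by simp
  qed
  have "\<exists>\<alpha> \<beta> \<gamma>. \<alpha> * int (?d 1 * ?d 2) + \<beta> * int (?d 0 * ?d 2) + \<gamma> * int (?d 0 * ?d 1) = 1"
    by (rule three_term_bezout[of ?d]) (intro coprime_Gcd; simp)+
  then obtain \<alpha>0 \<alpha>1 \<alpha>2 where "\<alpha>0 * int (Dp 0) + \<alpha>1 * int (Dp 1) + \<alpha>2 * int (Dp 2) = 1"
    using Dp3[of 0 1 2] Dp3[of 1 0 2] Dp3[of 2 0 1] by auto
  then obtain \<alpha> where al: "(\<Sum>i<3. \<alpha> i * int (Dp i)) = 1"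
    by (intro that[of "\<lambda>i. if i = 0 then \<alpha>0 else if i = 1 then \<alpha>1 else \<alpha>2"])
      (simp add: numeral_3_eq_3 numeral_2_eq_2)
  have wV: "w i \<in> V" if "i < 3" for i using w[OF that] Vi[OF that] by auto
  have wne: "w i \<noteq> w j" if "i < 3" "j < 3" "i \<noteq> j" for i j
    using w[OF that(1)] w[OF that(2)] Vs_disjoint[OF that] by auto
  define J where "J = V - {w 1, w 2}"
  have fJ: "finite J" unfolding J_def by simp
  have w0J: "w 0 \<in> J" unfolding J_def using wV[of 0] wne[of 0 1] wne[of 0 2] by simp
  \<comment> \<open>The slot of the distinguished variable \<open>w 0\<close> carries the common parameter \<open>s\<close>; the slots of \<open>w 1\<close>
     and \<open>w 2\<close> are dropped.\<close>
  define ins where "ins t v = (if v = w (idx v) then t (w 0) ^ Dp (idx v) else t v)" for t :: "'v \<Rightarrow> 'k" and v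
  define F where "F t v = \<Theta> (idx v) (ins t) v" for t v
  define R where "R c v = (if v = w 0 then (\<Prod>i<3. \<Xi> i c (w i) powi \<alpha> i) else \<Xi> (idx v) c v)" for c v
  have idxw: "idx (w i) = i" if "i < 3" for i using idx_eq[OF that w[OF that]] .
  have ins_l: "laurent J (\<lambda>t. ins t v)" if v: "v \<in> V" for v
  proof (cases "v = w (idx v)")
    case True
    have "laurent J (\<lambda>t. t (w 0) ^ Dp (idx v))" by (intro laurent_power laurent_coord fJ w0J)
    then show ?thesis unfolding ins_def by (rule laurent_cong) (use True in simp)
  next
    case False
    then have "v \<noteq> w 1" "v \<noteq> w 2" using idxw[of 1] idxw[of 2] by auto
    then have "v \<in> J" using v unfolding J_def by simp
    then have "laurent J (\<lambda>t. t v)" by (intro laurent_coord fJ)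
    then show ?thesis unfolding ins_def by (rule laurent_cong) (use False in simp)
  qed
  have F_l: "laurent J (\<lambda>t. F t v)" if v: "v \<in> V" for v
    unfolding F_def
    by (rule laurent_compose[where W = "Vs (idx v)" and h = ins])
       (use lT[OF idx_less[OF v] idx_mem[OF v]] Vi[OF idx_less[OF v]] fJ ins_l in auto)
  have nz_ins: "ins t v \<noteq> 0" if "\<forall>j\<in>J. t j \<noteq> 0" "v \<in> V" for t v
    using laurent_nonzero[OF fJ ins_l] that by blast
  have nz_F: "F t v \<noteq> 0" if "\<forall>j\<in>J. t j \<noteq> 0" "v \<in> V" for t v
    using laurent_nonzero[OF fJ F_l] that by blast
  have nz_X: "\<Xi> i c u \<noteq> 0" if "\<forall>v\<in>V. c v \<noteq> 0" "i < 3" "u \<in> Vs i" for i c u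
    using laurent_nonzero[OF finite_Vs[OF that(2)] lX[OF that(2,3)]] that Vi[OF that(2)] by blast
  have F_group: "F t v = \<Theta> i (ins t) v" if "i < 3" "v \<in> Vs i" for t i v
    unfolding F_def idx_eq[OF that] ..
  have Fprod: "(\<Prod>v\<in>Vs i. F t v ^ l v) = t (w 0) ^ (\<Prod>j<3. ?d j)" if t: "\<forall>j\<in>J. t j \<noteq> 0" and i: "i < 3" for t i
  proof -
    have "(\<Prod>v\<in>Vs i. F t v ^ l v) = (\<Prod>v\<in>Vs i. \<Theta> i (ins t) v ^ l v)"
      using F_group[OF i] by (intro prod.cong) auto
    also have "\<dots> = ins t (w i) ^ ?d i"
      using nz_ins[OF t] Vi[OF i] by (intro Tprod[OF i]) auto
    also have "\<dots> = t (w 0) ^ (Dp i * ?d i)"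
      unfolding ins_def idxw[OF i] by (simp add: power_mult)
    also have "Dp i * ?d i = (\<Prod>j<3. ?d j)"
      unfolding Dp_def using i by (simp add: prod.remove[of "{..<3}" i])
    finally show ?thesis .
  qed
  have \<Xi>F: "\<Xi> i (F t) u = ins t u" if t: "\<forall>j\<in>J. t j \<noteq> 0" and iu: "i < 3" "u \<in> Vs i" for t i u
  proof -
    have nz: "\<forall>u\<in>Vs i. ins t u \<noteq> 0" using nz_ins[OF t] Vi[OF iu(1)] by auto
    have "\<Xi> i (F t) u = \<Xi> i (\<Theta> i (ins t)) u"
    proof (rule l_cong(2)[OF iu])
      show "\<forall>u\<in>Vs i. F t u \<noteq> 0" using nz_F[OF t] Vi[OF iu(1)] by blast
      show "\<Theta> i (ins t) v = F t v" if "v \<in> Vs i" for v using F_group[OF iu(1) that] by simp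
    qed
    also have "\<dots> = ins t u" by (rule XT[OF iu(1) nz iu(2)])
    finally show ?thesis .
  qed
  have RF: "R (F t) v = t v" if t: "\<forall>j\<in>J. t j \<noteq> 0" and v: "v \<in> J" for t v
  proof (cases "v = w 0")
    case True
    have tw: "t (w 0) \<noteq> 0" using t w0J by blast
    have "R (F t) v = (\<Prod>i<3. \<Xi> i (F t) (w i) powi \<alpha> i)" unfolding R_def using True by simp
    also have "\<dots> = (\<Prod>i<3. t (w 0) powi (\<alpha> i * int (Dp i)))"
    proof (rule prod.cong[OF refl])
      fix i :: nat assume "i \<in> {..<3}"
      then have i: "i < 3" by simp
      have "\<Xi> i (F t) (w i) = t (w 0) ^ Dp i"
        unfolding \<Xi>F[OF t i w[OF i]] ins_def idxw[OF i] by simp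
      then show "\<Xi> i (F t) (w i) powi \<alpha> i = t (w 0) powi (\<alpha> i * int (Dp i))"
        by (simp add: mult.commute[of "\<alpha> i"] power_int_mult)
    qed
    also have "\<dots> = t (w 0) powi (\<Sum>i<3. \<alpha> i * int (Dp i))"
      using prod_power_int[OF tw, of "\<lambda>i. \<alpha> i * int (Dp i)" "{..<3::nat}"] by simp
    finally show ?thesis unfolding al using True by simp
  next
    case False
    have vV: "v \<in> V" using v unfolding J_def by simp
    have "v \<noteq> w (idx v)"
    proof
      assume eq: "v = w (idx v)"
      have "idx v = 0 \<or> idx v = 1 \<or> idx v = 2" using idx_less[OF vV] by auto
      then show False using eq False v unfolding J_def by auto
    qed
    then show ?thesis
      unfolding R_def using False \<Xi>F[OF t idx_less[OF vV] idx_mem[OF vV]] by (simp add: ins_def)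
  qed
  have nz_R: "\<forall>j\<in>J. R c j \<noteq> 0" if c: "\<forall>v\<in>V. c v \<noteq> 0" for c
  proof
    fix j assume j: "j \<in> J"
    then have jV: "j \<in> V" unfolding J_def by simp
    have "(\<Prod>i<3. \<Xi> i c (w i) powi \<alpha> i) \<noteq> 0"
      using nz_X[OF c _ w] by (simp add: power_int_not_zero)
    then show "R c j \<noteq> 0" unfolding R_def using nz_X[OF c idx_less[OF jV] idx_mem[OF jV]] by simp
  qed
  have FR: "F (R c) v = c v"
    if c: "\<forall>v\<in>V. c v \<noteq> 0" and d: "\<forall>i<3. (\<Prod>v\<in>Vs i. c v ^ l v) = d" and v: "v \<in> V" for c d v
  proof -
    define u where "u i = \<Xi> i c (w i)" for i
    have unz: "u i \<noteq> 0" if "i < 3" for i unfolding u_def by (rule nz_X[OF c that w[OF that]])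
    have ud: "u i ^ ?d i = d" if i: "i < 3" for i
    proof -
      have ci: "\<forall>v\<in>Vs i. c v \<noteq> 0" using c Vi[OF i] by auto
      have "u i ^ ?d i = (\<Prod>v\<in>Vs i. \<Theta> i (\<Xi> i c) v ^ l v)"
        unfolding u_def using nz_X[OF c i] by (intro Tprod[OF i, symmetric]) auto
      also have "\<dots> = (\<Prod>v\<in>Vs i. c v ^ l v)"
        using TX[OF i ci] by (intro prod.cong) auto
      finally show ?thesis using d i by simp
    qed
    have swap: "u j ^ Dp i = u i ^ Dp j" if ij: "i < 3" "j < 3" for i j
    proof (cases "i = j")
      case False
      obtain k where k: "k < 3" "distinct [i, j, k]" using third_index[OF ij False] by blast
      have "u j ^ Dp i = (u j ^ ?d j) ^ ?d k"
        using Dp3[OF ij k] by (simp add: power_mult)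
      also have "\<dots> = (u i ^ ?d i) ^ ?d k" using ud ij by simp
      also have "\<dots> = u i ^ Dp j"
        using Dp3[of j i k] ij k by (simp add: power_mult)
      finally show ?thesis .
    qed simp
    define s where "s = (\<Prod>i<3. u i powi \<alpha> i)"
    have sD: "s ^ Dp i = u i" if i: "i < 3" for i
    proof -
      have "s ^ Dp i = (\<Prod>j<3. (u j powi \<alpha> j) ^ Dp i)"
        unfolding s_def by (rule prod_power_distrib)
      also have "\<dots> = (\<Prod>j<3. u i powi (\<alpha> j * int (Dp j)))"
      proof (rule prod.cong[OF refl])
        fix j :: nat assume "j \<in> {..<3}"
        then have j: "j < 3" by simp
        have "(u j powi \<alpha> j) ^ Dp i = (u j ^ Dp i) powi \<alpha> j"
          by (metis mult.commute power_int_mult power_int_of_nat)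
        also have "\<dots> = (u i ^ Dp j) powi \<alpha> j" unfolding swap[OF i j] ..
        also have "\<dots> = u i powi (\<alpha> j * int (Dp j))"
          by (metis mult.commute power_int_mult power_int_of_nat)
        finally show "(u j powi \<alpha> j) ^ Dp i = u i powi (\<alpha> j * int (Dp j))" .
      qed
      also have "\<dots> = u i powi (\<Sum>j<3. \<alpha> j * int (Dp j))"
        using prod_power_int[OF unz[OF i], of "\<lambda>i. \<alpha> i * int (Dp i)" "{..<3::nat}"] by simp
      finally show ?thesis unfolding al by simp
    qed
    have Rw: "R c (w 0) = s" unfolding R_def s_def u_def by simp
    have insR: "ins (R c) x = \<Xi> i c x" if ix: "i < 3" "x \<in> Vs i" for i x
    proof (cases "x = w i")
      case True
      then show ?thesis
        unfolding ins_def idx_eq[OF ix] Rw using sD[OF ix(1)] by (simp add: u_def)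
    next
      case False
      have "x \<noteq> w 0" using False ix idxw[of 0] idx_eq[OF ix] by auto
      then show ?thesis unfolding ins_def idx_eq[OF ix] R_def using False by simp
    qed
    let ?i = "idx v"
    have i: "?i < 3" "v \<in> Vs ?i" using idx_less[OF v] idx_mem[OF v] by auto
    have ci: "\<forall>v\<in>Vs ?i. c v \<noteq> 0" using c Vi[OF i(1)] by auto
    have "F (R c) v = \<Theta> ?i (ins (R c)) v" unfolding F_def ..
    also have "\<dots> = \<Theta> ?i (\<Xi> ?i c) v"
      using insR[OF i(1)] nz_X[OF c i(1)] by (intro l_cong(1)[OF i]) auto
    also have "\<dots> = c v" by (rule TX[OF i(1) ci i(2)])
    finally show ?thesis .
  qed
  obtain \<beta> where \<beta>: "bij_betw \<beta> J {..<card J}" using ex_bij_betw_finite_nat[OF fJ] by (metis atLeast0LessThan)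
  define s where "s = card J"
  define F' where "F' t v = F (\<lambda>j. t (\<beta> j)) v" for t :: "nat \<Rightarrow> 'k" and v
  have b1: "\<beta> j < s" if "j \<in> J" for j using \<beta> that unfolding bij_betw_def s_def by auto
  define \<gamma> where "\<gamma> = inv_into J \<beta>"
  have g1: "\<gamma> k \<in> J" "\<beta> (\<gamma> k) = k" if "k < s" for k
    using bij_betw_inv_into_right[OF \<beta>] bij_betwE[OF bij_betw_inv_into[OF \<beta>]] that unfolding \<gamma>_def s_def by auto
  have g2: "\<gamma> (\<beta> j) = j" if "j \<in> J" for j
    using bij_betw_inv_into_left[OF \<beta> that] unfolding \<gamma>_def .
  have F'_l: "laurent {..<s} (\<lambda>t. F' t v)" if v: "v \<in> V" for v
    unfolding F'_def
    by (rule laurent_compose[where W = J and h = "\<lambda>t j. t (\<beta> j)"])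
       (use F_l[OF v] b1 in \<open>auto intro: laurent_coord\<close>)
  have "bij_betw (\<lambda>t. \<lambda>v\<in>V. F' t v) ({..<s} \<rightarrow>\<^sub>E UNIV - {0}) Tset"
  proof (rule bij_betw_byWitness[where f' = "\<lambda>c. \<lambda>k\<in>{..<s}. R c (\<gamma> k)"])
    have F_V: "\<Xi> i (\<lambda>v\<in>V. F t v) u = \<Xi> i (F t) u" if "\<forall>j\<in>J. t j \<noteq> 0" "i < 3" "u \<in> Vs i" for t i u
      using l_cong(2)[OF that(2,3), of "F t" "\<lambda>v\<in>V. F t v"] nz_F[OF that(1)] Vi[OF that(2)] by (auto simp: subset_iff)
    have R_V: "R (\<lambda>v\<in>V. F t v) j = R (F t) j" if t: "\<forall>j\<in>J. t j \<noteq> 0" and j: "j \<in> J" for t j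
    proof -
      have "(\<Prod>i<3. \<Xi> i (\<lambda>v\<in>V. F t v) (w i) powi \<alpha> i) = (\<Prod>i<3. \<Xi> i (F t) (w i) powi \<alpha> i)"
        using F_V[OF t _ w] by (intro prod.cong) auto
      moreover have jV: "j \<in> V" using j unfolding J_def by simp
      moreover have "\<Xi> (idx j) (\<lambda>v\<in>V. F t v) j = \<Xi> (idx j) (F t) j"
        by (rule F_V[OF t idx_less[OF jV] idx_mem[OF jV]])
      ultimately show ?thesis unfolding R_def by simp
    qed
    show "\<forall>t\<in>{..<s} \<rightarrow>\<^sub>E UNIV - {0}. (\<lambda>k\<in>{..<s}. R (\<lambda>v\<in>V. F' t v) (\<gamma> k)) = t"
    proof
      fix t :: "nat \<Rightarrow> 'k" assume t: "t \<in> {..<s} \<rightarrow>\<^sub>E UNIV - {0}"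
      have nz: "\<forall>j\<in>J. t (\<beta> j) \<noteq> 0" using t b1 by (auto simp: PiE_iff)
      show "(\<lambda>k\<in>{..<s}. R (\<lambda>v\<in>V. F' t v) (\<gamma> k)) = t"
      proof
        fix k
        show "(\<lambda>k\<in>{..<s}. R (\<lambda>v\<in>V. F' t v) (\<gamma> k)) k = t k"
        proof (cases "k < s")
          case True
          then show ?thesis
            unfolding F'_def using R_V[OF nz g1(1)] RF[OF nz g1(1)] g1(2) by simp
        next
          case False
          then show ?thesis using t by (auto simp: PiE_iff extensional_def)
        qed
      qed
    qed
    show "\<forall>c\<in>Tset. (\<lambda>v\<in>V. F' (\<lambda>k\<in>{..<s}. R c (\<gamma> k)) v) = c"
    proof
      fix c assume c: "c \<in> Tset"
      then obtain d where cV: "c \<in> V \<rightarrow>\<^sub>E UNIV - {0}" and d: "\<forall>i<3. (\<Prod>v\<in>Vs i. c v ^ l v) = d"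
        unfolding Tset_def by blast
      have nz: "\<forall>v\<in>V. c v \<noteq> 0" using cV by (auto simp: PiE_iff)
      show "(\<lambda>v\<in>V. F' (\<lambda>k\<in>{..<s}. R c (\<gamma> k)) v) = c"
      proof
        fix v
        show "(\<lambda>v\<in>V. F' (\<lambda>k\<in>{..<s}. R c (\<gamma> k)) v) v = c v"
        proof (cases "v \<in> V")
          case True
          let ?t = "\<lambda>j. (\<lambda>k\<in>{..<s}. R c (\<gamma> k)) (\<beta> j)"
          have tj: "?t j = R c j" if "j \<in> J" for j using that b1 g2 by simp
          have "laurent J (\<lambda>t. F t v)" by (rule F_l[OF True])
          then obtain a where a: "\<And>t. \<forall>j\<in>J. t j \<noteq> 0 \<Longrightarrow> F t v = (\<Prod>j\<in>J. t j powi a j)"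
            unfolding laurent_def by blast
          have "F ?t v = (\<Prod>j\<in>J. ?t j powi a j)" by (rule a) (use tj nz_R[OF nz] in simp)
          also have "\<dots> = (\<Prod>j\<in>J. R c j powi a j)" by (rule prod.cong) (simp_all only: tj)
          also have "\<dots> = F (R c) v" by (rule a[symmetric]) (rule nz_R[OF nz])
          finally have "F ?t v = F (R c) v" .
          then show ?thesis using FR[OF nz d True] True unfolding F'_def by simp
        next
          case False
          then show ?thesis using cV by (auto simp: PiE_iff extensional_def)
        qed
      qed
    qed
    show "(\<lambda>t. \<lambda>v\<in>V. F' t v) ` ({..<s} \<rightarrow>\<^sub>E UNIV - {0}) \<subseteq> Tset"
    proof
      fix c assume "c \<in> (\<lambda>t. \<lambda>v\<in>V. F' t v) ` ({..<s} \<rightarrow>\<^sub>E UNIV - {0})"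
      then obtain t where t: "t \<in> {..<s} \<rightarrow>\<^sub>E UNIV - {0}" "c = (\<lambda>v\<in>V. F' t v)" by blast
      have nz: "\<forall>j\<in>J. t (\<beta> j) \<noteq> 0" using t(1) b1 by (auto simp: PiE_iff)
      have "(\<Prod>v\<in>Vs i. c v ^ l v) = t (\<beta> (w 0)) ^ (\<Prod>j<3. ?d j)" if i: "i < 3" for i
      proof -
        have "(\<Prod>v\<in>Vs i. c v ^ l v) = (\<Prod>v\<in>Vs i. F (\<lambda>j. t (\<beta> j)) v ^ l v)"
          using Vi[OF i] by (intro prod.cong) (auto simp: t(2) F'_def)
        then show ?thesis using Fprod[OF nz i] by simp
      qed
      moreover have "c \<in> V \<rightarrow>\<^sub>E UNIV - {0}" unfolding t(2) F'_def using nz_F[OF nz] by auto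
      ultimately show "c \<in> Tset" unfolding Tset_def by blast
    qed
    show "(\<lambda>c. \<lambda>k\<in>{..<s}. R c (\<gamma> k)) ` Tset \<subseteq> {..<s} \<rightarrow>\<^sub>E UNIV - {0}"
    proof
      fix t assume "t \<in> (\<lambda>c. \<lambda>k\<in>{..<s}. R c (\<gamma> k)) ` Tset"
      then obtain c where c: "c \<in> Tset" "t = (\<lambda>k\<in>{..<s}. R c (\<gamma> k))" by blast
      have "\<forall>v\<in>V. c v \<noteq> 0" using c(1) unfolding Tset_def by (auto simp: PiE_iff)
      then show "t \<in> {..<s} \<rightarrow>\<^sub>E UNIV - {0}" unfolding c(2) using nz_R g1(1) by auto
    qed
  qed
  then have "(\<forall>v\<in>V. laurent {..<s} (\<lambda>t. F' t v)) \<and>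
      bij_betw (\<lambda>t. \<lambda>v\<in>V. F' t v) ({..<s} \<rightarrow>\<^sub>E UNIV - {0}) Tset"
    by (intro conjI ballI F'_l)
  then show ?thesis by (intro exI)
qed

end

section \<open>Semidirect decompositions\<close>

lemma semidirect_decomposition:
  fixes G :: "('g, 'x) monoid_scheme" (structure) and P :: "('p, 'y) monoid_scheme"
  assumes G: "group G" and P: "group P" and T: "subgroup T G" and h: "h \<in> hom P G"
    and norm: "\<And>p t. p \<in> carrier P \<Longrightarrow> t \<in> T \<Longrightarrow> h p \<otimes> t \<otimes> inv (h p) \<in> T"
    and triv: "\<And>p. p \<in> carrier P \<Longrightarrow> h p \<in> T \<Longrightarrow> p = \<one>\<^bsub>P\<^esub>"
    and gen: "\<And>g. g \<in> carrier G \<Longrightarrow> \<exists>t\<in>T. \<exists>p\<in>carrier P. g = t \<otimes> h p"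
    and \<theta>: "\<theta> = (\<lambda>p. \<lambda>t\<in>T. h p \<otimes> t \<otimes> inv (h p))"
  shows "\<theta> \<in> hom P (AutoGroup (G\<lparr>carrier := T\<rparr>))"
    and "G \<cong> semidirect_product P (G\<lparr>carrier := T\<rparr>) \<theta>"
proof -
  interpret G: group G by (rule G)
  interpret P: group P by (rule P)
  interpret h: group_hom P G h by (intro group_hom.intro group_hom_axioms.intro G P h)
  interpret T: subgroup T G by (rule T)
  have TG [simp]: "t \<in> carrier G" if "t \<in> T" for t using T.subset that by blast
  have hG [simp]: "h p \<in> carrier G" if "p \<in> carrier P" for p using that by (rule h.hom_closed)
  have \<theta>T: "\<theta> p t \<in> T" if "p \<in> carrier P" "t \<in> T" for p t
    using norm[OF that] that(2) by (simp add: \<theta>)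
  have \<theta>_mult: "\<theta> p (s \<otimes> t) = \<theta> p s \<otimes> \<theta> p t" if "p \<in> carrier P" "s \<in> T" "t \<in> T" for p s t
  proof -
    have "inv (h p) \<otimes> (h p \<otimes> (t \<otimes> inv (h p))) = t \<otimes> inv (h p)"
      using that by (simp add: G.m_assoc[symmetric])
    then show ?thesis using that by (simp add: \<theta> G.m_assoc)
  qed
  have \<theta>_comp: "\<theta> (p \<otimes>\<^bsub>P\<^esub> q) t = \<theta> p (\<theta> q t)" if "p \<in> carrier P" "q \<in> carrier P" "t \<in> T" for p q t
    using that \<theta>T[OF that(2,3)] by (simp add: \<theta> G.m_assoc G.inv_mult_group)
  have \<theta>_one: "\<theta> \<one>\<^bsub>P\<^esub> t = t" if "t \<in> T" for t
    using that by (simp add: \<theta>)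
  have \<theta>_Bij: "\<theta> p \<in> Bij T" if p: "p \<in> carrier P" for p
  proof -
    have "bij_betw (\<theta> p) T T"
    proof (rule bij_betw_byWitness[where f' = "\<theta> (inv\<^bsub>P\<^esub> p)"])
      show "\<forall>t\<in>T. \<theta> (inv\<^bsub>P\<^esub> p) (\<theta> p t) = t"
        using \<theta>_comp[of "inv\<^bsub>P\<^esub> p" p] \<theta>_one p by simp
      show "\<forall>t\<in>T. \<theta> p (\<theta> (inv\<^bsub>P\<^esub> p) t) = t"
        using \<theta>_comp[of p "inv\<^bsub>P\<^esub> p"] \<theta>_one p by simp
    qed (use \<theta>T p in auto)
    moreover have "\<theta> p \<in> extensional T" by (simp add: \<theta>)
    ultimately show ?thesis by (simp add: Bij_def)
  qed
  have \<theta>_auto: "\<theta> p \<in> auto (G\<lparr>carrier := T\<rparr>)" if p: "p \<in> carrier P" for p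
    using \<theta>_Bij[OF p] \<theta>T[OF p] \<theta>_mult[OF p] by (auto simp: auto_def hom_def)
  show "\<theta> \<in> hom P (AutoGroup (G\<lparr>carrier := T\<rparr>))"
  proof (rule homI)
    fix p q assume pq: "p \<in> carrier P" "q \<in> carrier P"
    show "\<theta> p \<in> carrier (AutoGroup (G\<lparr>carrier := T\<rparr>))"
      using \<theta>_auto[OF pq(1)] by (simp add: AutoGroup_def)
    have "\<theta> (p \<otimes>\<^bsub>P\<^esub> q) = compose T (\<theta> p) (\<theta> q)"
    proof
      fix t show "\<theta> (p \<otimes>\<^bsub>P\<^esub> q) t = compose T (\<theta> p) (\<theta> q) t"
        using \<theta>_comp[OF pq, of t] by (cases "t \<in> T") (simp_all add: compose_def, simp add: \<theta>)
    qed
    then show "\<theta> (p \<otimes>\<^bsub>P\<^esub> q) = \<theta> p \<otimes>\<^bsub>AutoGroup (G\<lparr>carrier := T\<rparr>)\<^esub> \<theta> q"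
      using \<theta>_Bij pq by (simp add: AutoGroup_def BijGroup_def)
  qed
  let ?S = "semidirect_product P (G\<lparr>carrier := T\<rparr>) \<theta>"
  define F where "F = (\<lambda>(p, t). t \<otimes> h p)"
  have carS: "carrier ?S = carrier P \<times> T" by (simp add: semidirect_product_def)
  have S_closed: "x \<otimes>\<^bsub>?S\<^esub> y \<in> carrier ?S" if "x \<in> carrier ?S" "y \<in> carrier ?S" for x y
    using that \<theta>T by (auto simp: semidirect_product_def)
  have F_mult: "F (x \<otimes>\<^bsub>?S\<^esub> y) = F x \<otimes> F y" if xy: "x \<in> carrier ?S" "y \<in> carrier ?S" for x y
  proof -
    obtain p t q s where pt: "x = (p, t)" "y = (q, s)" "p \<in> carrier P" "t \<in> T" "q \<in> carrier P" "s \<in> T"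
      using xy unfolding carS by auto
    have "inv (h p) \<otimes> (h p \<otimes> h q) = h q"
      using pt by (simp add: G.m_assoc[symmetric])
    then show ?thesis
      using pt by (simp add: F_def semidirect_product_def \<theta> G.m_assoc)
  qed
  have F_bij: "bij_betw F (carrier ?S) (carrier G)"
    unfolding bij_betw_def
  proof
    show "inj_on F (carrier ?S)"
    proof (rule inj_onI)
      fix x y assume xy: "x \<in> carrier ?S" "y \<in> carrier ?S" and eq: "F x = F y"
      obtain p t q s where pt: "x = (p, t)" "y = (q, s)" "p \<in> carrier P" "t \<in> T" "q \<in> carrier P" "s \<in> T"
        using xy unfolding carS by auto
      have tp: "t \<otimes> h p = s \<otimes> h q" using eq pt by (simp add: F_def)
      have "h p = inv t \<otimes> (t \<otimes> h p)" using pt by (simp add: G.m_assoc[symmetric])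
      also have "\<dots> = (inv t \<otimes> s) \<otimes> h q" unfolding tp using pt by (simp add: G.m_assoc)
      finally have "h p \<otimes> inv (h q) = inv t \<otimes> s" using pt by (simp add: G.m_assoc)
      then have "h (p \<otimes>\<^bsub>P\<^esub> inv\<^bsub>P\<^esub> q) \<in> T" using pt by simp
      then have "p \<otimes>\<^bsub>P\<^esub> inv\<^bsub>P\<^esub> q = \<one>\<^bsub>P\<^esub>" using triv pt by simp
      then have "p = q" using pt P.inv_equality[of p "inv\<^bsub>P\<^esub> q"] by simp
      moreover have "t = s" using tp pt \<open>p = q\<close> by simp
      ultimately show "x = y" using pt by simp
    qed
    show "F ` carrier ?S = carrier G"
    proof
      show "F ` carrier ?S \<subseteq> carrier G" unfolding carS F_def by auto
      show "carrier G \<subseteq> F ` carrier ?S"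
      proof
        fix g assume "g \<in> carrier G"
        then obtain t p where "t \<in> T" "p \<in> carrier P" "g = t \<otimes> h p" using gen by blast
        then show "g \<in> F ` carrier ?S" unfolding carS F_def by (intro image_eqI[of _ _ "(p, t)"]) auto
      qed
    qed
  qed
  define K where "K = inv_into (carrier ?S) F"
  have K_bij: "bij_betw K (carrier G) (carrier ?S)"
    unfolding K_def by (rule bij_betw_inv_into[OF F_bij])
  have FK: "F (K g) = g" if "g \<in> carrier G" for g
    unfolding K_def using bij_betw_inv_into_right[OF F_bij that] .
  have KS: "K g \<in> carrier ?S" if "g \<in> carrier G" for g using bij_betwE[OF K_bij] that by blast
  have "K \<in> iso G ?S"
    unfolding iso_def
  proof (intro CollectI conjI K_bij homI KS)
    fix g g' assume g: "g \<in> carrier G" "g' \<in> carrier G"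
    have "F (K (g \<otimes> g')) = F (K g \<otimes>\<^bsub>?S\<^esub> K g')"
      using F_mult[OF KS[OF g(1)] KS[OF g(2)]] FK g by simp
    then show "K (g \<otimes> g') = K g \<otimes>\<^bsub>?S\<^esub> K g'"
      using F_bij KS S_closed g unfolding bij_betw_def inj_on_def by simp
  qed
  then show "G \<cong> ?S" by (rule is_isoI)
qed

text \<open>Modulo the normal subgroup \<open>T\<close> the power of a product is the power of its second factor.\<close>
lemma pow_of_product:
  fixes G :: "('g, 'x) monoid_scheme" (structure)
  assumes G: "group G" and P: "group P" and T: "subgroup T G" and h: "h \<in> hom P G"
    and norm: "\<And>p t. p \<in> carrier P \<Longrightarrow> t \<in> T \<Longrightarrow> h p \<otimes> t \<otimes> inv (h p) \<in> T"
    and pt: "p \<in> carrier P" "t \<in> T"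
  shows "\<exists>s\<in>T. (t \<otimes> h p) [^] (n::nat) = s \<otimes> h (p [^]\<^bsub>P\<^esub> n)"
proof -
  interpret G: group G by (rule G)
  interpret P: group P by (rule P)
  interpret h: group_hom P G h by (intro group_hom.intro group_hom_axioms.intro G P h)
  interpret T: subgroup T G by (rule T)
  have TG [simp]: "t \<in> carrier G" if "t \<in> T" for t using T.subset that by blast
  show ?thesis
  proof (induction n)
    case 0
    show ?case by (intro bexI[of _ \<one>]) auto
  next
    case (Suc n)
    then obtain s where s: "s \<in> T" "(t \<otimes> h p) [^] n = s \<otimes> h (p [^]\<^bsub>P\<^esub> n)" by blast
    let ?q = "p [^]\<^bsub>P\<^esub> n"
    have q: "?q \<in> carrier P" using pt by simp
    have "(t \<otimes> h p) [^] Suc n = s \<otimes> h ?q \<otimes> (t \<otimes> h p)" using s by simp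
    also have "\<dots> = s \<otimes> (h ?q \<otimes> t \<otimes> inv (h ?q)) \<otimes> (h ?q \<otimes> h p)"
    proof -
      have "inv (h ?q) \<otimes> (h ?q \<otimes> h p) = h p" using q pt by (simp add: G.m_assoc[symmetric])
      then show ?thesis using s(1) q pt by (simp add: G.m_assoc)
    qed
    also have "h ?q \<otimes> h p = h (p [^]\<^bsub>P\<^esub> Suc n)" using q pt by simp
    finally show ?case using s(1) norm[OF q pt(2)] by (intro bexI[of _ "s \<otimes> (h ?q \<otimes> t \<otimes> inv (h ?q))"]) auto
  qed
qed

lemma finite_group_exponent:
  fixes P :: "('p, 'y) monoid_scheme" (structure)
  assumes "group P" "finite (carrier P)"
  shows "\<exists>N>0. \<forall>p\<in>carrier P. p [^] (N::nat) = \<one>"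
proof -
  interpret group P by (rule assms(1))
  have "\<exists>n>0. p [^] (n::nat) = \<one>" if p: "p \<in> carrier P" for p
  proof -
    have "finite (range (\<lambda>n::nat. p [^] n))"
      by (rule finite_subset[OF _ assms(2)]) (use p in auto)
    then have "\<not> inj (\<lambda>n::nat. p [^] n)" using finite_imageD infinite_UNIV_nat by blast
    then obtain i j :: nat where ij: "p [^] i = p [^] j" "i \<noteq> j" unfolding inj_def by blast
    define a b where "a = min i j" and "b = max i j - min i j"
    have "p [^] a \<otimes> p [^] b = p [^] a"
      using ij(1) p unfolding a_def b_def by (auto simp: nat_pow_mult min_def max_def)
    then have "p [^] b = \<one>" using p by simp
    moreover have "b > 0" using ij(2) unfolding b_def by simp
    ultimately show ?thesis by blast
  qed
  then obtain n where n: "\<And>p. p \<in> carrier P \<Longrightarrow> n p > (0::nat)" "\<And>p. p \<in> carrier P \<Longrightarrow> p [^] n p = \<one>"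
    by metis
  let ?N = "\<Prod>p\<in>carrier P. n p"
  have "p [^] ?N = \<one>" if p: "p \<in> carrier P" for p
  proof -
    have "?N = n p * (\<Prod>q\<in>carrier P - {p}. n q)" by (rule prod.remove[OF assms(2) p])
    then have "p [^] ?N = (p [^] n p) [^] (\<Prod>q\<in>carrier P - {p}. n q)"
      using p by (simp add: nat_pow_pow)
    then show ?thesis using n(2)[OF p] by simp
  qed
  moreover have "?N > 0" using n(1) by (simp add: prod_pos)
  ultimately show ?thesis by blast
qed

section \<open>The automorphism group\<close>

lemma mrename_mult: "mrename \<tau> (p * q) = mrename \<tau> p * mrename \<tau> q"
  by (simp add: mrename_conv_ext coeff_hom.ext_mult[OF mconst_hom])

lemma mrename_mconst: "mrename \<tau> (mconst c) = mconst c"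
  by (simp add: mrename_conv_ext coeff_hom.ext_mconst[OF mconst_hom])

lemma mrename_mrename: "mrename \<sigma> (mrename \<tau> p) = mrename (\<sigma> \<circ> \<tau>) p"
  unfolding mrename_def[of \<tau> p] mrename_sum mrename_mult mrename_mconst mrename_prod mrename_power mrename_mvar
  by (simp add: mrename_def[of "\<sigma> \<circ> \<tau>" p])

context trinomial_hypersurface
begin

abbreviation (input) G :: "(('v \<Rightarrow> 'k) \<Rightarrow> ('v \<Rightarrow> 'k)) monoid" where "G \<equiv> aut_group V X"

definition fp :: "('v, 'k) mpoly"
  where "fp = (\<Sum>i<3. \<Prod>v\<in>Vs i. mvar v ^ l v)"

lemma meval_fp: "meval fp x = (\<Sum>i<3. Mv i x)"
  by (simp add: fp_def meval_sum meval_prod meval_power Mv_def)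

lemma mrename_fp: "mrename \<tau> fp = (\<Sum>i<3. \<Prod>v\<in>Vs i. mvar (\<tau> v) ^ l v)"
  by (simp add: fp_def mrename_sum mrename_prod mrename_power mrename_mvar)

lemma regular_fun_iff: "regular_fun V X g \<longleftrightarrow> (\<lambda>x. g (retr x)) \<in> A"
proof
  assume "regular_fun V X g"
  then obtain p where p: "mvars p \<subseteq> V" "\<And>x. x \<in> X \<Longrightarrow> g x = meval p x"
    unfolding regular_fun_def by blast
  have "(\<lambda>x. g (retr x)) = rho p" by (rule ext) (simp only: p(2)[OF retr_in_X] rho_apply)
  then show "(\<lambda>x. g (retr x)) \<in> A" using rho_in[OF p(1)] by simp
next
  assume "(\<lambda>x. g (retr x)) \<in> A"
  then obtain p where p: "mvars p \<subseteq> V" "(\<lambda>x. g (retr x)) = rho p" by (auto elim: A_cases)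
  have "g x = meval p x" if "x \<in> X" for x
    using fun_cong[OF p(2), of x] that by (simp add: rho_apply)
  then show "regular_fun V X g" unfolding regular_fun_def using p(1) by blast
qed

definition regular :: "(('v \<Rightarrow> 'k) \<Rightarrow> ('v \<Rightarrow> 'k)) \<Rightarrow> bool"
  where "regular \<phi> \<longleftrightarrow> (\<forall>v\<in>V. (\<lambda>x. \<phi> (retr x) v) \<in> A)"

lemma carrier_G: "\<phi> \<in> carrier G \<longleftrightarrow> \<phi> \<in> Bij X \<and> regular \<phi> \<and> regular (inv_into X \<phi>)"
  by (simp add: aut_group_def regular_map_def regular_fun_iff regular_def)

definition pull :: "(('v \<Rightarrow> 'k) \<Rightarrow> ('v \<Rightarrow> 'k)) \<Rightarrow> (('v \<Rightarrow> 'k) \<Rightarrow> 'k) \<Rightarrow> ('v \<Rightarrow> 'k) \<Rightarrow> 'k"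
  where "pull \<phi> a = (\<lambda>x. a (\<phi> (retr x)))"

text \<open>The functions whose pullback is regular form a subring that contains the coordinates.\<close>
lemma pull_in:
  assumes "regular \<phi>" "\<And>x. x \<in> X \<Longrightarrow> \<phi> x \<in> X" "a \<in> A"
  shows "pull \<phi> a \<in> A"
  using assms(3)
proof (induction a rule: A_induct)
  case (mon c e)
  have "pull \<phi> (con c * mon e) = con c * (\<Prod>v\<in>V. (\<lambda>x. \<phi> (retr x) v) ^ e v)"
    by (rule ext) (simp add: pull_def mon_apply fun_prod_apply fun_power_apply assms(2))
  moreover have "con c * (\<Prod>v\<in>V. (\<lambda>x. \<phi> (retr x) v) ^ e v) \<in> A"
    using assms(1) unfolding regular_def by (intro mult_in con_in prod_in power_in) auto
  ultimately show "pull \<phi> (con c * mon e) \<in> A" by simp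
next
  case (add a b)
  have "pull \<phi> (a + b) = pull \<phi> a + pull \<phi> b" by (rule ext) (simp add: pull_def)
  then show "pull \<phi> (a + b) \<in> A" using add_in[OF add(3,4)] by simp
qed

lemma Bij_in: "\<phi> \<in> Bij X \<Longrightarrow> x \<in> X \<Longrightarrow> \<phi> x \<in> X"
  using Bij_imp_funcset by blast

lemma Bij_inv: "\<phi> \<in> Bij X \<Longrightarrow> x \<in> X \<Longrightarrow> inv_into X \<phi> (\<phi> x) = x"
  "\<phi> \<in> Bij X \<Longrightarrow> x \<in> X \<Longrightarrow> \<phi> (inv_into X \<phi> x) = x"
  by (auto simp: Bij_def bij_betw_inv_into_left bij_betw_inv_into_right)

lemma regular_cong: "regular \<phi> \<Longrightarrow> (\<And>x. x \<in> X \<Longrightarrow> \<psi> x = \<phi> x) \<Longrightarrow> regular \<psi>"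
  by (simp add: regular_def)

lemma regular_compose:
  assumes "regular \<phi>" "regular \<psi>" "\<And>x. x \<in> X \<Longrightarrow> \<phi> x \<in> X" "\<And>x. x \<in> X \<Longrightarrow> \<psi> x \<in> X"
  shows "regular (\<lambda>x. \<phi> (\<psi> x))"
  unfolding regular_def
proof
  fix v assume v: "v \<in> V"
  have "(\<lambda>x. \<phi> (retr x) v) \<in> A" using assms(1) v unfolding regular_def by blast
  then have "pull \<psi> (\<lambda>x. \<phi> (retr x) v) \<in> A"
    by (intro pull_in[OF assms(2)] assms(4))
  moreover have "pull \<psi> (\<lambda>x. \<phi> (retr x) v) = (\<lambda>x. \<phi> (\<psi> (retr x)) v)"
    by (rule ext) (simp add: pull_def assms(4))
  ultimately show "(\<lambda>x. \<phi> (\<psi> (retr x)) v) \<in> A" by simp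
qed

lemma Bij_inverse_eqI:
  assumes "\<phi> \<in> Bij X" "\<And>x. x \<in> X \<Longrightarrow> \<psi> x \<in> X" "\<And>x. x \<in> X \<Longrightarrow> \<phi> (\<psi> x) = x" "x \<in> X"
  shows "inv_into X \<phi> x = \<psi> x"
  using Bij_inv(1)[OF assms(1) assms(2)[OF assms(4)]] assms(3)[OF assms(4)] by simp

lemma subgroup_aut: "subgroup (carrier G) (BijGroup X)"
proof
  show "carrier G \<subseteq> carrier (BijGroup X)" by (auto simp: carrier_G BijGroup_def)
next
  fix \<phi> \<psi> assume "\<phi> \<in> carrier G" "\<psi> \<in> carrier G"
  then have p: "\<phi> \<in> Bij X" "regular \<phi>" "regular (inv_into X \<phi>)" "\<psi> \<in> Bij X" "regular \<psi>" "regular (inv_into X \<psi>)"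
    by (auto simp: carrier_G)
  have c: "compose X \<phi> \<psi> \<in> Bij X" using p by (intro compose_Bij)
  have r: "regular (compose X \<phi> \<psi>)"
    by (rule regular_cong[OF regular_compose[OF p(2,5)]]) (auto simp: compose_def intro: Bij_in p)
  have "inv_into X (compose X \<phi> \<psi>) x = inv_into X \<psi> (inv_into X \<phi> x)" if "x \<in> X" for x
    using that p by (intro Bij_inverse_eqI[OF c]) (auto simp: compose_def Bij_inv_into_mem Bij_inv)
  then have "regular (inv_into X (compose X \<phi> \<psi>))"
    using p by (intro regular_cong[OF regular_compose[OF p(6,3)]]) (auto intro: Bij_inv_into_mem)
  then show "\<phi> \<otimes>\<^bsub>BijGroup X\<^esub> \<psi> \<in> carrier G"
    using p c r by (simp add: carrier_G BijGroup_def)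
next
  have T: "regular (\<lambda>x. x)" unfolding regular_def
    by (simp add: T_def[symmetric] del: T_apply)
  have "inv_into X (\<lambda>x\<in>X. x) x = x" if "x \<in> X" for x
    using that by (intro Bij_inverse_eqI[OF id_Bij]) auto
  then have "(\<lambda>x\<in>X. x) \<in> carrier G"
    using regular_cong[OF T] by (auto simp: carrier_G id_Bij)
  then show "\<one>\<^bsub>BijGroup X\<^esub> \<in> carrier G" by (simp add: BijGroup_def)
next
  fix \<phi> assume "\<phi> \<in> carrier G"
  then have p: "\<phi> \<in> Bij X" "regular \<phi>" "regular (inv_into X \<phi>)" by (auto simp: carrier_G)
  have b: "(\<lambda>x\<in>X. inv_into X \<phi> x) \<in> Bij X" by (rule restrict_inv_into_Bij[OF p(1)])
  have "inv_into X (\<lambda>x\<in>X. inv_into X \<phi> x) x = \<phi> x" if "x \<in> X" for x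
    using that by (intro Bij_inverse_eqI[OF b]) (auto simp: Bij_inv p Bij_in)
  then show "inv\<^bsub>BijGroup X\<^esub> \<phi> \<in> carrier G"
    using b p regular_cong by (auto simp: inv_BijGroup carrier_G)
qed

lemma G_eq: "G = (BijGroup X)\<lparr>carrier := carrier G\<rparr>"
  by (simp add: aut_group_def)

lemma group_G: "group G"
  using subgroup.subgroup_is_group[OF subgroup_aut group_BijGroup] G_eq by simp

lemma G_mult: "\<phi> \<in> carrier G \<Longrightarrow> \<psi> \<in> carrier G \<Longrightarrow> x \<in> X \<Longrightarrow> (\<phi> \<otimes>\<^bsub>G\<^esub> \<psi>) x = \<phi> (\<psi> x)"
  by (simp add: carrier_G) (simp add: aut_group_def BijGroup_def compose_def)

lemma G_one: "x \<in> X \<Longrightarrow> \<one>\<^bsub>G\<^esub> x = x"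
  by (simp add: aut_group_def BijGroup_def)

lemma G_in: "\<phi> \<in> carrier G \<Longrightarrow> x \<in> X \<Longrightarrow> \<phi> x \<in> X"
  using Bij_in by (auto simp: carrier_G)

lemma G_inv: 
  assumes "\<phi> \<in> carrier G" "x \<in> X"
  shows "\<phi> ((inv\<^bsub>G\<^esub> \<phi>) x) = x"
proof -
  interpret group G by (rule group_G)
  have "(\<phi> \<otimes>\<^bsub>G\<^esub> inv\<^bsub>G\<^esub> \<phi>) x = x" using assms by (simp add: G_one)
  then show ?thesis using G_mult[of \<phi> "inv\<^bsub>G\<^esub> \<phi>" x] assms by simp
qed

lemma X_extensional: "x \<in> X \<Longrightarrow> x \<in> extensional V"
  by (auto simp: X_iff PiE_iff)

lemma G_eqI:
  assumes "\<phi> \<in> carrier G" "\<psi> \<in> carrier G" "\<And>x v. x \<in> X \<Longrightarrow> v \<in> V \<Longrightarrow> \<phi> x v = \<psi> x v"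
  shows "\<phi> = \<psi>"
proof (rule extensionalityI[of _ X])
  show "\<phi> \<in> extensional X" "\<psi> \<in> extensional X" using assms by (auto simp: carrier_G Bij_def)
  fix x assume x: "x \<in> X"
  show "\<phi> x = \<psi> x"
    using X_extensional[OF G_in[OF assms(1) x]] X_extensional[OF G_in[OF assms(2) x]] assms(3)[OF x]
    by (rule extensionalityI)
qed

lemma pull_automorphism:
  assumes "\<phi> \<in> carrier G"
  shows "trinomial_automorphism Vs l X (pull \<phi>) (pull (inv_into X \<phi>))"
proof -
  have p: "\<phi> \<in> Bij X" "regular \<phi>" "regular (inv_into X \<phi>)" using assms by (auto simp: carrier_G)
  show ?thesis
  proof unfold_locales
    fix a assume a: "a \<in> A"
    show "pull \<phi> a \<in> A" by (rule pull_in[OF p(2) Bij_in[OF p(1)] a])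
    show "pull (inv_into X \<phi>) a \<in> A" by (rule pull_in[OF p(3) Bij_inv_into_mem[OF p(1)] a])
    show "pull (inv_into X \<phi>) (pull \<phi> a) = a" "pull \<phi> (pull (inv_into X \<phi>) a) = a"
      by (rule ext, simp add: pull_def Bij_inv_into_mem p(1) Bij_inv Bij_in A_retr[OF a])+
  qed (auto simp: pull_def fun_eq_iff)
qed

text \<open>The geometric version of \<open>monomial_form\<close>.\<close>
lemma aut_form:
  assumes "\<phi> \<in> carrier G"
  shows "\<exists>\<tau> c. \<tau> permutes V \<and> (\<forall>i<3. \<exists>j<3. \<tau> ` Vs i = Vs j) \<and> (\<forall>v\<in>V. l (\<tau> v) = l v) \<and>
    (\<forall>v\<in>V. c v \<noteq> 0) \<and> (\<forall>x\<in>X. \<forall>v\<in>V. \<phi> x v = c v * x (\<tau> v)) \<and>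
    (\<exists>d. \<forall>i<3. (\<Prod>v\<in>Vs i. c v ^ l v) = d)"
proof -
  interpret a: trinomial_automorphism Vs l X "pull \<phi>" "pull (inv_into X \<phi>)"
    by (rule pull_automorphism[OF assms])
  obtain \<tau> c where tc: "\<tau> permutes V" "\<forall>i<3. \<exists>j<3. \<tau> ` Vs i = Vs j" "\<forall>v\<in>V. l (\<tau> v) = l v"
    "\<forall>v\<in>V. c v \<noteq> 0 \<and> pull \<phi> (T v) = con (c v) * T (\<tau> v)" "\<exists>d. \<forall>i<3. (\<Prod>v\<in>Vs i. c v ^ l v) = d"
    using a.monomial_form by blast
  have "\<phi> x v = c v * x (\<tau> v)" if "x \<in> X" "v \<in> V" for x v
  proof -
    have "pull \<phi> (T v) x = (con (c v) * T (\<tau> v)) x" using tc(4) that(2) by simp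
    then show ?thesis using that(1) G_in[OF assms that(1)] by (simp add: pull_def)
  qed
  then show ?thesis using tc by blast
qed

subsection \<open>The torus\<close>

definition Tor :: "(('v \<Rightarrow> 'k) \<Rightarrow> ('v \<Rightarrow> 'k)) set"
  where "Tor = {\<phi> \<in> carrier G. \<exists>c. \<forall>x\<in>X. \<forall>v\<in>V. \<phi> x v = c v * x v}"

definition diag :: "('v \<Rightarrow> 'k) \<Rightarrow> ('v \<Rightarrow> 'k) \<Rightarrow> ('v \<Rightarrow> 'k)"
  where "diag c = (\<lambda>x\<in>X. \<lambda>v\<in>V. c v * x v)"

lemma T_proportional_X:
  assumes "u \<in> V" "v \<in> V" "\<And>x. x \<in> X \<Longrightarrow> x u = c * x v"
  shows "u = v"
  by (rule T_proportional[OF assms(1,2), of c], rule ext) (simp add: assms(3))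

lemma nonzero_point: "\<exists>x\<in>X. \<forall>v\<in>V. x v \<noteq> 0"
proof -
  obtain w :: 'k where "w \<noteq> 0" "w \<noteq> -1" using infinite_avoid[of "{}"] by auto
  then show ?thesis using generic_point[of 0 1 w] by auto
qed

lemma diag_Tset_in:
  assumes c: "c \<in> Tset" and x: "x \<in> X"
  shows "(\<lambda>v\<in>V. c v * x v) \<in> X"
proof -
  obtain d where d: "\<And>i. i < 3 \<Longrightarrow> (\<Prod>v\<in>Vs i. c v ^ l v) = d" using c unfolding Tset_def by blast
  have "Mv i (\<lambda>v\<in>V. c v * x v) = d * Mv i x" if i: "i < 3" for i
  proof -
    have "Mv i (\<lambda>v\<in>V. c v * x v) = (\<Prod>v\<in>Vs i. c v ^ l v * x v ^ l v)"
      unfolding Mv_def using Vs_V[OF i] by (intro prod.cong) (auto simp: power_mult_distrib)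
    then show ?thesis unfolding prod.distrib d[OF i] Mv_def .
  qed
  then have "(\<Sum>i<3. Mv i (\<lambda>v\<in>V. c v * x v)) = d * (\<Sum>i<3. Mv i x)"
    unfolding sum_distrib_left by (intro sum.cong) auto
  then show ?thesis using x by (simp add: X_iff)
qed

lemma Tset_inverse: "c \<in> Tset \<Longrightarrow> (\<lambda>v\<in>V. inverse (c v)) \<in> Tset"
proof -
  assume "c \<in> Tset"
  then obtain d where d: "\<And>i. i < 3 \<Longrightarrow> (\<Prod>v\<in>Vs i. c v ^ l v) = d" "c \<in> V \<rightarrow>\<^sub>E UNIV - {0}"
    unfolding Tset_def by blast
  have "(\<Prod>v\<in>Vs i. (\<lambda>v\<in>V. inverse (c v)) v ^ l v) = inverse d" if i: "i < 3" for i
  proof -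
    have "(\<Prod>v\<in>Vs i. (\<lambda>v\<in>V. inverse (c v)) v ^ l v) = (\<Prod>v\<in>Vs i. inverse (c v ^ l v))"
      using Vs_V[OF i] by (intro prod.cong) (auto simp: power_inverse)
    also have "\<dots> = inverse (\<Prod>v\<in>Vs i. c v ^ l v)"
      using prod_inversef[of "\<lambda>v. c v ^ l v" "Vs i"] by (simp add: o_def)
    finally show ?thesis unfolding d(1)[OF i] .
  qed
  then show ?thesis unfolding Tset_def using d(2) by (auto simp: PiE_iff)
qed

lemma regular_scale:
  assumes "\<And>v. v \<in> V \<Longrightarrow> \<tau> v \<in> V"
  shows "regular (\<lambda>x. \<lambda>v\<in>V. c v * x (\<tau> v))"
  unfolding regular_def
proof
  fix v assume v: "v \<in> V"
  have "(\<lambda>x. (\<lambda>v\<in>V. c v * retr x (\<tau> v)) v) = con (c v) * T (\<tau> v)" by (rule ext) (simp add: v)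
  then show "(\<lambda>x. (\<lambda>v\<in>V. c v * retr x (\<tau> v)) v) \<in> A" using assms[OF v] by simp
qed

lemma X_restrict: "x \<in> X \<Longrightarrow> (\<lambda>v\<in>V. x v) = x"
  using X_extensional extensional_restrict by blast

lemma inverse_pair_in_G:
  assumes "regular \<phi>" "regular \<psi>" "\<And>x. x \<in> X \<Longrightarrow> \<phi> x \<in> X" "\<And>x. x \<in> X \<Longrightarrow> \<psi> x \<in> X"
    "\<And>x. x \<in> X \<Longrightarrow> \<phi> (\<psi> x) = x" "\<And>x. x \<in> X \<Longrightarrow> \<psi> (\<phi> x) = x"
  shows "(\<lambda>x\<in>X. \<phi> x) \<in> carrier G"
proof -
  have "bij_betw (\<lambda>x\<in>X. \<phi> x) X X"
    by (rule bij_betw_byWitness[of _ \<psi>]) (use assms in auto)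
  then have b: "(\<lambda>x\<in>X. \<phi> x) \<in> Bij X" by (simp add: Bij_def)
  moreover have "regular (\<lambda>x\<in>X. \<phi> x)" by (rule regular_cong[OF assms(1)]) simp
  moreover have "regular (inv_into X (\<lambda>x\<in>X. \<phi> x))"
    by (rule regular_cong[OF assms(2)]) (intro Bij_inverse_eqI[OF b]; simp add: assms)
  ultimately show ?thesis by (simp add: carrier_G)
qed

lemma diag_in_G:
  assumes c: "c \<in> Tset"
  shows "diag c \<in> carrier G"
  unfolding diag_def
proof (rule inverse_pair_in_G[of _ "\<lambda>x. \<lambda>v\<in>V. inverse (c v) * x v"])
  have nz: "c v \<noteq> 0" if "v \<in> V" for v using c that unfolding Tset_def by (auto simp: PiE_iff)
  show "regular (\<lambda>x. \<lambda>v\<in>V. c v * x v)" "regular (\<lambda>x. \<lambda>v\<in>V. inverse (c v) * x v)"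
    by (rule regular_scale, simp)+
  fix x assume x: "x \<in> X"
  show "(\<lambda>v\<in>V. c v * x v) \<in> X" by (rule diag_Tset_in[OF c x])
  have "(\<lambda>v\<in>V. (\<lambda>v\<in>V. inverse (c v)) v * x v) \<in> X" by (rule diag_Tset_in[OF Tset_inverse[OF c] x])
  then show "(\<lambda>v\<in>V. inverse (c v) * x v) \<in> X" by (simp cong: restrict_cong)
  have "(\<lambda>v\<in>V. c v * (\<lambda>v\<in>V. inverse (c v) * x v) v) = (\<lambda>v\<in>V. x v)"
    by (rule restrict_ext) (simp add: nz)
  then show "(\<lambda>v\<in>V. c v * (\<lambda>v\<in>V. inverse (c v) * x v) v) = x" using X_restrict[OF x] by simp
  have "(\<lambda>v\<in>V. inverse (c v) * (\<lambda>v\<in>V. c v * x v) v) = (\<lambda>v\<in>V. x v)"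
    by (rule restrict_ext) (simp add: nz)
  then show "(\<lambda>v\<in>V. inverse (c v) * (\<lambda>v\<in>V. c v * x v) v) = x" using X_restrict[OF x] by simp
qed

lemma diag_apply: "x \<in> X \<Longrightarrow> v \<in> V \<Longrightarrow> diag c x v = c v * x v"
  by (simp add: diag_def)

text \<open>An automorphism is of the form given by \<open>aut_form\<close> in only one way, so the constants of a diagonal
  one satisfy the equations of the torus.\<close>
lemma Tor_diag: "Tor = diag ` Tset"
proof
  show "Tor \<subseteq> diag ` Tset"
  proof
    fix \<phi> assume "\<phi> \<in> Tor"
    then obtain s where s: "\<phi> \<in> carrier G" "\<And>x v. x \<in> X \<Longrightarrow> v \<in> V \<Longrightarrow> \<phi> x v = s v * x v"
      unfolding Tor_def by blast
    obtain \<tau> c where tc: "\<tau> permutes V" "\<forall>v\<in>V. c v \<noteq> 0" "\<forall>x\<in>X. \<forall>v\<in>V. \<phi> x v = c v * x (\<tau> v)"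
      "\<exists>d. \<forall>i<3. (\<Prod>v\<in>Vs i. c v ^ l v) = d"
      using aut_form[OF s(1)] by blast
    have t: "\<tau> v = v" if v: "v \<in> V" for v
    proof (rule T_proportional_X)
      show "\<tau> v \<in> V" "v \<in> V" using v permutes_in_image[OF tc(1)] by auto
      fix x assume x: "x \<in> X"
      have "c v * x (\<tau> v) = s v * x v" using tc(3) s(2) x v by metis
      then show "x (\<tau> v) = (s v / c v) * x v" using tc(2) v by (simp add: field_simps)
    qed
    let ?c = "\<lambda>v\<in>V. c v"
    have "(\<Prod>v\<in>Vs i. ?c v ^ l v) = (\<Prod>v\<in>Vs i. c v ^ l v)" if "i < 3" for i
      using Vs_V[OF that] by (intro prod.cong) auto
    then have "?c \<in> Tset" using tc(2,4) unfolding Tset_def by auto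
    moreover have "\<phi> = diag ?c"
      by (rule G_eqI[OF s(1) diag_in_G[OF \<open>?c \<in> Tset\<close>]]) (use tc(3) t in \<open>simp add: diag_apply\<close>)
    ultimately show "\<phi> \<in> diag ` Tset" by blast
  qed
  show "diag ` Tset \<subseteq> Tor"
    using diag_in_G diag_apply unfolding Tor_def by blast
qed

lemma subgroup_Tor: "subgroup Tor G"
proof -
  interpret group G by (rule group_G)
  show ?thesis
  proof
    show "Tor \<subseteq> carrier G" by (auto simp: Tor_def)
    show "\<one>\<^bsub>G\<^esub> \<in> Tor" unfolding Tor_def by (auto simp: G_one intro!: exI[of _ "\<lambda>_. 1"])
  next
    fix \<phi> \<psi> assume "\<phi> \<in> Tor" "\<psi> \<in> Tor"
    then obtain c d where cd: "\<phi> \<in> carrier G" "\<psi> \<in> carrier G" "\<forall>x\<in>X. \<forall>v\<in>V. \<phi> x v = c v * x v"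
      "\<forall>x\<in>X. \<forall>v\<in>V. \<psi> x v = d v * x v" unfolding Tor_def by blast
    have "(\<phi> \<otimes>\<^bsub>G\<^esub> \<psi>) x v = (c v * d v) * x v" if "x \<in> X" "v \<in> V" for x v
      using cd(3,4) that G_in[OF cd(2) that(1)] unfolding G_mult[OF cd(1,2) that(1)] by simp
    then show "\<phi> \<otimes>\<^bsub>G\<^esub> \<psi> \<in> Tor" using cd(1,2) unfolding Tor_def by auto
  next
    fix \<phi> assume ph: "\<phi> \<in> Tor"
    then obtain c where c: "c \<in> Tset" "\<phi> = diag c" unfolding Tor_diag by blast
    have nz: "c v \<noteq> 0" if "v \<in> V" for v using c(1) that unfolding Tset_def by (auto simp: PiE_iff)
    have pG: "\<phi> \<in> carrier G" using ph by (simp add: Tor_def)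
    have "(inv\<^bsub>G\<^esub> \<phi>) x v = inverse (c v) * x v" if "x \<in> X" "v \<in> V" for x v
    proof -
      have iX: "(inv\<^bsub>G\<^esub> \<phi>) x \<in> X" using G_in[OF inv_closed[OF pG] that(1)] .
      have "x v = c v * (inv\<^bsub>G\<^esub> \<phi>) x v"
        using G_inv[OF pG that(1)] diag_apply[OF iX that(2), of c] c(2) by simp
      then show ?thesis using nz[OF that(2)] by simp
    qed
    then show "inv\<^bsub>G\<^esub> \<phi> \<in> Tor" using pG unfolding Tor_def by auto
  qed
qed

subsection \<open>Permutations\<close>

lemma carrier_P: "\<tau> \<in> carrier (perm_group V fp) \<longleftrightarrow> \<tau> permutes V \<and> mrename \<tau> fp = fp"
  by (simp add: perm_group_def)

lemma mrename_id_fp: "mrename id fp = fp"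
  unfolding mrename_fp by (simp add: fp_def)

lemma P_inv: "\<tau> \<in> carrier (perm_group V fp) \<Longrightarrow> Hilbert_Choice.inv \<tau> \<in> carrier (perm_group V fp)"
proof -
  assume t: "\<tau> \<in> carrier (perm_group V fp)"
  have "mrename (Hilbert_Choice.inv \<tau>) fp = mrename (Hilbert_Choice.inv \<tau>) (mrename \<tau> fp)"
    using t by (simp add: carrier_P)
  also have "\<dots> = mrename id fp"
    unfolding mrename_mrename using t permutes_inv_o(2)[of \<tau> V] by (simp add: carrier_P)
  finally show ?thesis using t permutes_inv[of \<tau> V] mrename_id_fp by (simp add: carrier_P)
qed

lemma group_P: "group (perm_group V fp)"
proof (rule groupI)
  fix \<sigma> \<tau> assume "\<sigma> \<in> carrier (perm_group V fp)" "\<tau> \<in> carrier (perm_group V fp)"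
  then show "\<sigma> \<otimes>\<^bsub>perm_group V fp\<^esub> \<tau> \<in> carrier (perm_group V fp)"
    using permutes_compose[of \<tau> V \<sigma>] mrename_mrename[of \<sigma> \<tau> fp] unfolding carrier_P
    by (simp add: perm_group_def)
next
  show "\<one>\<^bsub>perm_group V fp\<^esub> \<in> carrier (perm_group V fp)" using mrename_id_fp permutes_id[of V] unfolding carrier_P
    by (simp add: perm_group_def)
next
  fix \<tau> assume t: "\<tau> \<in> carrier (perm_group V fp)"
  show "\<exists>\<sigma>\<in>carrier (perm_group V fp). \<sigma> \<otimes>\<^bsub>perm_group V fp\<^esub> \<tau> = \<one>\<^bsub>perm_group V fp\<^esub>"
    using P_inv[OF t] t permutes_inv_o(2)[of \<tau> V] unfolding carrier_P
    by (intro bexI[of _ "Hilbert_Choice.inv \<tau>"]) (simp_all add: perm_group_def)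
qed (simp_all add: perm_group_def comp_assoc)

lemma finite_P: "finite (carrier (perm_group V fp))"
  by (rule finite_subset[OF _ finite_permutations[OF finite_V]]) (auto simp: carrier_P)

lemma permute_X:
  assumes "\<tau> \<in> carrier (perm_group V fp)" "x \<in> X"
  shows "(\<lambda>v\<in>V. x (\<tau> v)) \<in> X"
proof -
  have "meval fp (\<lambda>v. x (\<tau> v)) = meval fp x"
    using meval_mrename[of \<tau> fp x] assms(1) by (simp add: carrier_P)
  then have "(\<Sum>i<3. Mv i (\<lambda>v. x (\<tau> v))) = 0" using assms(2) by (simp add: meval_fp X_iff)
  moreover have "Mv i (\<lambda>v\<in>V. x (\<tau> v)) = Mv i (\<lambda>v. x (\<tau> v))" if "i < 3" for i
    using Vs_V[OF that] by (intro Mv_cong) auto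
  ultimately show ?thesis by (simp add: X_iff)
qed

lemma perm_aut_apply: "x \<in> X \<Longrightarrow> v \<in> V \<Longrightarrow> perm_aut V X \<tau> x v = x (Hilbert_Choice.inv \<tau> v)"
  by (simp add: perm_aut_def)

lemma perm_aut_in_G:
  assumes t: "\<tau> \<in> carrier (perm_group V fp)"
  shows "perm_aut V X \<tau> \<in> carrier G"
proof -
  let ?s = "Hilbert_Choice.inv \<tau>"
  have tp: "\<tau> permutes V" "?s permutes V" using t P_inv[OF t] by (auto simp: carrier_P)
  have reg: "regular (\<lambda>x. \<lambda>v\<in>V. x (\<sigma> v))" if "\<sigma> permutes V" for \<sigma>
    using regular_scale[of \<sigma> "\<lambda>_. 1"] permutes_in_image[OF that] by simp
  show ?thesis
    unfolding perm_aut_def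
  proof (rule inverse_pair_in_G[of _ "\<lambda>x. \<lambda>v\<in>V. x (\<tau> v)"])
    show "regular (\<lambda>x. \<lambda>v\<in>V. x (?s v))" "regular (\<lambda>x. \<lambda>v\<in>V. x (\<tau> v))"
      by (rule reg[OF tp(2)], rule reg[OF tp(1)])
    fix x assume x: "x \<in> X"
    show "(\<lambda>v\<in>V. x (?s v)) \<in> X" by (rule permute_X[OF P_inv[OF t] x])
    show "(\<lambda>v\<in>V. x (\<tau> v)) \<in> X" by (rule permute_X[OF t x])
    have "(\<lambda>v\<in>V. (\<lambda>v\<in>V. x (\<tau> v)) (?s v)) = (\<lambda>v\<in>V. x v)"
      using permutes_in_image[OF tp(2)] permutes_inverses(1)[OF tp(1)] by (intro restrict_ext) simp
    then show "(\<lambda>v\<in>V. (\<lambda>v\<in>V. x (\<tau> v)) (?s v)) = x" using X_restrict[OF x] by simp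
    have "(\<lambda>v\<in>V. (\<lambda>v\<in>V. x (?s v)) (\<tau> v)) = (\<lambda>v\<in>V. x v)"
      using permutes_in_image[OF tp(1)] permutes_inverses(2)[OF tp(1)] by (intro restrict_ext) simp
    then show "(\<lambda>v\<in>V. (\<lambda>v\<in>V. x (?s v)) (\<tau> v)) = x" using X_restrict[OF x] by simp
  qed
qed

lemma perm_aut_hom: "perm_aut V X \<in> hom (perm_group V fp) G"
proof (rule homI)
  fix \<sigma> \<tau> assume st: "\<sigma> \<in> carrier (perm_group V fp)" "\<tau> \<in> carrier (perm_group V fp)"
  interpret P: group "perm_group V fp" by (rule group_P)
  interpret G: group G by (rule group_G)
  show "perm_aut V X \<sigma> \<in> carrier G" by (rule perm_aut_in_G[OF st(1)])
  have perm: "\<sigma> permutes V" "\<tau> permutes V" using st by (auto simp: carrier_P)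
  have in': "perm_aut V X \<sigma> \<in> carrier G" "perm_aut V X \<tau> \<in> carrier G" using perm_aut_in_G st by auto
  have inv': "Hilbert_Choice.inv (\<sigma> \<circ> \<tau>) = Hilbert_Choice.inv \<tau> \<circ> Hilbert_Choice.inv \<sigma>"
    using permutes_bij[OF perm(1)] permutes_bij[OF perm(2)] by (rule o_inv_distrib)
  have mult: "\<sigma> \<otimes>\<^bsub>perm_group V fp\<^esub> \<tau> = \<sigma> \<circ> \<tau>" by (simp add: perm_group_def)
  show "perm_aut V X (\<sigma> \<otimes>\<^bsub>perm_group V fp\<^esub> \<tau>) = perm_aut V X \<sigma> \<otimes>\<^bsub>G\<^esub> perm_aut V X \<tau>"
  proof (rule G_eqI)
    show "perm_aut V X (\<sigma> \<otimes>\<^bsub>perm_group V fp\<^esub> \<tau>) \<in> carrier G" using st by (intro perm_aut_in_G P.m_closed)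
    show "perm_aut V X \<sigma> \<otimes>\<^bsub>G\<^esub> perm_aut V X \<tau> \<in> carrier G" using in' by (rule G.m_closed)
    fix x v assume xv: "x \<in> X" "v \<in> V"
    have "Hilbert_Choice.inv \<sigma> v \<in> V" using permutes_in_image[OF permutes_inv[OF perm(1)]] xv(2) by simp
    then show "perm_aut V X (\<sigma> \<otimes>\<^bsub>perm_group V fp\<^esub> \<tau>) x v = (perm_aut V X \<sigma> \<otimes>\<^bsub>G\<^esub> perm_aut V X \<tau>) x v"
      unfolding G_mult[OF in' xv(1)] perm_aut_apply[OF G_in[OF in'(2) xv(1)] xv(2)] mult
      using xv by (simp add: perm_aut_apply inv')
  qed
qed

lemma conj_Tor:
  assumes t: "\<tau> \<in> carrier (perm_group V fp)" and \<phi>: "\<phi> \<in> Tor"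
  shows "perm_aut V X \<tau> \<otimes>\<^bsub>G\<^esub> \<phi> \<otimes>\<^bsub>G\<^esub> inv\<^bsub>G\<^esub> (perm_aut V X \<tau>) \<in> Tor"
proof -
  interpret G: group G by (rule group_G)
  let ?p = "perm_aut V X \<tau>"
  have p: "?p \<in> carrier G" by (rule perm_aut_in_G[OF t])
  obtain c where c: "\<phi> \<in> carrier G" "\<And>x v. x \<in> X \<Longrightarrow> v \<in> V \<Longrightarrow> \<phi> x v = c v * x v"
    using \<phi> unfolding Tor_def by blast
  have perm: "\<tau> permutes V" using t by (simp add: carrier_P)
  have "(?p \<otimes>\<^bsub>G\<^esub> \<phi> \<otimes>\<^bsub>G\<^esub> inv\<^bsub>G\<^esub> ?p) x v = c (Hilbert_Choice.inv \<tau> v) * x v" if xv: "x \<in> X" "v \<in> V" for x v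
  proof -
    let ?y = "(inv\<^bsub>G\<^esub> ?p) x"
    have y: "?y \<in> X" using G_in[OF G.inv_closed[OF p] xv(1)] .
    have iv: "Hilbert_Choice.inv \<tau> v \<in> V" using permutes_in_image[OF permutes_inv[OF perm]] xv(2) by simp
    have "(?p \<otimes>\<^bsub>G\<^esub> \<phi> \<otimes>\<^bsub>G\<^esub> inv\<^bsub>G\<^esub> ?p) x v = ?p (\<phi> ?y) v"
      using G_mult[of "?p \<otimes>\<^bsub>G\<^esub> \<phi>" "inv\<^bsub>G\<^esub> ?p" x] G_mult[of ?p \<phi> ?y] p c(1) y xv(1) by simp
    also have "\<dots> = c (Hilbert_Choice.inv \<tau> v) * ?y (Hilbert_Choice.inv \<tau> v)"
      unfolding perm_aut_apply[OF G_in[OF c(1) y] xv(2)] by (rule c(2)[OF y iv])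
    also have "?y (Hilbert_Choice.inv \<tau> v) = ?p ?y v" unfolding perm_aut_apply[OF y xv(2)] ..
    also have "?p ?y = x" by (rule G_inv[OF p xv(1)])
    finally show ?thesis .
  qed
  then show ?thesis unfolding Tor_def using p c(1) by (intro CollectI conjI exI[of _ "\<lambda>v. c (Hilbert_Choice.inv \<tau> v)"]) auto
qed

lemma perm_aut_Tor:
  assumes t: "\<tau> \<in> carrier (perm_group V fp)" and in': "perm_aut V X \<tau> \<in> Tor"
  shows "\<tau> = \<one>\<^bsub>perm_group V fp\<^esub>"
proof -
  have perm: "\<tau> permutes V" using t by (simp add: carrier_P)
  obtain c where c: "\<And>x v. x \<in> X \<Longrightarrow> v \<in> V \<Longrightarrow> perm_aut V X \<tau> x v = c v * x v"
    using in' unfolding Tor_def by blast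
  have iv: "Hilbert_Choice.inv \<tau> v = v" if v: "v \<in> V" for v
  proof (rule T_proportional_X)
    show "Hilbert_Choice.inv \<tau> v \<in> V" "v \<in> V"
      using permutes_in_image[OF permutes_inv[OF perm]] v by auto
    show "x (Hilbert_Choice.inv \<tau> v) = c v * x v" if "x \<in> X" for x
      using c[OF that v] perm_aut_apply[OF that v] by simp
  qed
  have "\<tau> v = v" for v
  proof (cases "v \<in> V")
    case True
    then show ?thesis using iv permutes_inverses(1)[OF perm, of v] by simp
  next
    case False
    then show ?thesis using perm by (rule permutes_not_in[rotated])
  qed
  then show ?thesis by (simp add: perm_group_def fun_eq_iff)
qed

text \<open>By \<open>aut_form\<close> the automorphism is a permutation of coordinates followed by multiplication with
  constants. The permutation of the groups of variables permutes the three monomials, so it fixes the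
  trinomial.\<close>
lemma decomposition:
  assumes "\<phi> \<in> carrier G"
  shows "\<exists>t\<in>Tor. \<exists>\<sigma>\<in>carrier (perm_group V fp). \<phi> = t \<otimes>\<^bsub>G\<^esub> perm_aut V X \<sigma>"
proof -
  interpret G: group G by (rule group_G)
  obtain \<tau> c where tc: "\<tau> permutes V" "\<forall>i<3. \<exists>j<3. \<tau> ` Vs i = Vs j" "\<forall>v\<in>V. l (\<tau> v) = l v"
    "\<forall>x\<in>X. \<forall>v\<in>V. \<phi> x v = c v * x (\<tau> v)"
    using aut_form[OF assms] by blast
  obtain k where k: "\<And>i. i < 3 \<Longrightarrow> k i < (3::nat)" "\<And>i. i < 3 \<Longrightarrow> \<tau> ` Vs i = Vs (k i)" using tc(2) by metis
  have inj: "inj_on \<tau> S" for S using permutes_inj[OF tc(1)] by (rule inj_on_subset) simp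
  have kinj: "inj_on k {..<3}"
  proof (rule inj_onI)
    fix i j assume ij: "i \<in> {..<3}" "j \<in> {..<(3::nat)}" "k i = k j"
    then have "\<tau> ` Vs i = \<tau> ` Vs j" using k(2) by simp
    then have "Vs i = Vs j" using inj_image_eq_iff[OF permutes_inj[OF tc(1)]] by blast
    then show "i = j" using Vs_disjoint[of i j] Vs_nonempty[of i] ij by auto
  qed
  have kim: "k ` {..<3} = {..<3}"
    by (rule endo_inj_surj[OF _ _ kinj]) (use k(1) in auto)
  have "mrename \<tau> fp = (\<Sum>i<3. \<Prod>u\<in>Vs (k i). mvar u ^ l u)"
    unfolding mrename_fp
  proof (rule sum.cong[OF refl])
    fix i :: nat assume "i \<in> {..<3}"
    then have i: "i < 3" by simp
    have "(\<Prod>v\<in>Vs i. mvar (\<tau> v) ^ l v) = (\<Prod>v\<in>Vs i. (mvar (\<tau> v) :: ('v, 'k) mpoly) ^ l (\<tau> v))"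
      using tc(3) Vs_V[OF i] by (intro prod.cong) auto
    also have "\<dots> = (\<Prod>u\<in>Vs (k i). mvar u ^ l u)"
      unfolding k(2)[OF i, symmetric] prod.reindex[OF inj] o_def ..
    finally show "(\<Prod>v\<in>Vs i. mvar (\<tau> v) ^ l v) = (\<Prod>u\<in>Vs (k i). (mvar u :: ('v, 'k) mpoly) ^ l u)" .
  qed
  also have "\<dots> = (\<Sum>i\<in>k ` {..<3}. \<Prod>u\<in>Vs i. mvar u ^ l u)"
    unfolding sum.reindex[OF kinj] o_def ..
  also have "\<dots> = fp" unfolding kim fp_def ..
  finally have tP: "\<tau> \<in> carrier (perm_group V fp)" using tc(1) by (simp add: carrier_P)
  let ?s = "Hilbert_Choice.inv \<tau>"
  have sP: "?s \<in> carrier (perm_group V fp)" by (rule P_inv[OF tP])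
  have ii: "Hilbert_Choice.inv ?s = \<tau>" using permutes_inv_inv[OF tc(1)] .
  let ?p = "perm_aut V X ?s"
  have p: "?p \<in> carrier G" by (rule perm_aut_in_G[OF sP])
  let ?t = "\<phi> \<otimes>\<^bsub>G\<^esub> inv\<^bsub>G\<^esub> ?p"
  have "?t x v = c v * x v" if xv: "x \<in> X" "v \<in> V" for x v
  proof -
    let ?y = "(inv\<^bsub>G\<^esub> ?p) x"
    have y: "?y \<in> X" using G_in[OF G.inv_closed[OF p] xv(1)] .
    have "?t x v = \<phi> ?y v" unfolding G_mult[OF assms G.inv_closed[OF p] xv(1)] ..
    also have "\<dots> = c v * ?y (\<tau> v)" using tc(4) y xv(2) by simp
    also have "?y (\<tau> v) = ?p ?y v" unfolding perm_aut_apply[OF y xv(2)] ii ..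
    also have "?p ?y = x" by (rule G_inv[OF p xv(1)])
    finally show ?thesis .
  qed
  then have "?t \<in> Tor" unfolding Tor_def using assms p by auto
  moreover have "\<phi> = ?t \<otimes>\<^bsub>G\<^esub> ?p" using assms p by (simp add: G.m_assoc)
  ultimately show ?thesis using sP by blast
qed

subsection \<open>Maximality\<close>

lemma mult_group_simps [simp]: "carrier mult_group = UNIV - {0::'k}"
  "(\<otimes>\<^bsub>mult_group\<^esub>) = ((*) :: 'k \<Rightarrow> 'k \<Rightarrow> 'k)" "\<one>\<^bsub>mult_group\<^esub> = (1::'k)"
  by (simp_all add: mult_group_def)

lemma group_mult_group: "group (mult_group :: 'k monoid)"
proof (rule groupI)
  fix x :: 'k assume "x \<in> carrier mult_group"
  then show "\<exists>y\<in>carrier mult_group. y \<otimes>\<^bsub>mult_group\<^esub> x = \<one>\<^bsub>mult_group\<^esub>"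
    by (intro bexI[of _ "inverse x"]) simp_all
qed simp_all

lemma carrier_std_torus: "carrier (std_torus s :: (nat \<Rightarrow> 'k) monoid) = {..<s} \<rightarrow>\<^sub>E UNIV - {0}"
  by simp

lemma std_torus_pow:
  assumes "r \<in> carrier (std_torus s :: (nat \<Rightarrow> 'k) monoid)"
  shows "r [^]\<^bsub>std_torus s\<^esub> (n::nat) = (\<lambda>k\<in>{..<s}. r k ^ n)"
proof (induction n)
  case 0
  show ?case by (simp add: nat_pow_def)
next
  case (Suc n)
  have "r [^]\<^bsub>std_torus s\<^esub> Suc n = (r [^]\<^bsub>std_torus s\<^esub> n) \<otimes>\<^bsub>std_torus s\<^esub> r"
    by (simp add: nat_pow_def)
  then show ?case unfolding Suc by (auto simp: mult.commute)
qed

abbreviation (input) ST :: "nat \<Rightarrow> (nat \<Rightarrow> 'k) monoid" where "ST s \<equiv> std_torus s"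

text \<open>A torus over an algebraically closed field is divisible, so its image in the finite group of
  permutations is trivial.\<close>
lemma subtorus_le_Tor:
  assumes "is_subtorus V X S"
  shows "S \<subseteq> Tor"
proof
  fix \<phi> assume \<phi>: "\<phi> \<in> S"
  interpret G: group G by (rule group_G)
  interpret P: group "perm_group V fp" by (rule group_P)
  obtain s \<psi> where S: "subgroup S G" and \<psi>: "\<psi> \<in> iso (ST s) (G\<lparr>carrier := S\<rparr>)"
    using assms unfolding is_subtorus_def by blast
  interpret S: subgroup S G by (rule S)
  have gS: "group (G\<lparr>carrier := S\<rparr>)" by (rule S.subgroup_is_group[OF group_G])
  have gT: "group (ST s)" by (rule product_group) (rule group_mult_group)
  have \<psi>b: "bij_betw \<psi> (carrier (ST s)) S" and \<psi>h: "\<psi> \<in> hom (ST s) (G\<lparr>carrier := S\<rparr>)"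
    using \<psi> by (auto simp: iso_def)
  have "\<phi> \<in> \<psi> ` carrier (ST s)" using \<phi> bij_betw_imp_surj_on[OF \<psi>b] by (simp only:)
  then obtain t where t: "\<phi> = \<psi> t" "t \<in> carrier (ST s)" by (rule imageE)
  obtain N :: nat where N: "N > 0" "\<And>\<sigma>. \<sigma> \<in> carrier (perm_group V fp) \<Longrightarrow>
      \<sigma> [^]\<^bsub>perm_group V fp\<^esub> N = \<one>\<^bsub>perm_group V fp\<^esub>"
    using finite_group_exponent[OF group_P finite_P] by blast
  have "\<forall>k. \<exists>z. z ^ N = t k" using nth_root_exists[OF N(1)] by blast
  then obtain z where z: "\<And>k. z k ^ N = t k" by metis
  \<comment> \<open>A root of order \<open>N\<close> of the given element of the subtorus.\<close>
  define r where "r = (\<lambda>k\<in>{..<s}. z k)"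
  have r: "r \<in> carrier (ST s)"
  proof -
    have "z k \<noteq> 0" if "k < s" for k
      using z[of k] t(2) that N(1) by (auto simp: PiE_iff zero_power)
    then show ?thesis by (auto simp: r_def)
  qed
  have tr: "t = r [^]\<^bsub>ST s\<^esub> N"
    unfolding std_torus_pow[OF r] using t(2) by (auto simp: r_def z fun_eq_iff PiE_iff extensional_def)
  interpret h: group_hom "ST s" "G\<lparr>carrier := S\<rparr>" \<psi>
    by (intro group_hom.intro group_hom_axioms.intro gT gS \<psi>h)
  have "\<phi> = \<psi> r [^]\<^bsub>G\<lparr>carrier := S\<rparr>\<^esub> N"
    unfolding t(1) tr using r by (rule h.hom_nat_pow)
  also have "\<dots> = \<psi> r [^]\<^bsub>G\<^esub> N" by (simp add: nat_pow_def)
  finally have \<phi>r: "\<phi> = \<psi> r [^]\<^bsub>G\<^esub> N" .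
  have "\<psi> r \<in> carrier G" using h.hom_closed[OF r] S.subset by auto
  then obtain t' \<sigma> where ts: "t' \<in> Tor" "\<sigma> \<in> carrier (perm_group V fp)" "\<psi> r = t' \<otimes>\<^bsub>G\<^esub> perm_aut V X \<sigma>"
    using decomposition by blast
  obtain t'' where t'': "t'' \<in> Tor" "\<phi> = t'' \<otimes>\<^bsub>G\<^esub> perm_aut V X (\<sigma> [^]\<^bsub>perm_group V fp\<^esub> N)"
    using pow_of_product[OF group_G group_P subgroup_Tor perm_aut_hom conj_Tor ts(2,1), of N]
    unfolding \<phi>r ts(3) by blast
  have "\<sigma> [^]\<^bsub>perm_group V fp\<^esub> N = \<one>\<^bsub>perm_group V fp\<^esub>" using N(2)[OF ts(2)] .
  moreover have "perm_aut V X \<one>\<^bsub>perm_group V fp\<^esub> = \<one>\<^bsub>G\<^esub>"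
    using hom_one[OF perm_aut_hom group_P group_G] .
  moreover have "t'' \<in> carrier G" using t''(1) by (simp add: Tor_def)
  ultimately show "\<phi> \<in> Tor" using t'' by simp
qed

text \<open>The parametrization consists of Laurent monomials, which are polynomials in the coordinates of the
  torus and their inverses.\<close>
lemma is_subtorus_Tor: "is_subtorus V X Tor"
proof -
  obtain s :: nat and \<Theta> where \<Theta>: "\<And>v. v \<in> V \<Longrightarrow> laurent {..<s} (\<lambda>t. \<Theta> t v)"
    "bij_betw (\<lambda>t. \<lambda>v\<in>V. \<Theta> t v) ({..<s} \<rightarrow>\<^sub>E UNIV - {0}) Tset"
    using torus_parametrization by blast
  define th where "th t = (\<lambda>v\<in>V. \<Theta> t v)" for t
  have th: "bij_betw th ({..<s} \<rightarrow>\<^sub>E UNIV - {0}) Tset" using \<Theta>(2) unfolding th_def .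
  have diag_inj: "inj_on diag Tset"
  proof (rule inj_onI)
    fix c d assume cd: "c \<in> Tset" "d \<in> Tset" "diag c = diag d"
    obtain x where x: "x \<in> X" "\<forall>v\<in>V. x v \<noteq> 0" using nonzero_point by blast
    have "c v = d v" if "v \<in> V" for v
    proof -
      have "c v * x v = d v * x v"
        using cd(3) diag_apply[OF x(1) that, of c] diag_apply[OF x(1) that, of d] by metis
      moreover have "x v \<noteq> 0" using x(2) that by blast
      ultimately show ?thesis by (metis mult_right_cancel)
    qed
    then show "c = d" using cd(1,2) unfolding Tset_def by (auto intro: PiE_ext)
  qed
  have diag_bij: "bij_betw diag Tset Tor" unfolding bij_betw_def Tor_diag using diag_inj by simp
  define \<psi> where "\<psi> = diag \<circ> th"
  have \<psi>_bij: "bij_betw \<psi> (carrier (ST s)) Tor"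
    unfolding \<psi>_def carrier_std_torus by (rule bij_betw_trans[OF th diag_bij])
  have thT: "th t \<in> Tset" if "t \<in> carrier (ST s)" for t
    using bij_betwE[OF th] that unfolding carrier_std_torus by blast
  have nz: "\<forall>k\<in>{..<s}. t k \<noteq> 0" if "t \<in> carrier (ST s)" for t
    using that unfolding carrier_std_torus by (auto simp: PiE_iff)
  have \<psi>_apply: "\<psi> t x v = \<Theta> t v * x v" if "x \<in> X" "v \<in> V" for t x v
    unfolding \<psi>_def o_def diag_apply[OF that] th_def using that by simp
  have \<psi>G: "\<psi> t \<in> carrier G" if "t \<in> carrier (ST s)" for t
    unfolding \<psi>_def o_def by (rule diag_in_G[OF thT[OF that]])
  interpret st: group "ST s" by (rule product_group) (rule group_mult_group)
  interpret G: group G by (rule group_G)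
  have \<psi>_iso: "\<psi> \<in> iso (ST s) (G\<lparr>carrier := Tor\<rparr>)"
    unfolding iso_def
  proof (intro CollectI conjI homI)
    show "bij_betw \<psi> (carrier (ST s)) (carrier (G\<lparr>carrier := Tor\<rparr>))" using \<psi>_bij by simp
    fix t t' assume t: "t \<in> carrier (ST s)" "t' \<in> carrier (ST s)"
    show "\<psi> t \<in> carrier (G\<lparr>carrier := Tor\<rparr>)" using bij_betwE[OF \<psi>_bij] t(1) by auto
    have tt': "t \<otimes>\<^bsub>ST s\<^esub> t' \<in> carrier (ST s)" by (rule st.m_closed[OF t])
    have "\<psi> (t \<otimes>\<^bsub>ST s\<^esub> t') = \<psi> t \<otimes>\<^bsub>G\<^esub> \<psi> t'"
    proof (rule G_eqI[OF \<psi>G[OF tt'] G.m_closed[OF \<psi>G[OF t(1)] \<psi>G[OF t(2)]]])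
      fix x v assume xv: "x \<in> X" "v \<in> V"
      obtain a where a: "\<And>c. \<forall>i\<in>{..<s}. c i \<noteq> 0 \<Longrightarrow> \<Theta> c v = (\<Prod>i<s. c i powi a i)"
        using \<Theta>(1)[OF xv(2)] unfolding laurent_def by blast
      have "\<Theta> (t \<otimes>\<^bsub>ST s\<^esub> t') v = (\<Prod>i<s. (t i * t' i) powi a i)"
        unfolding a[OF nz[OF tt']] by (rule prod.cong) simp_all
      also have "\<dots> = \<Theta> t v * \<Theta> t' v"
        unfolding a[OF nz[OF t(1)]] a[OF nz[OF t(2)]] power_int_mult_distrib by (rule prod.distrib)
      finally show "\<psi> (t \<otimes>\<^bsub>ST s\<^esub> t') x v = (\<psi> t \<otimes>\<^bsub>G\<^esub> \<psi> t') x v"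
        unfolding G_mult[OF \<psi>G[OF t(1)] \<psi>G[OF t(2)] xv(1)] \<psi>_apply[OF xv]
          \<psi>_apply[OF G_in[OF \<psi>G[OF t(2)] xv(1)] xv(2)] by simp
    qed
    then show "\<psi> (t \<otimes>\<^bsub>ST s\<^esub> t') = \<psi> t \<otimes>\<^bsub>G\<lparr>carrier := Tor\<rparr>\<^esub> \<psi> t'" by simp
  qed
  have "morphic_torus_action V X s \<psi>"
    unfolding morphic_torus_action_def
  proof
    fix v assume v: "v \<in> V"
    obtain a where a: "\<And>c. \<forall>i\<in>{..<s}. c i \<noteq> 0 \<Longrightarrow> \<Theta> c v = (\<Prod>i<s. c i powi a i)"
      using \<Theta>(1)[OF v] unfolding laurent_def by blast
    let ?q = "\<lambda>k. mvar (Inl k) ^ nat (a k) * mvar (Inr (Inl k)) ^ nat (- a k) :: (nat + nat + 'v, 'k) mpoly"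
    let ?p = "(\<Prod>k<s. ?q k) * mvar (Inr (Inr v)) :: (nat + nat + 'v, 'k) mpoly"
    have "mvars (?q k) \<subseteq> {Inl k, Inr (Inl k)}" for k
      by (rule subset_trans[OF mvars_mult], rule Un_least;
          rule subset_trans[OF mvars_power]; rule subset_trans[OF mvars_mvar]; simp)
    then have "mvars (\<Prod>k<s. ?q k) \<subseteq> (\<Union>k<s. {Inl k, Inr (Inl k)})"
      by (intro subset_trans[OF mvars_prod] UN_mono) auto
    then have "mvars ?p \<subseteq> (\<Union>k<s. {Inl k, Inr (Inl k)}) \<union> {Inr (Inr v)}"
      by (intro subset_trans[OF mvars_mult] Un_mono mvars_mvar)
    also have "\<dots> \<subseteq> {..<s} <+> {..<s} <+> V" using v by auto
    finally have vars: "mvars ?p \<subseteq> {..<s} <+> {..<s} <+> V" .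
    moreover have "\<psi> t x v = meval ?p (case_sum t (case_sum (\<lambda>k. inverse (t k)) x))"
      if t: "t \<in> carrier (ST s)" and x: "x \<in> X" for t x
    proof -
      have "meval ?p (case_sum t (case_sum (\<lambda>k. inverse (t k)) x)) =
          (\<Prod>k<s. t k ^ nat (a k) * inverse (t k) ^ nat (- a k)) * x v"
        by (simp only: meval_mult meval_prod meval_power meval_mvar sum.case)
      also have "(\<Prod>k<s. t k ^ nat (a k) * inverse (t k) ^ nat (- a k)) = (\<Prod>k<s. t k powi a k)"
        by (rule prod.cong) (auto simp: power_int_def)
      finally show ?thesis unfolding \<psi>_apply[OF x v] a[OF nz[OF t]] by simp
    qed
    ultimately show "\<exists>p :: (nat + nat + 'v, 'k) mpoly. mvars p \<subseteq> {..<s} <+> {..<s} <+> V \<and>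
        (\<forall>t\<in>carrier (ST s). \<forall>x\<in>X.
           \<psi> t x v = meval p (case_sum t (case_sum (\<lambda>k. inverse (t k)) x)))"
      by blast
  qed
  then show ?thesis unfolding is_subtorus_def using subgroup_Tor \<psi>_iso by blast
qed

theorem automorphism_group:
  "is_maximal_torus V X Tor \<and>
   conj_action V X Tor \<in> hom (perm_group V fp) (AutoGroup (G\<lparr>carrier := Tor\<rparr>)) \<and>
   G \<cong> semidirect_product (perm_group V fp) (G\<lparr>carrier := Tor\<rparr>) (conj_action V X Tor)"
proof -
  have c: "conj_action V X Tor =
      (\<lambda>\<tau>. \<lambda>t\<in>Tor. perm_aut V X \<tau> \<otimes>\<^bsub>G\<^esub> t \<otimes>\<^bsub>G\<^esub> inv\<^bsub>G\<^esub> (perm_aut V X \<tau>))"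
    by (rule ext) (simp add: conj_action_def)
  note sd = semidirect_decomposition[OF group_G group_P subgroup_Tor perm_aut_hom conj_Tor perm_aut_Tor decomposition c]
  show ?thesis
    unfolding is_maximal_torus_def using is_subtorus_Tor subtorus_le_Tor sd by blast
qed

end

theorem theorem4:
  fixes n :: "nat \<Rightarrow> nat" and l :: "nat \<Rightarrow> nat \<Rightarrow> nat"
    and V :: "(nat \<times> nat) set"
    and f :: "(nat \<times> nat, 'k::{alg_closed_field, field_char_0}) mpoly"
    and X :: "(nat \<times> nat \<Rightarrow> 'k) set"
  assumes "\<forall>i\<in>{0..2}. n i \<ge> 1"
    and "V = trinomial_vars n"
    and "f = trinomial n l"
    and "X = zero_set V f"
    and "\<forall>i\<in>{0..2}. \<forall>j\<in>{1..n i}. l i j \<ge> 2"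
    and "\<forall>i\<in>{0..2}. \<forall>i'\<in>{0..2}. i \<noteq> i' \<longrightarrow>
           coprime (GCD j\<in>{1..n i}. l i j) (GCD j\<in>{1..n i'}. l i' j)"
  shows "\<exists>T. is_maximal_torus V X T \<and>
           conj_action V X T \<in> hom (perm_group V f) (AutoGroup ((aut_group V X)\<lparr>carrier := T\<rparr>)) \<and>
           aut_group V X \<cong>
             semidirect_product (perm_group V f) ((aut_group V X)\<lparr>carrier := T\<rparr>) (conj_action V X T)"
proof -
  define Vs where "Vs i = {i} \<times> {1..n i}" for i :: nat
  define l' where "l' = (\<lambda>(i, j). l i j)"
  have three: "{0..2} = {..<3::nat}" by auto
  have V: "V = (\<Union>i<3. Vs i)"
    unfolding assms(2) trinomial_vars_def three Vs_def by auto
  have prod: "(\<Prod>v\<in>Vs i. g v ^ l' v) = (\<Prod>j=1..n i. g (i, j) ^ l i j)"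
    for i and g :: "nat \<times> nat \<Rightarrow> 'b::comm_monoid_mult"
  proof -
    have "Vs i = Pair i ` {1..n i}" unfolding Vs_def by auto
    moreover have "inj_on (Pair i) {1..n i}" by (auto intro: inj_onI)
    ultimately show ?thesis by (simp only: prod.reindex o_def l'_def case_prod_conv)
  qed
  have f: "f = (\<Sum>i<3. \<Prod>v\<in>Vs i. mvar v ^ l' v)"
    unfolding assms(3) trinomial_def three prod ..
  have lim: "l' ` Vs i = l i ` {1..n i}" for i
    unfolding Vs_def l'_def by force
  interpret t: trinomial_hypersurface Vs l' X
  proof
    fix i assume i: "i < (3::nat)"
    show "finite (Vs i)" "Vs i \<noteq> {}" using assms(1) i by (auto simp: Vs_def three)
    show "2 \<le> l' v" if "v \<in> Vs i" for v using assms(5) i that by (auto simp: Vs_def l'_def three)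
    fix j assume j: "j < (3::nat)" "i \<noteq> j"
    show "Vs i \<inter> Vs j = {}" using j by (auto simp: Vs_def)
    show "coprime (Gcd (l' ` Vs i)) (Gcd (l' ` Vs j))"
      unfolding lim using assms(6) i j by (auto simp: three)
  next
    show "X = {x \<in> (\<Union>i<3. Vs i) \<rightarrow>\<^sub>E UNIV. (\<Sum>i<3. \<Prod>v\<in>Vs i. x v ^ l' v) = 0}"
      unfolding assms(4) zero_set_def V f by (simp add: meval_sum meval_prod meval_power)
  qed
  have "t.V = V" unfolding t.V_def V ..
  moreover have "t.fp = f" unfolding t.fp_def f ..
  ultimately show ?thesis using t.automorphism_group by auto
qed

end
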